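(* Let $\mathbf{K}$ be a $\lambda$-superstable abstract elementary class with $\lambda$-symmetry. If $\mathbf{K}$ is categorical in $\lambda$, then the frame of independent sequences of length less than $\lambda^+$ (with respect to $\lambda$-nonforking) has the symmetry property. That is: whenever $M_0\le_{\mathbf{K}}M_2\le_{\mathbf{K}}N$ are in $\mathbf{K}_\lambda$, $\bar a_1$ is a sequence from $N$ of length less than $\lambda^+$ that is independent in $(M_0,M_2,N)$, and $\bar a_2$ is a sequence from $M_2$ of length less than $\lambda^+$ that is independent in $(M_0,M_0,N)$, there are $M_1,N'\in\mathbf{K}_\lambda$ with $M_0\le_{\mathbf{K}}M_1\le_{\mathbf{K}}N'$, $N\le_{\mathbf{K}}N'$, all elements of $\bar a_1$ in $M_1$, and $\bar a_2$ independent in $(M_0,M_1,N')$.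
   Context: An abstract class is a pair $\mathbf{K}=(K,\le_{\mathbf{K}})$, where $K$ is a class of structures in a fixed vocabulary $\tau(\mathbf{K})$ and $\le_{\mathbf{K}}$ is a partial order on $K$ such that $M\le_{\mathbf{K}}N$ implies that $M$ is a substructure of $N$, and both $K$ and $\le_{\mathbf{K}}$ respect isomorphisms. A $\mathbf{K}$-embedding $f:M\to N$ is an isomorphism of $M$ onto $f[M]$ with $f[M]\le_{\mathbf{K}}N$; all maps between models are $\mathbf{K}$-embeddings, and $f:M\xrightarrow[A]{}N$ means $f$ fixes $A$ pointwise (similarly $f:M\cong_AN$). $|M|$ is the universe of $M$ and $\|M\|$ its cardinality. An abstract elementary class (AEC) is an abstract class in a finitary vocabulary satisfying: (Coherence) if $M_0\subseteq M_1\le_{\mathbf{K}}M_2$ and $M_0\le_{\mathbf{K}}M_2$ (all in $K$), then $M_0\le_{\mathbf{K}}M_1$; (Tarski-Vaught chain axioms) if $\langle M_i:i\in I\rangle$ is a $\le_{\mathbf{K}}$-directed system with union $M$, then $M\in K$, $M_i\le_{\mathbf{K}}M$ for all $i$, and if $M_i\le_{\mathbf{K}}N\in K$ for all $i$ then $M\le_{\mathbf{K}}N$; (Löwenheim-Skolem-Tarski) there is a cardinal $\theta\ge|\tau(\mathbf{K})|+\aleph_0$ such that for any $N\in K$ and $A\subseteq|N|$ there is $M\le_{\mathbf{K}}N$ with $A\subseteq|M|$ and $\|M\|\le|A|+\theta$; $\mathrm{LS}(\mathbf{K})$ is the least such $\theta$. $\mathbf{K}_\lambda$ is the class of models of cardinality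 $\lambda$. Categorical in $\lambda$: exactly one model of cardinality $\lambda$ up to isomorphism. Amalgamation: whenever $M_0\le_{\mathbf{K}}M_1,M_2$ there are $M_3$ and $f_\ell:M_\ell\xrightarrow[M_0]{}M_3$. Joint embedding: any two models embed in a common one. No maximal models: every model has a proper $\le_{\mathbf{K}}$-extension in the class. Orbital types: $\mathbf{tp}(b/A;N)$ is the equivalence class of $(b,A,N)$ under the transitive closure of: $(b_1,A,N_1)\sim(b_2,A,N_2)$ iff there are $N'\in K$ and $f_\ell:N_\ell\xrightarrow[A]{}N'$ with $f_1(b_1)=f_2(b_2)$. $\mathbf{S}(M)=\{\mathbf{tp}(b/M;N):M\le_{\mathbf{K}}N,\ b\in N\}$; restrictions and images of types under isomorphisms are defined naturally. A type over $M$ is nonalgebraic if it is not realized by an element of $M$. $\mathbf{K}$ is stable in $\lambda$ if $|\mathbf{S}(M)|\le\lambda$ for all $M\in\mathbf{K}_\lambda$. For $M,N\in\mathbf{K}_\lambda$, $N$ is universal over $M$ if $M\le_{\mathbf{K}}N$ and every $\le_{\mathbf{K}}$-extension of $M$ in $\mathbf{K}_\lambda$ embeds into $N$ over $M$. For a limit ordinal $\delta<\lambda^+$, $N$ is $(\lambda,\delta)$-limit over $M$ if there is an increasing continuous chain $\langle M_i:i\le\delta\rangle$ in $\mathbf{K}_\lambda$ with $M_0=M$, $M_\delta=N$, $M_{i+1}$ universal over $M_i$ for $i<\delta$. $N$ is a limit model if it is $(\lambda,\delta)$-limit over some $M$ for some $\delta$. For $p\in\mathbf{S}(N)$, $M\le_{\mathbf{K}}N$,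 $p$ does not $\lambda$-split over $M$ if whenever $N_1,N_2\in\mathbf{K}_\lambda$, $M\le_{\mathbf{K}}N_\ell\le_{\mathbf{K}}N$, and $f:N_1\cong_MN_2$, then $f(p\upharpoonright N_1)=p\upharpoonright N_2$. $\mathbf{K}$ is $\lambda$-superstable if: $\lambda\ge\mathrm{LS}(\mathbf{K})$ and $\mathbf{K}_\lambda\ne\emptyset$; $\mathbf{K}_\lambda$ has amalgamation, joint embedding, and no maximal models; $\mathbf{K}$ is stable in $\lambda$; and for every limit $\delta<\lambda^+$, increasing continuous $\langle M_i:i\le\delta\rangle$ in $\mathbf{K}_\lambda$ with $M_{i+1}$ universal over $M_i$, and $p\in\mathbf{S}(M_\delta)$, there is $i<\delta$ such that $p$ does not $\lambda$-split over $M_i$. In a $\lambda$-superstable $\mathbf{K}$, for limit models $M\le_{\mathbf{K}}N$ in $\mathbf{K}_\lambda$ and $p\in\mathbf{S}(N)$, $p$ does not ($\lambda$-)fork over $M$ if there is $M_0\in\mathbf{K}_\lambda$ such that $M$ is universal over $M_0$ and $p$ does not $\lambda$-split over $M_0$. (When $\mathbf{K}$ is moreover categorical in $\lambda$, all models in $\mathbf{K}_\lambda$ are limit.) $\mathbf{K}$ has $\lambda$-symmetry if for any limit models $M\le_{\mathbf{K}}N$ in $\mathbf{K}_\lambda$ and $a,b\in N$, the following are equivalent: (1) there are limit models $M_b\le_{\mathbf{K}}N_b$ in $\mathbf{K}_\lambda$ with $N\le_{\mathbf{K}}N_b$, $M\le_{\mathbf{K}}M_b$, $b\in M_b$, and $\mathbf{tp}(a/M_b;N_b)$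 does not fork over $M$; (2) the same with the roles of $a$ and $b$ exchanged. Independent sequences: let $M\le_{\mathbf{K}}M'\le_{\mathbf{K}}N$ be in $\mathbf{K}_\lambda$ and $\alpha<\lambda^+$. A sequence $\langle a_i:i<\alpha\rangle$ of elements of $N$ is independent in $(M,M',N)$ if there are $N^+\in\mathbf{K}_\lambda$ with $N\le_{\mathbf{K}}N^+$ and an increasing continuous chain $\langle M_i:i\le\alpha\rangle$ in $\mathbf{K}_\lambda$ with $M'\le_{\mathbf{K}}M_0$, $M_\alpha\le_{\mathbf{K}}N^+$, such that for every $i<\alpha$, $a_i\in M_{i+1}$ and $\mathbf{tp}(a_i/M_i;M_{i+1})$ is nonalgebraic and does not fork over $M$. In the frame of independent sequences of length less than $\lambda^+$, the basic types over $M$ are the types of sequences independent in $(M,M,N)$, and $\bar a$ is free from $M'$ over $M$ in $N$ when $\bar a$ is independent in $(M,M',N)$. *)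

theory Defs
  imports Main
begin

unbundle cardinal_syntax

text \<open>
  Universes of structures are subsets of a type \<open>'a\<close>, which plays the role of the class of all
  sets: an abstract class is a collection of structures on subsets of \<open>'a\<close>, closed under
  isomorphic copies inside \<open>'a\<close>. Results hold for every \<open>'a\<close>. For a class that is superstable in
  \<open>\<kappa>\<close> (defined below) \<open>'a\<close> has more than \<open>\<kappa>\<close> elements: some model of size \<open>\<kappa>\<close> exists, and if
  \<open>'a\<close> had only \<open>\<kappa>\<close> elements then a copy of it would have all of \<open>'a\<close> as its universe and be
  maximal.
\<close>

section \<open>Structures\<close>

record ('f, 'r) vocabulary =
  fun_syms :: "'f set"
  rel_syms :: "'r set"
  fun_arity :: "'f \<Rightarrow> nat"
  rel_arity :: "'r \<Rightarrow> nat"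

record ('a, 'f, 'r) struct =
  universe :: "'a set"
  fun_int :: "'f \<Rightarrow> 'a list \<Rightarrow> 'a"
  rel_int :: "'r \<Rightarrow> 'a list \<Rightarrow> bool"

definition tuples :: "'a set \<Rightarrow> nat \<Rightarrow> 'a list set" where
  "tuples A n = {xs. length xs = n \<and> set xs \<subseteq> A}"

text \<open>
  Interpretations take fixed default values outside their domains, so that equality of structures
  is the intended one.
\<close>

definition is_struct :: "('f, 'r) vocabulary \<Rightarrow> ('a, 'f, 'r) struct \<Rightarrow> bool" where
  "is_struct \<tau> M \<longleftrightarrow>
     (\<forall>F\<in>fun_syms \<tau>. \<forall>xs\<in>tuples (universe M) (fun_arity \<tau> F). fun_int M F xs \<in> universe M) \<and>
     (\<forall>F xs. \<not> (F \<in> fun_syms \<tau> \<and> xs \<in> tuples (universe M) (fun_arity \<tau> F)) \<longrightarrow>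
        fun_int M F xs = undefined) \<and>
     (\<forall>R xs. rel_int M R xs \<longrightarrow> R \<in> rel_syms \<tau> \<and> xs \<in> tuples (universe M) (rel_arity \<tau> R))"

definition substructure ::
    "('f, 'r) vocabulary \<Rightarrow> ('a, 'f, 'r) struct \<Rightarrow> ('a, 'f, 'r) struct \<Rightarrow> bool" where
  "substructure \<tau> M N \<longleftrightarrow>
     is_struct \<tau> M \<and> is_struct \<tau> N \<and> universe M \<subseteq> universe N \<and>
     (\<forall>F\<in>fun_syms \<tau>. \<forall>xs\<in>tuples (universe M) (fun_arity \<tau> F). fun_int M F xs = fun_int N F xs) \<and>
     (\<forall>R\<in>rel_syms \<tau>. \<forall>xs\<in>tuples (universe M) (rel_arity \<tau> R). rel_int M R xs = rel_int N R xs)"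

definition struct_iso ::
    "('f, 'r) vocabulary \<Rightarrow> ('a \<Rightarrow> 'a) \<Rightarrow> ('a, 'f, 'r) struct \<Rightarrow> ('a, 'f, 'r) struct \<Rightarrow> bool" where
  "struct_iso \<tau> f M N \<longleftrightarrow>
     is_struct \<tau> M \<and> is_struct \<tau> N \<and> bij_betw f (universe M) (universe N) \<and>
     (\<forall>F\<in>fun_syms \<tau>. \<forall>xs\<in>tuples (universe M) (fun_arity \<tau> F).
        f (fun_int M F xs) = fun_int N F (map f xs)) \<and>
     (\<forall>R\<in>rel_syms \<tau>. \<forall>xs\<in>tuples (universe M) (rel_arity \<tau> R).
        rel_int M R xs = rel_int N R (map f xs))"

text \<open>
  As symbols have finite arity, a nonempty directed family of structures (under the substructure
  relation) has exactly one union in the following sense.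
\<close>

definition is_union ::
    "('f, 'r) vocabulary \<Rightarrow> ('a, 'f, 'r) struct set \<Rightarrow> ('a, 'f, 'r) struct \<Rightarrow> bool" where
  "is_union \<tau> D U \<longleftrightarrow>
     is_struct \<tau> U \<and> universe U = (\<Union>M\<in>D. universe M) \<and> (\<forall>M\<in>D. substructure \<tau> M U)"


section \<open>Abstract elementary classes\<close>

record ('a, 'f, 'r) class_data =
  voc :: "('f, 'r) vocabulary"
  models :: "('a, 'f, 'r) struct set"
  le :: "('a, 'f, 'r) struct \<Rightarrow> ('a, 'f, 'r) struct \<Rightarrow> bool"

definition abstract_class :: "('a, 'f, 'r) class_data \<Rightarrow> bool" where
  "abstract_class K \<longleftrightarrow>
     (\<forall>M\<in>models K. is_struct (voc K) M) \<and>
     (\<forall>M N. le K M N \<longrightarrow> M \<in> models K \<and> N \<in> models K \<and> substructure (voc K) M N) \<and>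
     (\<forall>M\<in>models K. le K M M) \<and>
     (\<forall>M N. le K M N \<longrightarrow> le K N M \<longrightarrow> M = N) \<and>
     (\<forall>M N P. le K M N \<longrightarrow> le K N P \<longrightarrow> le K M P) \<and>
     (\<forall>M N f. M \<in> models K \<longrightarrow> struct_iso (voc K) f M N \<longrightarrow> N \<in> models K) \<and>
     (\<forall>M N M' N' f. le K M N \<longrightarrow> struct_iso (voc K) f N N' \<longrightarrow> struct_iso (voc K) f M M' \<longrightarrow>
        le K M' N')"

definition coherence :: "('a, 'f, 'r) class_data \<Rightarrow> bool" where
  "coherence K \<longleftrightarrow>
     (\<forall>M0\<in>models K. \<forall>M1 M2. substructure (voc K) M0 M1 \<longrightarrow> le K M1 M2 \<longrightarrow> le K M0 M2 \<longrightarrow>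
        le K M0 M1)"

text \<open>
  A directed system is given by the set of its members; its index set may be taken to be that set,
  ordered by \<open>le K\<close>.
\<close>

definition directed_system :: "('a, 'f, 'r) class_data \<Rightarrow> ('a, 'f, 'r) struct set \<Rightarrow> bool" where
  "directed_system K D \<longleftrightarrow>
     D \<noteq> {} \<and> D \<subseteq> models K \<and> (\<forall>M\<in>D. \<forall>N\<in>D. \<exists>P\<in>D. le K M P \<and> le K N P)"

definition tarski_vaught :: "('a, 'f, 'r) class_data \<Rightarrow> bool" where
  "tarski_vaught K \<longleftrightarrow>
     (\<forall>D U. directed_system K D \<longrightarrow> is_union (voc K) D U \<longrightarrow>
        U \<in> models K \<and> (\<forall>M\<in>D. le K M U) \<and>
        (\<forall>N\<in>models K. (\<forall>M\<in>D. le K M N) \<longrightarrow> le K U N))"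

definition lst_at :: "('a, 'f, 'r) class_data \<Rightarrow> 'd rel \<Rightarrow> bool" where
  "lst_at K \<theta> \<longleftrightarrow>
     Card_order \<theta> \<and> |fun_syms (voc K) <+> rel_syms (voc K)| +c natLeq \<le>o \<theta> \<and>
     (\<forall>N\<in>models K. \<forall>A. A \<subseteq> universe N \<longrightarrow>
        (\<exists>M. le K M N \<and> A \<subseteq> universe M \<and> |universe M| \<le>o |A| +c \<theta> ))"

text \<open>
  The cardinals \<open>\<theta>\<close> are represented on a type large enough to contain a copy of the least
  cardinal with the property \<open>lst_at K\<close>. Since all models live on subsets of \<open>'a\<close>, some
  \<open>\<theta>\<close> always works; the content of the axiom is carried by the condition \<open>LS K \<le>o \<kappa>\<close>, with
  \<open>\<kappa>\<close> smaller than the size of \<open>'a\<close>, in the definition of superstability.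
\<close>

definition aec :: "('a, 'f, 'r) class_data \<Rightarrow> bool" where
  "aec K \<longleftrightarrow>
     abstract_class K \<and> coherence K \<and> tarski_vaught K \<and>
     (\<exists>\<theta> :: ('a + 'f + 'r + nat) rel. lst_at K \<theta>)"

definition LS :: "('a, 'f, 'r) class_data \<Rightarrow> ('a + 'f + 'r + nat) rel" where
  "LS K = (SOME \<theta>. lst_at K \<theta> \<and>
     (\<forall>\<theta>' :: ('a + 'f + 'r + nat) rel. lst_at K \<theta>' \<longrightarrow> \<theta> \<le>o \<theta>'))"

definition models_of_card ::
    "('a, 'f, 'r) class_data \<Rightarrow> 'c rel \<Rightarrow> ('a, 'f, 'r) struct set" where
  "models_of_card K \<kappa> = {M. M \<in> models K \<and> |universe M| =o \<kappa>}"

definition K_embedding ::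
    "('a, 'f, 'r) class_data \<Rightarrow> ('a \<Rightarrow> 'a) \<Rightarrow> ('a, 'f, 'r) struct \<Rightarrow> ('a, 'f, 'r) struct \<Rightarrow> bool" where
  "K_embedding K f M N \<longleftrightarrow> (\<exists>M'. struct_iso (voc K) f M M' \<and> le K M' N)"

definition fixes_pointwise :: "('a \<Rightarrow> 'a) \<Rightarrow> 'a set \<Rightarrow> bool" where
  "fixes_pointwise f A \<longleftrightarrow> (\<forall>x\<in>A. f x = x)"

definition categorical :: "('a, 'f, 'r) class_data \<Rightarrow> 'c rel \<Rightarrow> bool" where
  "categorical K \<kappa> \<longleftrightarrow>
     models_of_card K \<kappa> \<noteq> {} \<and>
     (\<forall>M\<in>models_of_card K \<kappa>. \<forall>N\<in>models_of_card K \<kappa>. \<exists>f. struct_iso (voc K) f M N)"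

definition amalgamation :: "('a, 'f, 'r) class_data \<Rightarrow> 'c rel \<Rightarrow> bool" where
  "amalgamation K \<kappa> \<longleftrightarrow>
     (\<forall>M0\<in>models_of_card K \<kappa>. \<forall>M1\<in>models_of_card K \<kappa>. \<forall>M2\<in>models_of_card K \<kappa>.
        le K M0 M1 \<longrightarrow> le K M0 M2 \<longrightarrow>
        (\<exists>M3\<in>models_of_card K \<kappa>. \<exists>f1 f2.
           K_embedding K f1 M1 M3 \<and> fixes_pointwise f1 (universe M0) \<and>
           K_embedding K f2 M2 M3 \<and> fixes_pointwise f2 (universe M0)))"

definition joint_embedding :: "('a, 'f, 'r) class_data \<Rightarrow> 'c rel \<Rightarrow> bool" where
  "joint_embedding K \<kappa> \<longleftrightarrow>
     (\<forall>M1\<in>models_of_card K \<kappa>. \<forall>M2\<in>models_of_card K \<kappa>.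
        \<exists>M3\<in>models_of_card K \<kappa>. \<exists>f1 f2. K_embedding K f1 M1 M3 \<and> K_embedding K f2 M2 M3)"

definition no_maximal_models :: "('a, 'f, 'r) class_data \<Rightarrow> 'c rel \<Rightarrow> bool" where
  "no_maximal_models K \<kappa> \<longleftrightarrow>
     (\<forall>M\<in>models_of_card K \<kappa>. \<exists>N\<in>models_of_card K \<kappa>. le K M N \<and> M \<noteq> N)"


section \<open>Orbital types\<close>

type_synonym ('a, 'f, 'r) pointed = "'a \<times> 'a set \<times> ('a, 'f, 'r) struct"

definition tp_step :: "('a, 'f, 'r) class_data \<Rightarrow> ('a, 'f, 'r) pointed rel" where
  "tp_step K = {((b1, A, N1), (b2, A, N2)) | b1 b2 A N1 N2.
     N1 \<in> models K \<and> N2 \<in> models K \<and> A \<subseteq> universe N1 \<and> A \<subseteq> universe N2 \<and>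
     b1 \<in> universe N1 \<and> b2 \<in> universe N2 \<and>
     (\<exists>N'\<in>models K. \<exists>f1 f2.
        K_embedding K f1 N1 N' \<and> fixes_pointwise f1 A \<and>
        K_embedding K f2 N2 N' \<and> fixes_pointwise f2 A \<and> f1 b1 = f2 b2)}"

definition tp ::
    "('a, 'f, 'r) class_data \<Rightarrow> 'a \<Rightarrow> 'a set \<Rightarrow> ('a, 'f, 'r) struct \<Rightarrow> ('a, 'f, 'r) pointed set" where
  "tp K b A N = (tp_step K)\<^sup>+ `` {(b, A, N)}"

definition types_over ::
    "('a, 'f, 'r) class_data \<Rightarrow> ('a, 'f, 'r) struct \<Rightarrow> ('a, 'f, 'r) pointed set set" where
  "types_over K M = {tp K b (universe M) N | b N. le K M N \<and> b \<in> universe N}"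

text \<open>
  Restriction and image of a type are computed on representatives; the image uses an extension
  \<open>g\<close> of \<open>f\<close> to an isomorphism between the ambient models. For types over a model with fewer
  elements than \<open>'a\<close> such an extension exists and the result does not depend on the choices, so
  that the unions below are unions of a single type.
\<close>

definition tp_restrict ::
    "('a, 'f, 'r) class_data \<Rightarrow> ('a, 'f, 'r) pointed set \<Rightarrow> 'a set \<Rightarrow> ('a, 'f, 'r) pointed set" where
  "tp_restrict K p B = \<Union>{tp K b B N | b A N. (b, A, N) \<in> p}"

definition tp_image ::
    "('a, 'f, 'r) class_data \<Rightarrow> ('a \<Rightarrow> 'a) \<Rightarrow> ('a, 'f, 'r) pointed set \<Rightarrow> ('a, 'f, 'r) pointed set" where
  "tp_image K f p = \<Union>{tp K (g b) (f ` A) N' | b A N N' g.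
     (b, A, N) \<in> p \<and> struct_iso (voc K) g N N' \<and> (\<forall>x\<in>A. g x = f x)}"

definition nonalgebraic ::
    "('a, 'f, 'r) class_data \<Rightarrow> ('a, 'f, 'r) pointed set \<Rightarrow> ('a, 'f, 'r) struct \<Rightarrow> bool" where
  "nonalgebraic K p M \<longleftrightarrow> \<not> (\<exists>c\<in>universe M. tp K c (universe M) M = p)"

definition stable_in :: "('a, 'f, 'r) class_data \<Rightarrow> 'c rel \<Rightarrow> bool" where
  "stable_in K \<kappa> \<longleftrightarrow> (\<forall>M\<in>models_of_card K \<kappa>. |types_over K M| \<le>o \<kappa>)"


section \<open>Ordinals below the successor of a cardinal\<close>

text \<open>
  \<open>cardSuc \<kappa>\<close> is a well-order of order type \<open>\<kappa>\<^sup>+\<close>, so the elements of its field represent exactly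
  the ordinals below \<open>\<kappa>\<^sup>+\<close>, and \<open>underS (cardSuc \<kappa>) i\<close> is the set of ordinals below \<open>i\<close>. When
  \<open>\<kappa>\<close> is infinite, every such ordinal has a successor there.
\<close>

definition ords :: "'c rel \<Rightarrow> 'c set set" where
  "ords \<kappa> = Field (cardSuc \<kappa>)"

definition ord_le :: "'c rel \<Rightarrow> 'c set \<Rightarrow> 'c set \<Rightarrow> bool" where
  "ord_le \<kappa> i j \<longleftrightarrow> (i, j) \<in> cardSuc \<kappa>"

definition below :: "'c rel \<Rightarrow> 'c set \<Rightarrow> 'c set set" where
  "below \<kappa> i = underS (cardSuc \<kappa>) i"

definition ord_zero :: "'c rel \<Rightarrow> 'c set" where
  "ord_zero \<kappa> = wo_rel.minim (cardSuc \<kappa>) (ords \<kappa>)"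

definition ord_suc :: "'c rel \<Rightarrow> 'c set \<Rightarrow> 'c set" where
  "ord_suc \<kappa> i = wo_rel.suc (cardSuc \<kappa>) {i}"

definition limit_ord :: "'c rel \<Rightarrow> 'c set \<Rightarrow> bool" where
  "limit_ord \<kappa> i \<longleftrightarrow> i \<in> ords \<kappa> \<and> i \<noteq> ord_zero \<kappa> \<and> \<not> (\<exists>j\<in>below \<kappa> i. i = ord_suc \<kappa> j)"

text \<open>Increasing continuous chains \<open>\<langle>M i : i \<le> \<delta>\<rangle>\<close> of models of size \<open>\<kappa>\<close>.\<close>

definition cont_chain ::
    "('a, 'f, 'r) class_data \<Rightarrow> 'c rel \<Rightarrow> 'c set \<Rightarrow> ('c set \<Rightarrow> ('a, 'f, 'r) struct) \<Rightarrow> bool" where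
  "cont_chain K \<kappa> \<delta> M \<longleftrightarrow>
     (\<forall>i. ord_le \<kappa> i \<delta> \<longrightarrow> M i \<in> models_of_card K \<kappa>) \<and>
     (\<forall>i j. ord_le \<kappa> i j \<longrightarrow> ord_le \<kappa> j \<delta> \<longrightarrow> le K (M i) (M j)) \<and>
     (\<forall>i. limit_ord \<kappa> i \<longrightarrow> ord_le \<kappa> i \<delta> \<longrightarrow> is_union (voc K) (M ` below \<kappa> i) (M i))"


section \<open>Limit models, superstability, nonforking and symmetry\<close>

definition universal_over ::
    "('a, 'f, 'r) class_data \<Rightarrow> 'c rel \<Rightarrow> ('a, 'f, 'r) struct \<Rightarrow> ('a, 'f, 'r) struct \<Rightarrow> bool" where
  "universal_over K \<kappa> N M \<longleftrightarrow>
     M \<in> models_of_card K \<kappa> \<and> N \<in> models_of_card K \<kappa> \<and> le K M N \<and>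
     (\<forall>M'\<in>models_of_card K \<kappa>. le K M M' \<longrightarrow>
        (\<exists>f. K_embedding K f M' N \<and> fixes_pointwise f (universe M)))"

definition limit_over ::
    "('a, 'f, 'r) class_data \<Rightarrow> 'c rel \<Rightarrow> 'c set \<Rightarrow> ('a, 'f, 'r) struct \<Rightarrow> ('a, 'f, 'r) struct \<Rightarrow> bool" where
  "limit_over K \<kappa> \<delta> N M \<longleftrightarrow>
     (\<exists>Ms. cont_chain K \<kappa> \<delta> Ms \<and> Ms (ord_zero \<kappa>) = M \<and> Ms \<delta> = N \<and>
        (\<forall>i\<in>below \<kappa> \<delta>. universal_over K \<kappa> (Ms (ord_suc \<kappa> i)) (Ms i)))"

definition limit_model ::
    "('a, 'f, 'r) class_data \<Rightarrow> 'c rel \<Rightarrow> ('a, 'f, 'r) struct \<Rightarrow> bool" where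
  "limit_model K \<kappa> N \<longleftrightarrow> (\<exists>M \<delta>. limit_ord \<kappa> \<delta> \<and> limit_over K \<kappa> \<delta> N M)"

text \<open>\<open>nonsplitting K \<kappa> p M N\<close>: the type \<open>p\<close> over \<open>N\<close> does not \<open>\<kappa>\<close>-split over \<open>M\<close>.\<close>

definition nonsplitting ::
    "('a, 'f, 'r) class_data \<Rightarrow> 'c rel \<Rightarrow> ('a, 'f, 'r) pointed set \<Rightarrow>
      ('a, 'f, 'r) struct \<Rightarrow> ('a, 'f, 'r) struct \<Rightarrow> bool" where
  "nonsplitting K \<kappa> p M N \<longleftrightarrow>
     p \<in> types_over K N \<and> le K M N \<and>
     (\<forall>N1\<in>models_of_card K \<kappa>. \<forall>N2\<in>models_of_card K \<kappa>. \<forall>f.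
        le K M N1 \<longrightarrow> le K N1 N \<longrightarrow> le K M N2 \<longrightarrow> le K N2 N \<longrightarrow>
        struct_iso (voc K) f N1 N2 \<longrightarrow> fixes_pointwise f (universe M) \<longrightarrow>
        tp_image K f (tp_restrict K p (universe N1)) = tp_restrict K p (universe N2))"

definition superstable :: "('a, 'f, 'r) class_data \<Rightarrow> 'c rel \<Rightarrow> bool" where
  "superstable K \<kappa> \<longleftrightarrow>
     LS K \<le>o \<kappa> \<and> models_of_card K \<kappa> \<noteq> {} \<and>
     amalgamation K \<kappa> \<and> joint_embedding K \<kappa> \<and> no_maximal_models K \<kappa> \<and>
     stable_in K \<kappa> \<and>
     (\<forall>\<delta> Ms p. limit_ord \<kappa> \<delta> \<longrightarrow> cont_chain K \<kappa> \<delta> Ms \<longrightarrow>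
        (\<forall>i\<in>below \<kappa> \<delta>. universal_over K \<kappa> (Ms (ord_suc \<kappa> i)) (Ms i)) \<longrightarrow>
        p \<in> types_over K (Ms \<delta>) \<longrightarrow>
        (\<exists>i\<in>below \<kappa> \<delta>. nonsplitting K \<kappa> p (Ms i) (Ms \<delta>)))"

text \<open>
  \<open>nonforking K \<kappa> p M N\<close>: the type \<open>p\<close> over the limit model \<open>N\<close> does not \<open>\<kappa>\<close>-fork over the
  limit model \<open>M\<close>. The standing assumptions under which the notion is used are part of the
  definition.
\<close>

definition nonforking ::
    "('a, 'f, 'r) class_data \<Rightarrow> 'c rel \<Rightarrow> ('a, 'f, 'r) pointed set \<Rightarrow>
      ('a, 'f, 'r) struct \<Rightarrow> ('a, 'f, 'r) struct \<Rightarrow> bool" where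
  "nonforking K \<kappa> p M N \<longleftrightarrow>
     limit_model K \<kappa> M \<and> limit_model K \<kappa> N \<and> le K M N \<and> p \<in> types_over K N \<and>
     (\<exists>M0\<in>models_of_card K \<kappa>. universal_over K \<kappa> M M0 \<and> nonsplitting K \<kappa> p M0 N)"

definition symmetry_witness ::
    "('a, 'f, 'r) class_data \<Rightarrow> 'c rel \<Rightarrow> ('a, 'f, 'r) struct \<Rightarrow> ('a, 'f, 'r) struct \<Rightarrow>
      'a \<Rightarrow> 'a \<Rightarrow> bool" where
  "symmetry_witness K \<kappa> M N a b \<longleftrightarrow>
     (\<exists>Mb Nb. limit_model K \<kappa> Mb \<and> limit_model K \<kappa> Nb \<and> le K Mb Nb \<and>
        le K N Nb \<and> le K M Mb \<and> b \<in> universe Mb \<and>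
        nonforking K \<kappa> (tp K a (universe Mb) Nb) M Mb)"

definition has_symmetry :: "('a, 'f, 'r) class_data \<Rightarrow> 'c rel \<Rightarrow> bool" where
  "has_symmetry K \<kappa> \<longleftrightarrow>
     (\<forall>M N a b. limit_model K \<kappa> M \<longrightarrow> limit_model K \<kappa> N \<longrightarrow> le K M N \<longrightarrow>
        a \<in> universe N \<longrightarrow> b \<in> universe N \<longrightarrow>
        symmetry_witness K \<kappa> M N a b = symmetry_witness K \<kappa> M N b a)"


section \<open>Independent sequences\<close>

text \<open>
  \<open>independent K \<kappa> \<alpha> a M M' N\<close>: the sequence \<open>\<langle>a i : i < \<alpha>\<rangle>\<close> is independent in \<open>(M, M', N)\<close>.
\<close>

definition independent ::
    "('a, 'f, 'r) class_data \<Rightarrow> 'c rel \<Rightarrow> 'c set \<Rightarrow> ('c set \<Rightarrow> 'a) \<Rightarrow>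
      ('a, 'f, 'r) struct \<Rightarrow> ('a, 'f, 'r) struct \<Rightarrow> ('a, 'f, 'r) struct \<Rightarrow> bool" where
  "independent K \<kappa> \<alpha> a M M' N \<longleftrightarrow>
     \<alpha> \<in> ords \<kappa> \<and>
     M \<in> models_of_card K \<kappa> \<and> M' \<in> models_of_card K \<kappa> \<and> N \<in> models_of_card K \<kappa> \<and>
     le K M M' \<and> le K M' N \<and> (\<forall>i\<in>below \<kappa> \<alpha>. a i \<in> universe N) \<and>
     (\<exists>Np\<in>models_of_card K \<kappa>. \<exists>Ms.
        le K N Np \<and> cont_chain K \<kappa> \<alpha> Ms \<and> le K M' (Ms (ord_zero \<kappa>)) \<and> le K (Ms \<alpha>) Np \<and>
        (\<forall>i\<in>below \<kappa> \<alpha>. a i \<in> universe (Ms (ord_suc \<kappa> i)) \<and>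
           nonalgebraic K (tp K (a i) (universe (Ms i)) (Ms (ord_suc \<kappa> i))) (Ms i) \<and>
           nonforking K \<kappa> (tp K (a i) (universe (Ms i)) (Ms (ord_suc \<kappa> i))) M (Ms i)))"


end

theory Submission
  imports Defs
begin

text \<open>
  Working inside a homogeneous model \<open>C\<close> of size \<open>\<kappa>\<^sup>+\<close> turns types into orbits of automorphisms and
  \<open>\<kappa>\<close>-sized submodels into a family of subsets of \<open>C\<close> on which \<open>le K\<close> is inclusion. Extension and
  uniqueness over a common base are the usual consequences of nonsplitting over a model with a
  universal extension; uniqueness over different bases, and with it transitivity, comes from iterating
  a single automorphism until superstability is contradicted.

  Given \<open>\<langle>a i\<rangle>\<close> free over a model containing \<open>\<langle>b j\<rangle>\<close>, one element \<open>a i\<close> at a time is absorbed into a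
  whole chain \<open>\<langle>Q j\<rangle>\<close> witnessing the independence of \<open>\<langle>b j\<rangle>\<close>: along \<open>j\<close> one alternately applies
  extension and the symmetry hypothesis, which lets a copy of \<open>Q j\<close> grow independently of \<open>a i\<close> while
  \<open>b j\<close> stays free from a model containing \<open>a i\<close>. Keeping every new chain universal over the
  previous one makes nonforking pass to unions, so the process can be iterated through all \<open>i\<close>. The
  chains need not be continuous: unions are inserted only at the end, where monotonicity suffices.
\<close>

section \<open>Ordinals below the successor of an infinite cardinal\<close>

text \<open>The symmetry hypothesis speaks of two single elements, while here two whole sequences
  have to change places. Each \<open>b j\<close> must end up free over a model containing every
  \<open>a i\<close>, so the recursions move models by automorphisms as they go and carry the copy
  back only when they are finished. Limit stages are the other obstacle. Local character speaks only
  of chains whose later members are universal over the earlier ones, so universality rather than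
  continuity has to be an invariant of the recursions. Categoricity enters twice: one universal step
  found in some limit model can be copied over every model of size \<kappa>, and all models of size
  \<kappa> become limit, so that nonforking makes sense over each of them. That a limit model exists
  at all is read off from the nonforking clause in the independence of a nonempty first sequence. If
  the first sequence is empty, \<open>M0\<close> serves as \<open>M1\<close>; if the second is
  empty, \<open>N\<close> does.\<close>

locale infinite_card =
  fixes \<kappa> :: "'c rel"
  assumes card_order: "Card_order \<kappa>"
    and infinite_Field: "infinite (Field \<kappa>)"
begin

lemma Well_order_cardSuc: "Well_order (cardSuc \<kappa>)"
  using cardSuc_Card_order[OF card_order] by (simp add: card_order_on_well_order_on)

lemma wo_rel_cardSuc: "wo_rel (cardSuc \<kappa>)"
  using Well_order_cardSuc by (simp add: wo_rel_def)

lemma infinite_ords: "infinite (ords \<kappa>)"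
  using cardSuc_finite[OF card_order] infinite_Field by (simp add: ords_def)

lemma below_iff: "j \<in> below \<kappa> i \<longleftrightarrow> ord_le \<kappa> j i \<and> j \<noteq> i"
  by (auto simp: below_def underS_def ord_le_def)

lemma below_ords: "j \<in> below \<kappa> i \<Longrightarrow> j \<in> ords \<kappa>" "j \<in> below \<kappa> i \<Longrightarrow> i \<in> ords \<kappa>"
  by (auto simp: below_def underS_def ords_def Field_def)

lemma ord_le_ords: "ord_le \<kappa> i j \<Longrightarrow> i \<in> ords \<kappa>" "ord_le \<kappa> i j \<Longrightarrow> j \<in> ords \<kappa>"
  by (auto simp: ord_le_def ords_def Field_def)

lemma ord_le_refl: "i \<in> ords \<kappa> \<Longrightarrow> ord_le \<kappa> i i"
  using wo_rel.REFL[OF wo_rel_cardSuc] by (auto simp: ords_def ord_le_def refl_on_def)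

lemma ord_le_trans: "ord_le \<kappa> i j \<Longrightarrow> ord_le \<kappa> j k \<Longrightarrow> ord_le \<kappa> i k"
  using wo_rel.TRANS[OF wo_rel_cardSuc] unfolding ord_le_def by (meson transD)

lemma ord_le_antisym: "ord_le \<kappa> i j \<Longrightarrow> ord_le \<kappa> j i \<Longrightarrow> i = j"
  using wo_rel.ANTISYM[OF wo_rel_cardSuc] unfolding ord_le_def by (meson antisymD)

lemma below_trans: "i \<in> below \<kappa> j \<Longrightarrow> j \<in> below \<kappa> k \<Longrightarrow> i \<in> below \<kappa> k"
  using ord_le_trans ord_le_antisym unfolding below_iff by blast

lemma below_irrefl: "i \<notin> below \<kappa> i"
  by (simp add: below_iff)

lemma below_asym: "i \<in> below \<kappa> j \<Longrightarrow> j \<notin> below \<kappa> i"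
  using ord_le_antisym by (auto simp: below_iff)

lemma below_le_trans: "i \<in> below \<kappa> j \<Longrightarrow> ord_le \<kappa> j k \<Longrightarrow> i \<in> below \<kappa> k"
  using ord_le_trans ord_le_antisym unfolding below_iff by blast

lemma le_below_trans: "ord_le \<kappa> i j \<Longrightarrow> j \<in> below \<kappa> k \<Longrightarrow> i \<in> below \<kappa> k"
  using ord_le_trans ord_le_antisym unfolding below_iff by blast

lemma ord_total:
  assumes "i \<in> ords \<kappa>" "j \<in> ords \<kappa>"
  obtains "i \<in> below \<kappa> j" | "i = j" | "j \<in> below \<kappa> i"
  using assms wo_rel.TOTALS[OF wo_rel_cardSuc] unfolding below_iff ord_le_def ords_def by blast

lemma not_below_iff: "i \<in> ords \<kappa> \<Longrightarrow> j \<in> ords \<kappa> \<Longrightarrow> i \<notin> below \<kappa> j \<longleftrightarrow> ord_le \<kappa> j i"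
  by (metis below_iff below_asym ord_le_refl ord_total)

lemma below_or_eq: "ord_le \<kappa> i j \<Longrightarrow> i \<in> below \<kappa> j \<or> i = j"
  by (auto simp: below_iff)

lemma wf_below: "wf {(i, j). i \<in> below \<kappa> j}"
proof -
  have "{(i, j). i \<in> below \<kappa> j} = cardSuc \<kappa> - Id"
    by (auto simp: below_def underS_def)
  then show ?thesis
    using wo_rel.WF[OF wo_rel_cardSuc] by simp
qed

lemma ord_least:
  assumes "S \<noteq> {}" "S \<subseteq> ords \<kappa>"
  obtains i where "i \<in> S" "\<And>j. j \<in> S \<Longrightarrow> ord_le \<kappa> i j"
proof -
  obtain i where "i \<in> S" "\<And>j. j \<in> below \<kappa> i \<Longrightarrow> j \<notin> S"
    using wfE_min[OF wf_below, of _ S] assms(1) by (metis (mono_tags, lifting) case_prodI ex_in_conv mem_Collect_eq)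
  then show ?thesis
    using that assms(2) not_below_iff by (metis subsetD)
qed

lemma ord_zero_ords: "ord_zero \<kappa> \<in> ords \<kappa>"
  and ord_zero_le: "i \<in> ords \<kappa> \<Longrightarrow> ord_le \<kappa> (ord_zero \<kappa>) i"
proof -
  have ne: "ords \<kappa> \<noteq> {}" using infinite_ords by auto
  show "ord_zero \<kappa> \<in> ords \<kappa>"
    using wo_rel.minim_in[OF wo_rel_cardSuc, of "ords \<kappa>"] ne by (simp add: ord_zero_def ords_def)
  show "i \<in> ords \<kappa> \<Longrightarrow> ord_le \<kappa> (ord_zero \<kappa>) i"
    using wo_rel.minim_least[OF wo_rel_cardSuc, of "ords \<kappa>"] by (simp add: ord_zero_def ords_def ord_le_def)
qed

lemma below_zero: "below \<kappa> (ord_zero \<kappa>) = {}"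
  using ord_zero_le below_asym below_iff below_ords ord_le_antisym by blast

lemma zero_below: "i \<in> ords \<kappa> \<Longrightarrow> i \<noteq> ord_zero \<kappa> \<Longrightarrow> ord_zero \<kappa> \<in> below \<kappa> i"
  using ord_zero_le by (auto simp: below_iff)

lemma card_below: "|below \<kappa> i| \<le>o \<kappa>"
proof (cases "i \<in> ords \<kappa>")
  case True
  then have "|below \<kappa> i| <o cardSuc \<kappa>"
    unfolding below_def using cardSuc_Card_order[OF card_order] card_of_underS by (auto simp: ords_def)
  then show ?thesis
    using cardSuc_ordLeq_ordLess[OF card_order card_of_Card_order] by blast
next
  case False
  then have "below \<kappa> i = {}" using below_ords by blast
  then show ?thesis using card_order card_of_empty1 card_order_on_well_order_on by metis
qed

lemma ord_suc:
  assumes "i \<in> ords \<kappa>"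
  shows ord_suc_ords: "ord_suc \<kappa> i \<in> ords \<kappa>"
    and below_ord_suc: "i \<in> below \<kappa> (ord_suc \<kappa> i)"
    and ord_suc_least: "i \<in> below \<kappa> j \<Longrightarrow> ord_le \<kappa> (ord_suc \<kappa> i) j"
proof -
  have sub: "{i} \<subseteq> Field (cardSuc \<kappa>)" using assms by (simp add: ords_def)
  have "\<exists>j\<in>ords \<kappa>. j \<noteq> i \<and> ord_le \<kappa> i j"
    using infinite_Card_order_limit[OF cardSuc_Card_order[OF card_order], of i] infinite_ords assms
    by (auto simp: ords_def ord_le_def)
  then have ne: "AboveS (cardSuc \<kappa>) {i} \<noteq> {}"
    by (auto simp: AboveS_def ords_def ord_le_def)
  show "ord_suc \<kappa> i \<in> ords \<kappa>"
    using wo_rel.suc_inField[OF wo_rel_cardSuc sub ne] by (simp add: ord_suc_def ords_def)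
  show "i \<in> below \<kappa> (ord_suc \<kappa> i)"
    using wo_rel.suc_greater[OF wo_rel_cardSuc sub ne, of i] by (auto simp: ord_suc_def below_iff ord_le_def)
  assume "i \<in> below \<kappa> j"
  then have "j \<in> AboveS (cardSuc \<kappa>) {i}"
    using below_ords(2) by (auto simp: AboveS_def below_iff ord_le_def ords_def)
  then show "ord_le \<kappa> (ord_suc \<kappa> i) j"
    using wo_rel.suc_least_AboveS[OF wo_rel_cardSuc] by (simp add: ord_suc_def ord_le_def)
qed

lemma below_ord_suc_iff: "i \<in> ords \<kappa> \<Longrightarrow> j \<in> below \<kappa> (ord_suc \<kappa> i) \<longleftrightarrow> ord_le \<kappa> j i"
  by (metis below_ord_suc below_ords(1) le_below_trans not_below_iff ord_suc_least ord_suc_ords)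

lemma limit_ord_ords: "limit_ord \<kappa> i \<Longrightarrow> i \<in> ords \<kappa>"
  by (simp add: limit_ord_def)

lemma limit_ord_suc:
  assumes "limit_ord \<kappa> i" "j \<in> below \<kappa> i" shows "ord_suc \<kappa> j \<in> below \<kappa> i"
  using assms ord_suc_least[OF below_ords(1), OF assms(2) assms(2)]
  unfolding limit_ord_def below_iff[of "ord_suc \<kappa> j"] by metis

lemma not_limit_suc: "i \<in> ords \<kappa> \<Longrightarrow> \<not> limit_ord \<kappa> (ord_suc \<kappa> i)"
  using below_ord_suc by (auto simp: limit_ord_def)

lemma not_limit_zero: "\<not> limit_ord \<kappa> (ord_zero \<kappa>)"
  by (auto simp: limit_ord_def)

lemma ord_cases:
  assumes "i \<in> ords \<kappa>"
  obtains "i = ord_zero \<kappa>" | j where "j \<in> below \<kappa> i" "i = ord_suc \<kappa> j" | "limit_ord \<kappa> i"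
  using assms by (auto simp: limit_ord_def)

section \<open>The ordinal omega, gluing, and recursion along ordinals\<close>

fun nth_ord :: "nat \<Rightarrow> 'c set" where
  "nth_ord 0 = ord_zero \<kappa>"
| "nth_ord (Suc n) = ord_suc \<kappa> (nth_ord n)"

lemma nth_ord_ords: "nth_ord n \<in> ords \<kappa>"
  by (induction n) (simp_all add: ord_zero_ords ord_suc_ords)

text \<open>The successor of an infinite cardinal is uncountable, so the finite ordinals miss some
  element of it; the least one missed is omega. Chains indexed by natural numbers can thus be fed
  into the superstability hypothesis, whose chains are indexed by ordinals.\<close>

lemma ex_omega:
  obtains \<omega> where "limit_ord \<kappa> \<omega>" "below \<kappa> \<omega> = range nth_ord" "inj nth_ord"
    "\<And>m n. nth_ord m \<in> below \<kappa> (nth_ord n) \<longleftrightarrow> m < n"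
proof -
  have "ords \<kappa> - range nth_ord \<noteq> {}"
  proof
    assume "ords \<kappa> - range nth_ord = {}"
    then have "|ords \<kappa>| \<le>o |UNIV :: nat set|"
      by (metis Diff_eq_empty_iff card_of_image card_of_mono1 ordLeq_transitive)
    also have "|UNIV :: nat set| \<le>o |Field \<kappa>|"
      using infinite_Field infinite_iff_card_of_nat by blast
    also have "|Field \<kappa>| =o \<kappa>"
      using card_order card_of_Field_ordIso by blast
    also have "\<kappa> <o cardSuc \<kappa>"
      by (rule cardSuc_greater[OF card_order])
    also have "cardSuc \<kappa> =o |ords \<kappa>|"
      unfolding ords_def using card_of_Field_ordIso[OF cardSuc_Card_order[OF card_order]] ordIso_symmetric by blast
    finally show False
      using ordLess_irreflexive by blast
  qed
  then obtain \<omega> where w: "\<omega> \<in> ords \<kappa> - range nth_ord"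
    and least: "\<And>j. j \<in> ords \<kappa> - range nth_ord \<Longrightarrow> ord_le \<kappa> \<omega> j"
    by (rule ord_least[of "ords \<kappa> - range nth_ord"]) blast+
  have neq: "nth_ord n \<noteq> \<omega>" for n using w by auto
  have lim: "limit_ord \<kappa> \<omega>"
    unfolding limit_ord_def
  proof (intro conjI notI)
    show "\<omega> \<in> ords \<kappa>" using w by simp
    show "\<omega> = ord_zero \<kappa> \<Longrightarrow> False" using neq[of 0] by simp
    assume "\<exists>j\<in>below \<kappa> \<omega>. \<omega> = ord_suc \<kappa> j"
    then obtain j where j: "j \<in> below \<kappa> \<omega>" "\<omega> = ord_suc \<kappa> j" by blast
    then have "j \<in> range nth_ord"
      using least[of j] below_ords(1) not_below_iff below_asym w by blast
    then obtain n where "j = nth_ord n" by blast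
    then show False using neq[of "Suc n"] j by simp
  qed
  have "nth_ord n \<in> below \<kappa> \<omega>" for n
  proof (induction n)
    case 0
    then show ?case using zero_below w neq[of 0] by simp
  next
    case (Suc n)
    then show ?case using limit_ord_suc[OF lim] by simp
  qed
  moreover have "j \<in> range nth_ord" if "j \<in> below \<kappa> \<omega>" for j
    using that least[of j] below_ords(1) below_asym not_below_iff w by blast
  ultimately have eq: "below \<kappa> \<omega> = range nth_ord" by blast
  have lt: "nth_ord m \<in> below \<kappa> (nth_ord n)" if "m < n" for m n
    using that
  proof (induction n)
    case (Suc n)
    then show ?case
      using below_ord_suc_iff[OF nth_ord_ords] by (metis below_iff less_antisym nth_ord.simps(2) nth_ord_ords ord_le_refl)
  qed simp
  have "inj nth_ord"
    by (rule injI) (metis below_irrefl linorder_neq_iff lt)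
  moreover have "nth_ord m \<in> below \<kappa> (nth_ord n) \<longleftrightarrow> m < n" for m n
    by (metis below_asym below_irrefl linorder_neqE_nat lt)
  ultimately show ?thesis using that lim eq by blast
qed

lemma glue_functions:
  assumes "I \<subseteq> ords \<kappa>"
    and "\<And>k l x. k \<in> I \<Longrightarrow> l \<in> I \<Longrightarrow> l \<in> below \<kappa> k \<Longrightarrow> x \<in> V l \<Longrightarrow> x \<in> V k \<Longrightarrow> f k x = f l x"
  obtains h where "\<And>k x. k \<in> I \<Longrightarrow> x \<in> V k \<Longrightarrow> h x = f k x"
proof
  fix k x assume kx: "k \<in> I" "x \<in> V k"
  let ?l = "SOME k. k \<in> I \<and> x \<in> V k"
  have l: "?l \<in> I \<and> x \<in> V ?l" by (rule someI_ex) (use kx in blast)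
  show "f ?l x = f k x"
    by (rule ord_total[of ?l k]) (use kx l assms in auto)
qed

lemma ord_recursion:
  fixes P :: "('c set \<Rightarrow> 'b) \<Rightarrow> 'c set \<Rightarrow> 'b \<Rightarrow> bool"
  assumes "\<And>f g i y. (\<And>j. j \<in> below \<kappa> i \<Longrightarrow> f j = g j) \<Longrightarrow> P f i y = P g i y"
    and "\<And>i f. (\<And>j. j \<in> below \<kappa> i \<Longrightarrow> P f j (f j)) \<Longrightarrow> \<exists>y. P f i y"
  shows "\<exists>f. \<forall>i. P f i (f i)"
proof (rule dependent_wf_choice[OF wf_below])
  show "P f i y = P g i y" if "\<And>j. (j, i) \<in> {(i, j). i \<in> below \<kappa> j} \<Longrightarrow> f j = g j" for f g i y
    using assms(1)[of i f g y] that by simp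
  show "\<exists>y. P f i y" if "\<And>j. (j, i) \<in> {(i, j). i \<in> below \<kappa> j} \<Longrightarrow> P f j (f j)" for f i
    using assms(2)[of i f] that by simp
qed

text \<open>\<open>A\<close> is the invariant of a single stage and \<open>B\<close> compares a
  stage with every earlier one, not merely with its predecessor. A step can therefore treat zero,
  successor and limit indices alike, by first collecting all earlier stages. The index ranges over a
  whole type, which is why later invariants carry guards such as
  \<open>j \<in> below \<kappa> \<alpha>\<close>.\<close>

lemma ord_recursion_pairs:
  assumes "\<And>i f. (\<And>j. j \<in> below \<kappa> i \<Longrightarrow> A j (f j) \<and> (\<forall>k\<in>below \<kappa> j. B k (f k) j (f j))) \<Longrightarrow>
    \<exists>y. A i y \<and> (\<forall>k\<in>below \<kappa> i. B k (f k) i y)"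
  shows "\<exists>f. \<forall>i. A i (f i) \<and> (\<forall>k\<in>below \<kappa> i. B k (f k) i (f i))"
  by (rule ord_recursion[where P = "\<lambda>f i y. A i y \<and> (\<forall>k\<in>below \<kappa> i. B k (f k) i y)"])
    (simp, rule assms, blast)

end

section \<open>Nonforking in a homogeneous family of sets\<close>

text \<open>
  \<open>\<U>\<close> stands for the universes of the \<open>\<kappa>\<close>-sized submodels of a homogeneous model and \<open>G\<close> for its
  automorphisms, extended by the identity. Accordingly \<open>N2\<close> and \<open>f\<close> in the definition of splitting
  are \<open>\<sigma> ` N1\<close> and (an extension \<open>\<sigma>\<close> of) \<open>f\<close> in \<open>nonsplit\<close>, and \<open>free a N M\<close> says that the type of
  \<open>a\<close> over \<open>N\<close> does not fork over \<open>M\<close>.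
\<close>

locale homogeneous_family = infinite_card \<kappa> for \<kappa> :: "'c rel" +
  fixes \<U> :: "'a set set" and G :: "('a \<Rightarrow> 'a) set"
  assumes G_bij: "\<sigma> \<in> G \<Longrightarrow> bij \<sigma>"
    and G_id: "id \<in> G"
    and G_comp: "\<sigma> \<in> G \<Longrightarrow> \<rho> \<in> G \<Longrightarrow> \<sigma> \<circ> \<rho> \<in> G"
    and G_inv: "\<sigma> \<in> G \<Longrightarrow> inv \<sigma> \<in> G"
    and G_image: "\<sigma> \<in> G \<Longrightarrow> X \<in> \<U> \<Longrightarrow> \<sigma> ` X \<in> \<U>"
    and union_closed: "below \<kappa> j \<noteq> {} \<Longrightarrow> (\<And>k. k \<in> below \<kappa> j \<Longrightarrow> V k \<in> \<U>) \<Longrightarrow>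
      (\<And>k l. k \<in> below \<kappa> j \<Longrightarrow> l \<in> below \<kappa> k \<Longrightarrow> V l \<subseteq> V k) \<Longrightarrow> (\<Union>k\<in>below \<kappa> j. V k) \<in> \<U>"
    and cover_family: "(\<And>k. k \<in> below \<kappa> j \<Longrightarrow> V k \<in> \<U>) \<Longrightarrow> \<exists>Z\<in>\<U>. (\<Union>k\<in>below \<kappa> j. V k) \<subseteq> Z"
    and cover_Un: "X \<in> \<U> \<Longrightarrow> Y \<in> \<U> \<Longrightarrow> \<exists>Z\<in>\<U>. X \<union> Y \<subseteq> Z"
    and glue: "(\<And>k. k \<in> below \<kappa> j \<Longrightarrow> f k \<in> G \<and> V k \<in> \<U>) \<Longrightarrow>
      (\<And>k l. k \<in> below \<kappa> j \<Longrightarrow> l \<in> below \<kappa> k \<Longrightarrow> V l \<subseteq> V k \<and> (\<forall>x\<in>V l. f k x = f l x)) \<Longrightarrow>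
      \<exists>\<tau>\<in>G. \<forall>k\<in>below \<kappa> j. \<forall>x\<in>V k. \<tau> x = f k x"
begin

text \<open>Embeddings between \<kappa>-sized submodels extend to automorphisms of the homogeneous
  model, so universality can be tested with elements of \<open>G\<close>.\<close>

definition univ_over :: "'a set \<Rightarrow> 'a set \<Rightarrow> bool" where
  "univ_over N M \<longleftrightarrow> M \<in> \<U> \<and> N \<in> \<U> \<and> M \<subseteq> N \<and>
     (\<forall>M'\<in>\<U>. M \<subseteq> M' \<longrightarrow> (\<exists>\<sigma>\<in>G. fixes_pointwise \<sigma> M \<and> \<sigma> ` M' \<subseteq> N))"

definition same_type :: "'a \<Rightarrow> 'a \<Rightarrow> 'a set \<Rightarrow> bool" where
  "same_type a b X \<longleftrightarrow> (\<exists>\<sigma>\<in>G. fixes_pointwise \<sigma> X \<and> \<sigma> a = b)"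

definition nonsplit :: "'a \<Rightarrow> 'a set \<Rightarrow> 'a set \<Rightarrow> bool" where
  "nonsplit a M N \<longleftrightarrow> a \<in> \<Union>\<U> \<and> M \<in> \<U> \<and> N \<in> \<U> \<and> M \<subseteq> N \<and>
     (\<forall>N1\<in>\<U>. \<forall>\<sigma>\<in>G. M \<subseteq> N1 \<longrightarrow> N1 \<subseteq> N \<longrightarrow> \<sigma> ` N1 \<subseteq> N \<longrightarrow> fixes_pointwise \<sigma> M \<longrightarrow>
        same_type (\<sigma> a) a (\<sigma> ` N1))"

definition free :: "'a \<Rightarrow> 'a set \<Rightarrow> 'a set \<Rightarrow> bool" where
  "free a N M \<longleftrightarrow> M \<in> \<U> \<and> N \<in> \<U> \<and> M \<subseteq> N \<and> (\<exists>B. univ_over M B \<and> nonsplit a B N)"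

lemma fixes_pointwise_subset: "fixes_pointwise \<sigma> Y \<Longrightarrow> X \<subseteq> Y \<Longrightarrow> fixes_pointwise \<sigma> X"
  by (auto simp: fixes_pointwise_def)

lemma fixes_pointwise_image: "fixes_pointwise \<sigma> X \<Longrightarrow> \<sigma> ` X = X"
  by (auto simp: fixes_pointwise_def)

lemma inv_apply: "\<sigma> \<in> G \<Longrightarrow> inv \<sigma> (\<sigma> x) = x"
  using G_bij by (simp add: bij_is_inj inv_f_f)

lemma apply_inv: "\<sigma> \<in> G \<Longrightarrow> \<sigma> (inv \<sigma> x) = x"
  using G_bij by (simp add: bij_is_surj surj_f_inv_f)

lemma inv_image: "\<sigma> \<in> G \<Longrightarrow> inv \<sigma> ` \<sigma> ` X = X"
  by (simp add: image_image inv_apply)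

lemma image_inv: "\<sigma> \<in> G \<Longrightarrow> \<sigma> ` inv \<sigma> ` X = X"
  by (simp add: image_image apply_inv)

lemma fixes_pointwise_inv: "\<sigma> \<in> G \<Longrightarrow> fixes_pointwise \<sigma> X \<Longrightarrow> fixes_pointwise (inv \<sigma>) X"
  unfolding fixes_pointwise_def by (metis inv_apply)

lemma G_elem: "\<sigma> \<in> G \<Longrightarrow> a \<in> \<Union>\<U> \<Longrightarrow> \<sigma> a \<in> \<Union>\<U>"
  using G_image by blast

lemma same_type_sym: "same_type a b X \<Longrightarrow> same_type b a X"
  unfolding same_type_def using fixes_pointwise_inv G_inv inv_apply by metis

lemma same_type_trans: "same_type a b X \<Longrightarrow> same_type b c X \<Longrightarrow> same_type a c X"
proof -
  assume "same_type a b X" "same_type b c X"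
  then obtain \<sigma> \<rho> where "\<sigma> \<in> G" "fixes_pointwise \<sigma> X" "\<sigma> a = b" "\<rho> \<in> G" "fixes_pointwise \<rho> X" "\<rho> b = c"
    unfolding same_type_def by blast
  then show ?thesis
    unfolding same_type_def by (intro bexI[of _ "\<rho> \<circ> \<sigma>"]) (auto simp: fixes_pointwise_def G_comp)
qed

lemma same_type_mono: "same_type a b Y \<Longrightarrow> X \<subseteq> Y \<Longrightarrow> same_type a b X"
  unfolding same_type_def using fixes_pointwise_subset by blast

lemma same_type_elem: "same_type a b X \<Longrightarrow> a \<in> \<Union>\<U> \<Longrightarrow> b \<in> \<Union>\<U>"
  unfolding same_type_def using G_elem by blast

lemma same_type_image: "same_type a b X \<Longrightarrow> \<sigma> \<in> G \<Longrightarrow> same_type (\<sigma> a) (\<sigma> b) (\<sigma> ` X)"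
proof -
  assume "same_type a b X" and s: "\<sigma> \<in> G"
  then obtain \<rho> where "\<rho> \<in> G" "fixes_pointwise \<rho> X" "\<rho> a = b"
    unfolding same_type_def by blast
  then show ?thesis
    unfolding same_type_def using s
    by (intro bexI[of _ "\<sigma> \<circ> \<rho> \<circ> inv \<sigma>"]) (auto simp: fixes_pointwise_def G_comp G_inv inv_apply)
qed

lemma same_type_image_iff: "\<sigma> \<in> G \<Longrightarrow> same_type (\<sigma> a) (\<sigma> b) (\<sigma> ` X) \<longleftrightarrow> same_type a b X"
  using same_type_image[of a b X \<sigma>] same_type_image[of "\<sigma> a" "\<sigma> b" "\<sigma> ` X" "inv \<sigma>"]
  by (auto simp: inv_image inv_apply G_inv)

lemma same_type_realized: "same_type a b X \<Longrightarrow> a \<in> X \<Longrightarrow> b = a"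
  by (auto simp: same_type_def fixes_pointwise_def)

section \<open>Universality and nonsplitting when models are enlarged, shrunk or moved\<close>

lemma univ_overD:
  assumes "univ_over N M"
  shows "M \<in> \<U>" "N \<in> \<U>" "M \<subseteq> N"
  using assms by (auto simp: univ_over_def)

lemma univ_over_embed:
  assumes "univ_over N M" "M' \<in> \<U>" "M \<subseteq> M'"
  obtains \<sigma> where "\<sigma> \<in> G" "fixes_pointwise \<sigma> M" "\<sigma> ` M' \<subseteq> N"
  using assms unfolding univ_over_def by blast

lemma univ_over_top: "univ_over N M \<Longrightarrow> N \<subseteq> N' \<Longrightarrow> N' \<in> \<U> \<Longrightarrow> univ_over N' M"
  unfolding univ_over_def by (meson order_trans)

text \<open>An extension of the smaller base need not contain \<open>M\<close>. A common cover
  \<open>Z\<close> of the two serves as their amalgam, and an automorphism fixing \<open>M\<close>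
  moves it into \<open>N\<close>.\<close>

lemma univ_over_base:
  assumes "univ_over N M" "M0 \<subseteq> M" "M0 \<in> \<U>"
  shows "univ_over N M0"
  unfolding univ_over_def
proof (intro conjI ballI impI)
  fix M' assume M': "M' \<in> \<U>" "M0 \<subseteq> M'"
  then obtain Z where Z: "Z \<in> \<U>" "M \<union> M' \<subseteq> Z"
    using cover_Un univ_overD(1)[OF assms(1)] by blast
  then obtain \<sigma> where "\<sigma> \<in> G" "fixes_pointwise \<sigma> M" "\<sigma> ` Z \<subseteq> N"
    using univ_over_embed[OF assms(1), of Z] by blast
  then show "\<exists>\<sigma>\<in>G. fixes_pointwise \<sigma> M0 \<and> \<sigma> ` M' \<subseteq> N"
    using assms(2) Z fixes_pointwise_subset by blast
qed (use assms univ_overD[OF assms(1)] in auto)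

lemma univ_over_image:
  assumes "univ_over N M" "\<sigma> \<in> G"
  shows "univ_over (\<sigma> ` N) (\<sigma> ` M)"
  unfolding univ_over_def
proof (intro conjI ballI impI)
  fix M' assume M': "M' \<in> \<U>" "\<sigma> ` M \<subseteq> M'"
  have "inv \<sigma> ` M' \<in> \<U>" "M \<subseteq> inv \<sigma> ` M'"
    using M' assms G_image G_inv by (blast, metis image_mono inv_image)
  then obtain \<rho> where r: "\<rho> \<in> G" "fixes_pointwise \<rho> M" "\<rho> ` inv \<sigma> ` M' \<subseteq> N"
    using univ_over_embed[OF assms(1)] by blast
  have "fixes_pointwise (\<sigma> \<circ> \<rho> \<circ> inv \<sigma>) (\<sigma> ` M)"
    using r(2) assms(2) by (auto simp: fixes_pointwise_def inv_apply)
  moreover have "(\<sigma> \<circ> \<rho> \<circ> inv \<sigma>) ` M' \<subseteq> \<sigma> ` N"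
    using image_mono[OF r(3), of \<sigma>] by (simp add: image_image)
  ultimately show "\<exists>\<rho>\<in>G. fixes_pointwise \<rho> (\<sigma> ` M) \<and> \<rho> ` M' \<subseteq> \<sigma> ` N"
    using r assms(2) G_comp G_inv by meson
qed (use univ_overD[OF assms(1)] assms(2) G_image in auto)

lemma nonsplitD:
  assumes "nonsplit a M N"
  shows "a \<in> \<Union>\<U>" "M \<in> \<U>" "N \<in> \<U>" "M \<subseteq> N"
  using assms unfolding nonsplit_def by auto

lemma nonsplit_apply:
  "nonsplit a M N \<Longrightarrow> N1 \<in> \<U> \<Longrightarrow> \<sigma> \<in> G \<Longrightarrow> M \<subseteq> N1 \<Longrightarrow> N1 \<subseteq> N \<Longrightarrow> \<sigma> ` N1 \<subseteq> N \<Longrightarrow>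
   fixes_pointwise \<sigma> M \<Longrightarrow> same_type (\<sigma> a) a (\<sigma> ` N1)"
  unfolding nonsplit_def by blast

lemma nonsplit_mono:
  assumes "nonsplit a M N" "M \<subseteq> M'" "M' \<subseteq> N'" "N' \<subseteq> N" "M' \<in> \<U>" "N' \<in> \<U>"
  shows "nonsplit a M' N'"
  unfolding nonsplit_def
proof (intro conjI ballI impI)
  fix N1 \<sigma> assume "N1 \<in> \<U>" "\<sigma> \<in> G" "M' \<subseteq> N1" "N1 \<subseteq> N'" "\<sigma> ` N1 \<subseteq> N'" "fixes_pointwise \<sigma> M'"
  then show "same_type (\<sigma> a) a (\<sigma> ` N1)"
    using assms by (intro nonsplit_apply[OF assms(1)]) (auto simp: fixes_pointwise_def)
qed (use assms nonsplitD in auto)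

lemma nonsplit_same_type:
  assumes "nonsplit a M N" "same_type a b N"
  shows "nonsplit b M N"
  unfolding nonsplit_def
proof (intro conjI ballI impI)
  fix N1 \<sigma> assume A: "N1 \<in> \<U>" "\<sigma> \<in> G" "M \<subseteq> N1" "N1 \<subseteq> N" "\<sigma> ` N1 \<subseteq> N" "fixes_pointwise \<sigma> M"
  then have "same_type (\<sigma> a) a (\<sigma> ` N1)"
    by (rule nonsplit_apply[OF assms(1)])
  moreover have "same_type (\<sigma> a) (\<sigma> b) (\<sigma> ` N1)"
    by (rule same_type_image[OF same_type_mono[OF assms(2) A(4)] A(2)])
  moreover have "same_type a b (\<sigma> ` N1)"
    by (rule same_type_mono[OF assms(2) A(5)])
  ultimately show "same_type (\<sigma> b) b (\<sigma> ` N1)"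
    using same_type_sym same_type_trans by blast
qed (use assms nonsplitD same_type_elem in auto)

lemma nonsplit_image:
  assumes "nonsplit a M N" "\<rho> \<in> G"
  shows "nonsplit (\<rho> a) (\<rho> ` M) (\<rho> ` N)"
  unfolding nonsplit_def
proof (intro conjI ballI impI)
  fix N1 \<sigma> assume A: "N1 \<in> \<U>" "\<sigma> \<in> G" "\<rho> ` M \<subseteq> N1" "N1 \<subseteq> \<rho> ` N" "\<sigma> ` N1 \<subseteq> \<rho> ` N"
    "fixes_pointwise \<sigma> (\<rho> ` M)"
  let ?N = "inv \<rho> ` N1" and ?s = "inv \<rho> \<circ> \<sigma> \<circ> \<rho>"
  have im: "?s ` ?N = inv \<rho> ` \<sigma> ` N1"
    using assms(2) by (auto simp: image_image apply_inv)
  have "same_type (?s a) a (?s ` ?N)"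
  proof (rule nonsplit_apply[OF assms(1)])
    show "?N \<in> \<U>" by (rule G_image[OF G_inv[OF assms(2)] A(1)])
    show "?s \<in> G" using A(2) assms(2) by (intro G_comp G_inv)
    show "M \<subseteq> ?N" using image_mono[OF A(3), of "inv \<rho>"] assms(2) by (simp add: inv_image)
    show "?N \<subseteq> N" using image_mono[OF A(4), of "inv \<rho>"] assms(2) by (simp add: inv_image)
    show "?s ` ?N \<subseteq> N" unfolding im using image_mono[OF A(5), of "inv \<rho>"] assms(2) by (simp add: inv_image)
    show "fixes_pointwise ?s M" using A(6) assms(2) by (auto simp: fixes_pointwise_def inv_apply)
  qed
  then have "same_type (\<rho> (?s a)) (\<rho> a) (\<rho> ` ?s ` ?N)"
    using same_type_image assms(2) by blast
  then show "same_type (\<sigma> (\<rho> a)) (\<rho> a) (\<sigma> ` N1)"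
    unfolding im using assms(2) by (simp add: image_inv apply_inv)
qed (use assms nonsplitD[OF assms(1)] G_image G_elem in auto)

text \<open>Let \<open>\<sigma>\<close> push \<open>N'\<close> into \<open>N\<close> over
  \<open>M\<close>, and pull \<open>a\<close> back to \<open>b = inv \<sigma> a\<close>.
  Nonsplitting over \<open>N'\<close> is inherited from the image of \<open>N'\<close>, and
  \<open>b\<close> agrees with \<open>a\<close> over \<open>N\<close> because
  \<open>\<sigma>\<close> maps \<open>N\<close> into itself, where nonsplitting compares the two
  types.\<close>

lemma nonsplit_extend:
  assumes "nonsplit a M N" "univ_over N M" "N \<subseteq> N'" "N' \<in> \<U>"
  obtains b where "same_type a b N" "nonsplit b M N'"
proof -
  obtain \<sigma> where s: "\<sigma> \<in> G" "fixes_pointwise \<sigma> M" "\<sigma> ` N' \<subseteq> N"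
    using univ_over_embed[OF assms(2,4)] assms(3) univ_overD[OF assms(2)] by blast
  have MN': "M \<subseteq> N'" using assms nonsplitD by blast
  have M: "M \<subseteq> \<sigma> ` N'" using image_mono[OF MN', of \<sigma>] s by (simp add: fixes_pointwise_image)
  have "nonsplit a M (\<sigma> ` N')"
    by (rule nonsplit_mono[OF assms(1)]) (use s M assms G_image nonsplitD[OF assms(1)] in auto)
  then have "nonsplit (inv \<sigma> a) (inv \<sigma> ` M) (inv \<sigma> ` \<sigma> ` N')"
    using nonsplit_image s(1) G_inv by blast
  then have ns: "nonsplit (inv \<sigma> a) M N'"
    using s by (simp add: inv_image fixes_pointwise_image fixes_pointwise_inv)
  have "same_type (\<sigma> a) a (\<sigma> ` N)"
    by (rule nonsplit_apply[OF assms(1)]) (use s assms univ_overD[OF assms(2)] in auto)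
  then have "same_type (inv \<sigma> (\<sigma> a)) (inv \<sigma> a) (inv \<sigma> ` \<sigma> ` N)"
    using same_type_image s(1) G_inv by blast
  then show ?thesis
    using that ns s by (simp add: inv_image inv_apply)
qed

text \<open>An automorphism fixing \<open>M\<close> moves \<open>N'\<close> into \<open>N\<close>.
  Nonsplitting reduces each type over \<open>N'\<close> to its restriction to that image, where the
  two agree by assumption.\<close>

lemma nonsplit_unique_same_base:
  assumes "nonsplit a M N'" "nonsplit b M N'" "univ_over N M" "N \<subseteq> N'" "same_type a b N"
  shows "same_type a b N'"
proof -
  have N': "N' \<in> \<U>" "M \<subseteq> N'" using nonsplitD assms(1) by auto
  obtain \<sigma> where s: "\<sigma> \<in> G" "fixes_pointwise \<sigma> M" "\<sigma> ` N' \<subseteq> N"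
    using univ_over_embed[OF assms(3) N'] by blast
  have "same_type (\<sigma> a) a (\<sigma> ` N')" "same_type (\<sigma> b) b (\<sigma> ` N')"
    using nonsplit_apply[OF assms(1)] nonsplit_apply[OF assms(2)] s N' assms(4) by auto
  moreover have "same_type a b (\<sigma> ` N')"
    using assms(5) s(3) same_type_mono by blast
  ultimately have "same_type (\<sigma> a) (\<sigma> b) (\<sigma> ` N')"
    using same_type_sym same_type_trans by blast
  then show ?thesis using s same_type_image_iff by blast
qed

section \<open>Basic properties of nonforking\<close>

lemma freeD:
  assumes "free a N M"
  shows "M \<in> \<U>" "N \<in> \<U>" "M \<subseteq> N" "a \<in> \<Union>\<U>"
  using assms nonsplitD unfolding free_def by auto

lemma free_mono:
  assumes "free a N M" "M \<subseteq> M'" "M' \<subseteq> N'" "N' \<subseteq> N" "M' \<in> \<U>" "N' \<in> \<U>"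
  shows "free a N' M'"
proof -
  obtain B where B: "univ_over M B" "nonsplit a B N"
    using assms(1) unfolding free_def by blast
  have BM: "B \<subseteq> M" "B \<in> \<U>" using univ_overD B(1) by auto
  have "univ_over M' B" using univ_over_top B assms by blast
  moreover have "nonsplit a B N'"
    by (rule nonsplit_mono[OF B(2)]) (use BM assms in auto)
  ultimately show ?thesis using assms unfolding free_def by auto
qed

lemma free_same_type: "free a N M \<Longrightarrow> same_type a b N \<Longrightarrow> free b N M"
  unfolding free_def using nonsplit_same_type by blast

lemma free_image: "free a N M \<Longrightarrow> \<rho> \<in> G \<Longrightarrow> free (\<rho> a) (\<rho> ` N) (\<rho> ` M)"
  unfolding free_def using nonsplit_image univ_over_image G_image by (metis image_mono)

lemma free_extend:
  assumes "free a N M" "N \<subseteq> N'" "N' \<in> \<U>"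
  obtains b where "same_type a b N" "free b N' M"
proof -
  obtain B where B: "univ_over M B" "nonsplit a B N"
    using assms(1) unfolding free_def by blast
  then have "univ_over N B" using univ_over_top freeD[OF assms(1)] by blast
  then obtain b where "same_type a b N" "nonsplit b B N'"
    using nonsplit_extend B assms by metis
  then show ?thesis using that B assms freeD[OF assms(1)] unfolding free_def by (metis order_trans)
qed

text \<open>Push \<open>N\<close> into \<open>M\<close> over the witness \<open>B\<close>.
  Nonsplitting equates the types of \<open>\<sigma> a\<close> and \<open>a\<close> over the image of
  \<open>N\<close>; as \<open>\<sigma> a\<close> lies in that image, it equals \<open>a\<close>.
  Read contrapositively, an element outside the base stays outside every model over which it is
  free, which later gives nonalgebraicity.\<close>

lemma free_realized:
  assumes "free a N M" "a \<in> N"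
  shows "a \<in> M"
proof -
  obtain B where B: "univ_over M B" "nonsplit a B N"
    using assms(1) unfolding free_def by blast
  note BN = nonsplitD[OF B(2)] and N = freeD[OF assms(1)]
  obtain \<sigma> where s: "\<sigma> \<in> G" "fixes_pointwise \<sigma> B" "\<sigma> ` N \<subseteq> M"
    using univ_over_embed[OF B(1) BN(3,4)] by blast
  then have "same_type (\<sigma> a) a (\<sigma> ` N)"
    using nonsplit_apply[OF B(2) BN(3)] BN N by auto
  then have "a = \<sigma> a" using same_type_realized assms(2) by blast
  then show ?thesis using s(3) assms(2) by (metis image_subset_iff)
qed

end

text \<open>What superstability and symmetry contribute once types are orbits. The chain in
  \<open>local_character\<close> need not be continuous, since only its union at \<delta> matters;
  \<open>free_symmetric\<close> mentions no ambient models, as everything happens inside one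
  homogeneous model.\<close>

locale superstable_family = homogeneous_family \<kappa> \<U> G
  for \<kappa> :: "'c rel" and \<U> :: "'a set set" and G :: "('a \<Rightarrow> 'a) set" +
  assumes ex_univ: "X \<in> \<U> \<Longrightarrow> \<exists>Y. univ_over Y X"
    and local_character: "limit_ord \<kappa> \<delta> \<Longrightarrow> a \<in> \<Union>\<U> \<Longrightarrow>
      (\<And>k l. k \<in> below \<kappa> \<delta> \<Longrightarrow> l \<in> below \<kappa> k \<Longrightarrow> univ_over (V k) (V l)) \<Longrightarrow>
      \<exists>k\<in>below \<kappa> \<delta>. nonsplit a (V k) (\<Union>k\<in>below \<kappa> \<delta>. V k)"
    and free_symmetric: "M \<in> \<U> \<Longrightarrow> a \<in> \<Union>\<U> \<Longrightarrow> Z \<in> \<U> \<Longrightarrow> b \<in> Z \<Longrightarrow> free a Z M \<Longrightarrow>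
      \<exists>Z'\<in>\<U>. a \<in> Z' \<and> free b Z' M"
begin

section \<open>Uniqueness, transitivity and unions from superstability\<close>

lemma ex_univ_above:
  assumes "X \<in> \<U>" "Y \<in> \<U>"
  obtains Z where "univ_over Z X" "Y \<subseteq> Z"
proof -
  obtain X' where X': "univ_over X' X" using ex_univ assms by blast
  then obtain Z where "Z \<in> \<U>" "X' \<union> Y \<subseteq> Z" using cover_Un[OF univ_overD(2) assms(2)] by blast
  then show ?thesis using that X' univ_over_top by (metis le_sup_iff)
qed

text \<open>Two universal steps above \<open>M\<close> fit, over \<open>M\<close>, inside any
  universal extension \<open>N\<close>; the image of the middle model is the interpolant.\<close>

lemma univ_over_interpolate:
  assumes "univ_over N M"
  obtains M' where "univ_over M' M" "univ_over N M'"
proof -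
  obtain M1 where M1: "univ_over M1 M" using ex_univ univ_overD assms by blast
  obtain M2 where M2: "univ_over M2 M1" using ex_univ univ_overD M1 by blast
  obtain \<sigma> where s: "\<sigma> \<in> G" "fixes_pointwise \<sigma> M" "\<sigma> ` M2 \<subseteq> N"
    using univ_over_embed[OF assms univ_overD(2)[OF M2]] univ_overD[OF M1] univ_overD[OF M2] by blast
  have "univ_over (\<sigma> ` M1) M"
    using univ_over_image[OF M1 s(1)] s(2) by (simp add: fixes_pointwise_image)
  moreover have "univ_over N (\<sigma> ` M1)"
    using univ_over_top[OF univ_over_image[OF M2 s(1)] s(3)] univ_overD assms by blast
  ultimately show ?thesis by (rule that)
qed

text \<open>Superstability for omega-chains. Only nonsplitting over the next member is kept, which
  is what the chain in the uniqueness proof below violates at every step.\<close>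

lemma local_character_omega:
  assumes "a \<in> \<Union>\<U>" "\<And>m n :: nat. m < n \<Longrightarrow> univ_over (D n) (D m)"
  obtains n where "nonsplit a (D n) (D (Suc n))"
proof -
  obtain \<omega> where w: "limit_ord \<kappa> \<omega>" "below \<kappa> \<omega> = range nth_ord" "inj nth_ord"
    and lt: "\<And>m n. nth_ord m \<in> below \<kappa> (nth_ord n) \<longleftrightarrow> m < n"
    by (rule ex_omega) blast
  define V where "V i = D (inv nth_ord i)" for i
  have V: "V (nth_ord n) = D n" for n
    by (simp add: V_def inv_f_f w(3))
  have "\<exists>k\<in>below \<kappa> \<omega>. nonsplit a (V k) (\<Union>k\<in>below \<kappa> \<omega>. V k)"
  proof (rule local_character[OF w(1) assms(1)])
    fix k l assume kl: "k \<in> below \<kappa> \<omega>" "l \<in> below \<kappa> k"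
    have "l \<in> below \<kappa> \<omega>" by (rule below_trans[OF kl(2,1)])
    then obtain m where m: "l = nth_ord m" unfolding w(2) by (rule imageE)
    obtain n where n: "k = nth_ord n" using kl(1) unfolding w(2) by (rule imageE)
    show "univ_over (V k) (V l)" using assms(2)[of m n] kl(2) lt m n by (simp add: V)
  qed
  moreover have "(\<Union>k\<in>below \<kappa> \<omega>. V k) = (\<Union>n. D n)"
    unfolding w(2) by (simp add: V)
  ultimately obtain k where k: "k \<in> range nth_ord" "nonsplit a (V k) (\<Union>n. D n)"
    unfolding w(2) by auto
  then obtain n where n: "nonsplit a (D n) (\<Union>n. D n)"
    using V by auto
  have "univ_over (D (Suc n)) (D n)" using assms(2) by simp
  from univ_overD[OF this] have "nonsplit a (D n) (D (Suc n))"
    by (intro nonsplit_mono[OF n]) auto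
  then show ?thesis by (rule that)
qed

text \<open>
  Uniqueness for two unrelated bases. If \<open>a\<close> split over an intermediate \<open>D1\<close>, an automorphism
  \<open>F\<close> fixing \<open>a\<close> could be chosen with \<open>F D1\<close> above \<open>N'\<close>, so that \<open>a\<close> splits at every step of
  the chain \<open>D1 \<subseteq> F D1 \<subseteq> F (F D1) \<subseteq> \<dots>\<close>, against superstability.
\<close>

lemma nonsplit_unique:
  assumes a: "nonsplit a C N'" and b: "nonsplit b D N'"
    and C: "univ_over N C" and D: "univ_over N D"
    and NN': "N \<subseteq> N'" and ab: "same_type a b N"
  shows "same_type a b N'"
proof -
  obtain D1 where D1: "univ_over D1 D" "univ_over N D1"
    using univ_over_interpolate[OF D] by blast
  note N' = nonsplitD[OF a] nonsplitD[OF b] and ND = univ_overD[OF D] univ_overD[OF D1(1)] univ_overD[OF D1(2)]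
  have N'D1: "univ_over N' D1" using univ_over_top D1(2) NN' N' by blast
  \<comment> \<open>It suffices to give \<open>a\<close> the base \<open>D1\<close>: by monotonicity
    \<open>b\<close> has it too, and \<open>N\<close> is universal over \<open>D1\<close>, so
    uniqueness over a common base applies.\<close>
  have "nonsplit a D1 N'"
  proof (rule ccontr)
    assume split: "\<not> nonsplit a D1 N'"
    have aD: "nonsplit a D N"
    proof (rule nonsplit_same_type)
      show "nonsplit b D N" by (rule nonsplit_mono[OF b]) (use NN' ND in auto)
      show "same_type b a N" using ab same_type_sym by blast
    qed
    \<comment> \<open>\<open>\<sigma>\<close> moves \<open>N'\<close> into \<open>N\<close> over
      \<open>C\<close>, and \<open>\<rho>\<close> moves \<open>N\<close> into \<open>D1\<close> over
      \<open>D\<close>. The first keeps the type of \<open>a\<close> because \<open>a\<close> does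
      not split over \<open>C\<close>, the second because on \<open>N\<close> it inherits
      nonsplitting over \<open>D\<close> from \<open>b\<close>. Finally \<open>\<tau>\<close>
      corrects the composite so that it fixes \<open>a\<close>.\<close>
    obtain \<sigma> where s: "\<sigma> \<in> G" "fixes_pointwise \<sigma> C" "\<sigma> ` N' \<subseteq> N"
      using univ_over_embed[OF C] N' by blast
    obtain \<rho> where r: "\<rho> \<in> G" "fixes_pointwise \<rho> D" "\<rho> ` N \<subseteq> D1"
      using univ_over_embed[OF D1(1)] ND by blast
    have "same_type (\<sigma> a) a (\<sigma> ` N')"
      by (rule nonsplit_apply[OF a]) (use s N' NN' in auto)
    then have "same_type (\<rho> (\<sigma> a)) (\<rho> a) (\<rho> ` \<sigma> ` N')"
      using same_type_image r by blast
    moreover have "same_type (\<rho> a) a (\<rho> ` N)"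
      by (rule nonsplit_apply[OF aD]) (use r ND in auto)
    then have "same_type (\<rho> a) a (\<rho> ` \<sigma> ` N')"
      by (rule same_type_mono) (use s in blast)
    ultimately have "same_type (\<rho> (\<sigma> a)) a (\<rho> ` \<sigma> ` N')"
      by (rule same_type_trans)
    then obtain \<tau> where t: "\<tau> \<in> G" "fixes_pointwise \<tau> (\<rho> ` \<sigma> ` N')" "\<tau> (\<rho> (\<sigma> a)) = a"
      unfolding same_type_def by blast
    define E where "E = \<tau> \<circ> \<rho> \<circ> \<sigma>"
    define F where "F = inv E"
    have E: "E \<in> G" "E a = a" "E ` N' \<subseteq> D1"
      unfolding E_def using s r t by (auto simp: G_comp fixes_pointwise_def image_subset_iff)
    have F: "F \<in> G" "F a = a" "N' \<subseteq> F ` D1"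
      using E inv_apply[OF E(1), of a] image_mono[OF E(3), of F]
      by (auto simp: F_def G_inv inv_image)
    \<comment> \<open>The image of \<open>N'\<close> under \<open>H n\<close> lies in
      \<open>D' (Suc n)\<close>, and \<open>H n\<close> fixes \<open>a\<close>. Hence nonsplitting
      of \<open>a\<close> at step \<open>n\<close>, pulled back by \<open>H n\<close>, is
      nonsplitting of \<open>a\<close> over \<open>D1\<close> in \<open>N'\<close>.\<close>
    define H where "H n = F ^^ n" for n
    have H: "H n \<in> G" "H n a = a" for n
      by (induction n) (auto simp: H_def G_id G_comp F simp flip: id_def)
    define D' where "D' n = H n ` D1" for n
    have step: "H n ` N' \<subseteq> D' (Suc n)" for n
      using image_mono[OF F(3), of "H n"] by (simp add: D'_def H_def image_comp funpow_swap1 o_def)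
    have univ: "univ_over (H n ` N') (D' n)" for n
      unfolding D'_def using univ_over_image[OF N'D1 H(1)] .
    have D'U: "D' n \<in> \<U>" for n unfolding D'_def using G_image H ND by blast
    have suc: "univ_over (D' (Suc n)) (D' n)" for n
      using univ_over_top[OF univ step D'U] .
    have "univ_over (D' n) (D' m)" if "m < n" for m n
      using that
    proof (induction n)
      case (Suc n)
      show ?case
      proof (cases "m = n")
        case True
        then show ?thesis using suc by simp
      next
        case False
        then have "univ_over (D' n) (D' m)" using Suc by simp
        then show ?thesis using univ_over_base[OF suc] univ_overD[of "D' n" "D' m"] by blast
      qed
    qed simp
    then obtain n where "nonsplit a (D' n) (D' (Suc n))"
      using local_character_omega N'(1) by blast
    then have "nonsplit a (D' n) (H n ` N')"
      by (rule nonsplit_mono) (use step univ_overD[OF univ, of n] in auto)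
    then have "nonsplit (inv (H n) a) (inv (H n) ` D' n) (inv (H n) ` H n ` N')"
      using nonsplit_image H G_inv by blast
    moreover have "inv (H n) a = a" using inv_apply[OF H(1), of n a] H(2) by simp
    ultimately have "nonsplit a D1 N'"
      by (simp add: D'_def inv_image H)
    then show False using split by blast
  qed
  moreover have "nonsplit b D1 N'"
    by (rule nonsplit_mono[OF b]) (use ND NN' N' in auto)
  ultimately show ?thesis
    using nonsplit_unique_same_base D1(2) NN' ab by blast
qed

lemma free_unique:
  assumes "free a N M" "free b N M" "same_type a b M"
  shows "same_type a b N"
  using assms nonsplit_unique unfolding free_def by blast

text \<open>Extend the type of \<open>a\<close> over \<open>N\<close> to one over \<open>P\<close>
  that is free from \<open>M\<close>. The extension is also free from \<open>N\<close>, so by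
  uniqueness it is the type of \<open>a\<close> over \<open>P\<close>.\<close>

lemma free_trans:
  assumes "free a N M" "free a P N"
  shows "free a P M"
proof -
  note N = freeD[OF assms(1)] and P = freeD[OF assms(2)]
  obtain b where b: "same_type a b N" "free b P M"
    using free_extend[OF assms(1)] P by blast
  have "free b P N" by (rule free_mono[OF b(2)]) (use N P in auto)
  then have "same_type b a P" using free_unique assms(2) b(1) same_type_sym by blast
  then show ?thesis using b(2) free_same_type by blast
qed

text \<open>At a limit, local character gives a \<open>V k\<close> over which \<open>a\<close> does
  not split in the union. As the next member is universal over \<open>V k\<close>, \<open>a\<close>
  is free from that member over the union, and transitivity brings the base down to
  \<open>M\<close>.\<close>

lemma free_Union:
  assumes "below \<kappa> j \<noteq> {}" "\<And>k. k \<in> below \<kappa> j \<Longrightarrow> free a (V k) M"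
    and V: "\<And>k l. k \<in> below \<kappa> j \<Longrightarrow> l \<in> below \<kappa> k \<Longrightarrow> univ_over (V k) (V l)"
  shows "free a (\<Union>k\<in>below \<kappa> j. V k) M"
proof -
  have Vsub: "V l \<subseteq> V k" if "k \<in> below \<kappa> j" "l \<in> below \<kappa> k" for k l
    using V that univ_overD by blast
  have "j \<in> ords \<kappa>" using assms(1) below_ords by blast
  then consider "j = ord_zero \<kappa>" | i where "i \<in> below \<kappa> j" "j = ord_suc \<kappa> i" | "limit_ord \<kappa> j"
    by (rule ord_cases)
  then show ?thesis
  proof cases
    case 1
    then show ?thesis using assms(1) below_zero by simp
  next
    case (2 i)
    have "V k \<subseteq> V i" if "k \<in> below \<kappa> j" for k
      using that 2 below_ord_suc_iff[of i k] below_ords(1) below_or_eq[of k i] Vsub[of i k] by blast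
    then have "(\<Union>k\<in>below \<kappa> j. V k) = V i" using 2(1) by blast
    then show ?thesis using assms(2) 2(1) by simp
  next
    case 3
    obtain k0 where "k0 \<in> below \<kappa> j" using assms(1) by blast
    then have M: "M \<in> \<U>" "a \<in> \<Union>\<U>" using freeD[OF assms(2)] by auto
    let ?W = "\<Union>k\<in>below \<kappa> j. V k"
    obtain k where k: "k \<in> below \<kappa> j" "nonsplit a (V k) ?W"
      using local_character[where V = V, OF 3 M(2) V] by auto
    let ?k = "ord_suc \<kappa> k"
    have k': "?k \<in> below \<kappa> j" "k \<in> below \<kappa> ?k"
      using limit_ord_suc[OF 3 k(1)] below_ord_suc below_ords k(1) by auto
    have "free a ?W (V ?k)"
      unfolding free_def using k(2) V[OF k'] nonsplitD[OF k(2)] univ_overD[OF V[OF k']] k'(1) by blast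
    then show ?thesis using free_trans assms(2)[OF k'(1)] by blast
  qed
qed

text \<open>The extension property seen from the other side: an automorphism fixing \<open>Q\<close>
  carries a realization of the free extension back to \<open>a\<close>, so that \<open>T\<close>
  moves instead of the element.\<close>

lemma free_move_base:
  assumes "free a Q M" "Q \<subseteq> T" "T \<in> \<U>"
  obtains h where "h \<in> G" "fixes_pointwise h Q" "free a (h ` T) M"
proof -
  obtain b where b: "same_type a b Q" "free b T M" using free_extend assms by blast
  then obtain h where h: "h \<in> G" "fixes_pointwise h Q" "h b = a"
    using same_type_sym unfolding same_type_def by blast
  have "fixes_pointwise h M" using fixes_pointwise_subset h(2) freeD[OF assms(1)] by blast
  then have "free a (h ` T) M" using free_image[OF b(2) h(1)] h(3) by (simp add: fixes_pointwise_image)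
  then show ?thesis using that h by blast
qed

text \<open>Here the models stay and the element moves: \<open>g\<close> is changed, but not on
  \<open>Q\<close>, until the image of \<open>b\<close> is free over the prescribed
  \<open>X\<close>.\<close>

lemma free_move_element:
  assumes "free b Q M" "g \<in> G" "fixes_pointwise g M" "g ` Q \<subseteq> X" "X \<in> \<U>"
  obtains g' where "g' \<in> G" "\<And>x. x \<in> Q \<Longrightarrow> g' x = g x" "free (g' b) X M"
proof -
  have "free (g b) (g ` Q) M" using free_image[OF assms(1,2)] assms(3) by (simp add: fixes_pointwise_image)
  then obtain c where c: "same_type (g b) c (g ` Q)" "free c X M" using free_extend assms by blast
  then obtain t where t: "t \<in> G" "fixes_pointwise t (g ` Q)" "t (g b) = c" unfolding same_type_def by blast
  show ?thesis
    by (rule that[of "t \<circ> g"]) (use t c assms G_comp in \<open>auto simp: fixes_pointwise_def\<close>)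
qed

text \<open>The place where symmetry enters the construction. Since \<open>a\<close> lies in
  \<open>X\<close>, it turns the freeness of \<open>b\<close> into a model \<open>Z\<close> that
  contains \<open>b\<close> and \<open>Q\<close> and over which \<open>a\<close> is free. Then
  \<open>T\<close> can be moved away from \<open>a\<close> over \<open>Z\<close>, hence with
  \<open>b\<close> fixed.\<close>

lemma free_symmetric_move:
  assumes a: "free a Q M" and b: "free b X M" and QX: "Q \<subseteq> X" and aX: "a \<in> X" and T: "T \<in> \<U>" "Q \<subseteq> T"
  obtains h where "h \<in> G" "fixes_pointwise h Q" "h b = b" "free a (h ` T) M"
proof -
  note Q = freeD[OF a] and X = freeD[OF b]
  have "free b X Q" by (rule free_mono[OF b]) (use Q X QX in auto)
  then obtain Z where Z: "Z \<in> \<U>" "b \<in> Z" "free a Z Q"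
    using free_symmetric[OF Q(2) X(4,2) aX] by blast
  obtain T' where T': "T' \<in> \<U>" "Z \<union> T \<subseteq> T'" using cover_Un Z T by blast
  obtain h where h: "h \<in> G" "fixes_pointwise h Z" "free a (h ` T') M"
    using free_move_base[OF free_trans[OF a Z(3)], of T'] T' by blast
  have hQ: "fixes_pointwise h Q" using fixes_pointwise_subset h(2) freeD[OF Z(3)] by blast
  have "Q \<subseteq> h ` T" using image_mono[OF T(2), of h] hQ by (simp add: fixes_pointwise_image)
  then have "free a (h ` T) M"
    by (intro free_mono[OF h(3)]) (use Q T T' G_image h in auto)
  then show ?thesis using that h hQ Z(2) by (auto simp: fixes_pointwise_def)
qed

section \<open>Exchanging two free systems\<close>

text \<open>A chain witnessing independence, with continuity dropped: \<open>Q j\<close> need not be a union for limit \<open>j\<close>.\<close>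

definition free_system ::
    "'c set \<Rightarrow> ('c set \<Rightarrow> 'a set) \<Rightarrow> ('c set \<Rightarrow> 'a set) \<Rightarrow> ('c set \<Rightarrow> 'a) \<Rightarrow> 'a set \<Rightarrow> bool" where
  "free_system \<alpha> Q Q' b M \<longleftrightarrow> (\<forall>j\<in>below \<kappa> \<alpha>.
     Q' j \<in> \<U> \<and> Q j \<subseteq> Q' j \<and> b j \<in> Q' j \<and> free (b j) (Q j) M \<and> (\<forall>k\<in>below \<kappa> j. Q' k \<subseteq> Q j))"

lemma free_systemD:
  assumes "free_system \<alpha> Q Q' b M" "j \<in> below \<kappa> \<alpha>"
  shows "Q' j \<in> \<U>" "Q j \<subseteq> Q' j" "b j \<in> Q' j" "free (b j) (Q j) M" "Q j \<in> \<U>" "M \<in> \<U>" "M \<subseteq> Q j"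
    "k \<in> below \<kappa> j \<Longrightarrow> Q' k \<subseteq> Q j"
  using assms freeD[of "b j" "Q j" M] unfolding free_system_def by auto

lemma free_system_image:
  assumes "free_system \<alpha> Q Q' b M" "\<rho> \<in> G" "fixes_pointwise \<rho> M"
  shows "free_system \<alpha> (\<lambda>j. \<rho> ` Q j) (\<lambda>j. \<rho> ` Q' j) (\<lambda>j. \<rho> (b j)) M"
  unfolding free_system_def
proof (intro ballI conjI)
  fix j assume j: "j \<in> below \<kappa> \<alpha>"
  note Q = free_systemD[OF assms(1) j]
  show "\<rho> ` Q' j \<in> \<U>" "\<rho> ` Q j \<subseteq> \<rho> ` Q' j" "\<rho> (b j) \<in> \<rho> ` Q' j"
    using Q(1,2,3) G_image[OF assms(2)] by auto
  show "free (\<rho> (b j)) (\<rho> ` Q j) M"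
    using free_image[OF Q(4) assms(2)] fixes_pointwise_image[OF assms(3)] by simp
  show "\<rho> ` Q' k \<subseteq> \<rho> ` Q j" if "k \<in> below \<kappa> j" for k
    using Q(8)[OF that] by blast
qed

text \<open>Adds to gluing that the common map fixes \<open>M\<close>; with nothing to glue, the
  identity has to be chosen explicitly.\<close>

lemma glue_over:
  assumes "M \<in> \<U>"
    and "\<And>k. k \<in> below \<kappa> j \<Longrightarrow> f k \<in> G \<and> fixes_pointwise (f k) M \<and> M \<subseteq> V k \<and> V k \<in> \<U>"
    and "\<And>k l. k \<in> below \<kappa> j \<Longrightarrow> l \<in> below \<kappa> k \<Longrightarrow> V l \<subseteq> V k \<and> (\<forall>x\<in>V l. f k x = f l x)"
  obtains g where "g \<in> G" "fixes_pointwise g M" "\<And>k x. k \<in> below \<kappa> j \<Longrightarrow> x \<in> V k \<Longrightarrow> g x = f k x"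
proof (cases "below \<kappa> j = {}")
  case True
  then show ?thesis using that[of id] G_id by (auto simp: fixes_pointwise_def)
next
  case False
  then obtain k where k: "k \<in> below \<kappa> j" by blast
  obtain g where g: "g \<in> G" "\<forall>k\<in>below \<kappa> j. \<forall>x\<in>V k. g x = f k x"
    using glue[of j f V] assms(2,3) by blast
  have "fixes_pointwise g M"
    using assms(2)[OF k] g(2) k unfolding fixes_pointwise_def by (metis subsetD)
  then show ?thesis using that g by blast
qed

text \<open>One element changes places with a whole chain: in the result every \<open>b j\<close> is
  free over a set containing \<open>a\<close>. The clause \<open>univ_over (X j) (Q j)\<close> is
  what later allows unions of chains obtained in this way.\<close>

lemma free_system_absorb:
  assumes sys: "free_system \<alpha> Q Q' b M" and a: "free a Y M" and Y: "\<And>j. j \<in> below \<kappa> \<alpha> \<Longrightarrow> Q' j \<subseteq> Y"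
  obtains X X' where "free_system \<alpha> X X' b M"
    "\<And>j. j \<in> below \<kappa> \<alpha> \<Longrightarrow> univ_over (X j) (Q j) \<and> Q' j \<subseteq> X' j \<and> a \<in> X j"
proof (cases "below \<kappa> \<alpha> = {}")
  case True
  then show ?thesis using that unfolding free_system_def by blast
next
  case nonempty: False
  have M: "M \<in> \<U>" and aU: "a \<in> \<Union>\<U>" using freeD[OF a] by auto
  note Q = free_systemD[OF sys]
  txt \<open>
    \<open>g j\<close> embeds \<open>Q' j\<close> into \<open>q j\<close>, over which \<open>a\<close> is free, while \<open>x j\<close> contains \<open>a\<close> and the image of
    \<open>b j\<close> is free from it. In the end \<open>a\<close> has the same type over the image of the whole system as its
    own image does, so the copy can be moved back while fixing \<open>a\<close>.
  \<close>
  define A where "A j = (\<lambda>(q, x, x', g). j \<in> below \<kappa> \<alpha> \<longrightarrow>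
    g \<in> G \<and> fixes_pointwise g M \<and> q \<in> \<U> \<and> x \<in> \<U> \<and> x' \<in> \<U> \<and> g ` Q' j \<subseteq> q \<and> q \<subseteq> x' \<and> x \<subseteq> x' \<and>
    a \<in> x \<and> free a q M \<and> free (g (b j)) x M \<and> univ_over x (g ` Q j))" for j
  define B where "B k = (\<lambda>(q :: 'a set, x :: 'a set, x' :: 'a set, g :: 'a \<Rightarrow> 'a) j
    (q1 :: 'a set, x1 :: 'a set, x1' :: 'a set, g1 :: 'a \<Rightarrow> 'a). j \<in> below \<kappa> \<alpha> \<longrightarrow>
    x' \<subseteq> x1 \<and> univ_over q1 q \<and> (\<forall>z\<in>Q' k. g1 z = g z))" for k :: "'c set"
  have "\<exists>f. \<forall>j. A j (f j) \<and> (\<forall>k\<in>below \<kappa> j. B k (f k) j (f j))"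
  proof (rule ord_recursion_pairs)
    fix j f assume IH: "\<And>i. i \<in> below \<kappa> j \<Longrightarrow> A i (f i) \<and> (\<forall>k\<in>below \<kappa> i. B k (f k) i (f i))"
    show "\<exists>y. A j y \<and> (\<forall>k\<in>below \<kappa> j. B k (f k) j y)"
    proof (cases "j \<in> below \<kappa> \<alpha>")
      case False
      then have "A j y" "B k (f k) j y" for y k by (auto simp: A_def B_def split: prod.splits)
      then show ?thesis by blast
    next
      case j: True
      have lt: "i \<in> below \<kappa> \<alpha>" if "i \<in> below \<kappa> j" for i by (rule below_trans[OF that j])
      define q where "q i = fst (f i)" for i
      define x where "x i = fst (snd (f i))" for i
      define x' where "x' i = fst (snd (snd (f i)))" for i
      define g where "g i = snd (snd (snd (f i)))" for i
      have f: "f i = (q i, x i, x' i, g i)" for i by (simp add: q_def x_def x'_def g_def)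
      have IA: "g i \<in> G" "fixes_pointwise (g i) M" "q i \<in> \<U>" "x i \<in> \<U>" "x' i \<in> \<U>" "g i ` Q' i \<subseteq> q i"
        "q i \<subseteq> x' i" "x i \<subseteq> x' i" "a \<in> x i" "free a (q i) M" if "i \<in> below \<kappa> j" for i
        using conjunct1[OF IH[OF that]] lt[OF that] by (auto simp: A_def f)
      have IB: "x' k \<subseteq> x i" "univ_over (q i) (q k)" "\<And>z. z \<in> Q' k \<Longrightarrow> g i z = g k z"
        if "i \<in> below \<kappa> j" "k \<in> below \<kappa> i" for i k
        using conjunct2[OF IH[OF that(1)]] lt[OF that(1)] that(2) by (auto simp: B_def f)
      obtain h0 where h0: "h0 \<in> G" "fixes_pointwise h0 M"
        and h0g: "\<And>k z. k \<in> below \<kappa> j \<Longrightarrow> z \<in> Q' k \<Longrightarrow> h0 z = g k z"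
      proof (rule glue_over[of M j g Q'])
        fix k assume k: "k \<in> below \<kappa> j"
        show "g k \<in> G \<and> fixes_pointwise (g k) M \<and> M \<subseteq> Q' k \<and> Q' k \<in> \<U>"
          using IA(1,2)[OF k] Q(1,2,7)[OF lt[OF k]] by auto
        fix l assume l: "l \<in> below \<kappa> k"
        show "Q' l \<subseteq> Q' k \<and> (\<forall>z\<in>Q' l. g k z = g l z)"
          using IB(3)[OF k l] Q(8)[OF lt[OF k] l] Q(2)[OF lt[OF k]] by blast
      qed (use M in blast)+
      \<comment> \<open>\<open>q0\<close> collects the earlier \<open>q k\<close>; \<open>a\<close>
        is free over their union because later ones are universal over earlier ones. With no earlier
        stage, the base \<open>M\<close> itself serves.\<close>
      obtain q0 where q0: "free a q0 M" "\<And>k. k \<in> below \<kappa> j \<Longrightarrow> q k \<subseteq> q0"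
      proof (cases "below \<kappa> j = {}")
        case True
        have "free a M M" by (rule free_mono[OF a]) (use freeD[OF a] in auto)
        then show ?thesis using that True by blast
      next
        case False
        have "free a (\<Union>k\<in>below \<kappa> j. q k) M"
          by (rule free_Union[OF False IA(10) IB(2)])
        then show ?thesis using that by blast
      qed
      have hQ: "h0 ` Q j \<in> \<U>" using G_image[OF h0(1)] Q(5)[OF j] by blast
      obtain T where T: "T \<in> \<U>" "q0 \<union> h0 ` Q j \<subseteq> T" using cover_Un freeD(2)[OF q0(1)] hQ by blast
      \<comment> \<open>Images of earlier stages lie in \<open>q0\<close>, so fixing
        \<open>q0\<close> keeps the new embedding in agreement with all earlier ones.\<close>
      obtain h1 where h1: "h1 \<in> G" "fixes_pointwise h1 q0" "free a (h1 ` T) M"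
        using free_move_base[OF q0(1), of T] T by blast
      define g' where "g' = h1 \<circ> h0"
      define q1 where "q1 = h1 ` T"
      have q1: "q1 \<in> \<U>" "q0 \<subseteq> q1" "M \<subseteq> q1"
        using G_image[OF h1(1) T(1)] T(2) h1(2) freeD(3)[OF h1(3)]
        by (auto simp: q1_def fixes_pointwise_def image_iff) (metis UnCI subsetD)
      have Mq0: "M \<subseteq> q0" using freeD[OF q0(1)] by blast
      have g': "g' \<in> G" "fixes_pointwise g' M" "g' ` Q j \<subseteq> q1"
        unfolding g'_def q1_def using h0 h1 Mq0 T(2) by (auto simp: G_comp fixes_pointwise_def)
      have g'g: "g' z = g k z" if "k \<in> below \<kappa> j" "z \<in> Q' k" for k z
      proof -
        have "g k z \<in> q0" using IA(6)[OF that(1)] q0(2)[OF that(1)] that(2) by blast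
        then show ?thesis using h0g[OF that] h1(2) by (simp add: g'_def fixes_pointwise_def)
      qed
      obtain S where S: "S \<in> \<U>" "a \<in> S" "\<And>k. k \<in> below \<kappa> j \<Longrightarrow> x' k \<subseteq> S"
      proof -
        obtain S1 where S1: "S1 \<in> \<U>" "(\<Union>k\<in>below \<kappa> j. x' k) \<subseteq> S1"
          using cover_family[of j x'] IA(5) by blast
        obtain S2 where S2: "S2 \<in> \<U>" "a \<in> S2" using aU by blast
        obtain S where "S \<in> \<U>" "S1 \<union> S2 \<subseteq> S" using cover_Un[OF S1(1) S2(1)] by blast
        then show ?thesis using that S1(2) S2(2) by blast
      qed
      \<comment> \<open>\<open>x1\<close> contains \<open>a\<close> and everything built earlier.
        Being universal over \<open>q1\<close>, it is universal over the image of
        \<open>Q j\<close>, which lies inside \<open>q1\<close>.\<close>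
      obtain x1 where x1: "univ_over x1 q1" "S \<subseteq> x1" by (rule ex_univ_above[OF q1(1) S(1)])
      note x1D = univ_overD[OF x1(1)]
      \<comment> \<open>Only the embedding of \<open>Q j\<close> is settled so far, so it may be
        continued in such a way that the image of \<open>b j\<close> is free over
        \<open>x1\<close>.\<close>
      obtain g1 where g1: "g1 \<in> G" "\<And>z. z \<in> Q j \<Longrightarrow> g1 z = g' z" "free (g1 (b j)) x1 M"
        using free_move_element[OF Q(4)[OF j] g'(1,2), of x1] g'(3) x1D by (metis order_trans)
      have hQ': "g1 ` Q' j \<in> \<U>" using G_image[OF g1(1)] Q(1)[OF j] by blast
      obtain T1 where T1: "T1 \<in> \<U>" "q1 \<union> g1 ` Q' j \<subseteq> T1" using cover_Un[OF q1(1) hQ'] by blast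
      obtain T2 where T2: "univ_over T2 q1" "T1 \<subseteq> T2" by (rule ex_univ_above[OF q1(1) T1(1)])
      note T2D = univ_overD[OF T2(1)]
      have ax1: "a \<in> x1" using S(2) x1(2) by blast
      \<comment> \<open>Now the rest of the image of \<open>Q' j\<close> is moved away from
        \<open>a\<close>, while the image just chosen for \<open>b j\<close> is kept in
        place.\<close>
      obtain h2 where h2: "h2 \<in> G" "fixes_pointwise h2 q1" "h2 (g1 (b j)) = g1 (b j)" "free a (h2 ` T2) M"
        by (rule free_symmetric_move[OF h1(3)[folded q1_def] g1(3) x1D(3) ax1 T2D(2,3)])
      define g2 where "g2 = h2 \<circ> g1"
      define q2 where "q2 = h2 ` T2"
      have univ2: "univ_over q2 q1"
        using univ_over_image[OF T2(1) h2(1)] h2(2) by (simp add: q2_def fixes_pointwise_image)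
      note q2 = univ_overD[OF univ2]
      have g2Q: "g2 z = g' z" if "z \<in> Q j" for z
        using g1(2)[OF that] g'(3) h2(2) that by (auto simp: g2_def fixes_pointwise_def)
      have g2: "g2 \<in> G" "g2 ` Q' j \<subseteq> q2" "g2 (b j) = g1 (b j)"
      proof -
        have "g1 ` Q' j \<subseteq> T2" using T1(2) T2(2) by blast
        then show "g2 ` Q' j \<subseteq> q2" unfolding g2_def q2_def image_comp[symmetric] by (rule image_mono)
      qed (simp_all add: g2_def G_comp h2 g1(1))
      have g2M: "fixes_pointwise g2 M"
        using g2Q g'(2) Q(7)[OF j] unfolding fixes_pointwise_def by (metis subsetD)
      obtain x2 where x2: "x2 \<in> \<U>" "x1 \<union> q2 \<subseteq> x2" using cover_Un[OF x1D(2) q2(2)] by blast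
      have g2img: "g2 ` Q j \<subseteq> q1" "g2 ` Q j \<in> \<U>"
        using g2Q g'(3) G_image[OF g2(1) Q(5)[OF j]] by auto
      have "A j (q2, x1, x2, g2)"
        unfolding A_def using g2 g2M q2 x1D x2 ax1 h2(4) g1(3) univ_over_base[OF x1(1) g2img]
        by (auto simp: q2_def)
      moreover have "B k (f k) j (q2, x1, x2, g2)" if k: "k \<in> below \<kappa> j" for k
        unfolding B_def f split
      proof (intro impI conjI ballI)
        show "x' k \<subseteq> x1" using S(3)[OF k] x1(2) by blast
        show "univ_over q2 (q k)"
          by (rule univ_over_base[OF univ2]) (use q0(2)[OF k] q1(2) IA(3)[OF k] in auto)
        show "g2 z = g k z" if "z \<in> Q' k" for z
          using g2Q g'g[OF k that] Q(8)[OF j k] that by auto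
      qed
      ultimately show ?thesis by blast
    qed
  qed
  then obtain f where f0: "\<And>j. A j (f j)" "\<And>j k. k \<in> below \<kappa> j \<Longrightarrow> B k (f k) j (f j)" by blast
  define q where "q i = fst (f i)" for i
  define x where "x i = fst (snd (f i))" for i
  define x' where "x' i = fst (snd (snd (f i)))" for i
  define g where "g i = snd (snd (snd (f i)))" for i
  have f: "f i = (q i, x i, x' i, g i)" for i by (simp add: q_def x_def x'_def g_def)
  have IA: "g i \<in> G" "fixes_pointwise (g i) M" "q i \<in> \<U>" "x i \<in> \<U>" "x' i \<in> \<U>" "g i ` Q' i \<subseteq> q i"
    "q i \<subseteq> x' i" "x i \<subseteq> x' i" "a \<in> x i" "free a (q i) M" "free (g i (b i)) (x i) M"
    "univ_over (x i) (g i ` Q i)"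
    if "i \<in> below \<kappa> \<alpha>" for i
    using f0(1)[of i] that by (auto simp: A_def f)
  have IB: "x' k \<subseteq> x i" "univ_over (q i) (q k)" "\<And>z. z \<in> Q' k \<Longrightarrow> g i z = g k z"
    if "i \<in> below \<kappa> \<alpha>" "k \<in> below \<kappa> i" for i k
    using f0(2)[OF that(2)] that(1) by (auto simp: B_def f)
  have Q'mono: "Q' l \<subseteq> Q' k" if "k \<in> below \<kappa> \<alpha>" "l \<in> below \<kappa> k" for k l
    using Q(8)[OF that] Q(2)[OF that(1)] by blast
  obtain h where h: "h \<in> G" "fixes_pointwise h M"
    and hg: "\<And>k z. k \<in> below \<kappa> \<alpha> \<Longrightarrow> z \<in> Q' k \<Longrightarrow> h z = g k z"
  proof (rule glue_over[of M \<alpha> g Q'])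
    fix k assume k: "k \<in> below \<kappa> \<alpha>"
    show "g k \<in> G \<and> fixes_pointwise (g k) M \<and> M \<subseteq> Q' k \<and> Q' k \<in> \<U>"
      using IA(1,2)[OF k] Q(1,2,7)[OF k] by auto
    fix l assume l: "l \<in> below \<kappa> k"
    show "Q' l \<subseteq> Q' k \<and> (\<forall>z\<in>Q' l. g k z = g l z)"
      using IB(3)[OF k l] Q'mono[OF k l] by blast
  qed (use M in blast)+
  define R where "R = (\<Union>k\<in>below \<kappa> \<alpha>. Q' k)"
  obtain k0 where k0: "k0 \<in> below \<kappa> \<alpha>" using nonempty by blast
  have R: "R \<in> \<U>" "M \<subseteq> R" "R \<subseteq> Y"
  proof -
    show "R \<in> \<U>" unfolding R_def by (rule union_closed[OF nonempty Q(1) Q'mono])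
    show "M \<subseteq> R" unfolding R_def using Q(2,7)[OF k0] k0 by blast
    show "R \<subseteq> Y" unfolding R_def by (rule UN_least[OF Y])
  qed
  have fq: "free a (\<Union>k\<in>below \<kappa> \<alpha>. q k) M"
    by (rule free_Union[OF nonempty IA(10) IB(2)])
  have hR: "h ` R \<subseteq> (\<Union>k\<in>below \<kappa> \<alpha>. q k)" "h ` R \<in> \<U>"
    using hg IA(6) G_image[OF h(1) R(1)] by (auto simp: R_def) blast
  have hM: "h ` M = M" by (rule fixes_pointwise_image[OF h(2)])
  have MhR: "M \<subseteq> h ` R" using image_mono[OF R(2), of h] hM by simp
  have "free a (h ` R) M"
    by (rule free_mono[OF fq]) (use hR M MhR in auto)
  moreover have "free (h a) (h ` R) M"
  proof -
    have "free a R M" by (rule free_mono[OF a]) (use R M in auto)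
    from free_image[OF this h(1)] show ?thesis by (simp add: hM)
  qed
  moreover have "same_type a (h a) M"
    unfolding same_type_def using h by blast
  \<comment> \<open>\<open>a\<close> is free over the image of \<open>R\<close> by construction, and
    \<open>h a\<close> is so because \<open>a\<close> was free over \<open>Y\<close>. Their types
    agree over \<open>M\<close>, hence over that image, so \<open>h\<close> can be undone on
    \<open>R\<close> by a map fixing \<open>a\<close>.\<close>
  ultimately have "same_type a (h a) (h ` R)" by (rule free_unique)
  then obtain t where t: "t \<in> G" "fixes_pointwise t (h ` R)" "t a = h a" unfolding same_type_def by blast
  define r where "r = inv h \<circ> t"
  have r: "r \<in> G" "r a = a" "\<And>z. z \<in> R \<Longrightarrow> r (h z) = z"
    using h(1) t by (auto simp: r_def G_comp G_inv inv_apply fixes_pointwise_def)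
  have rg: "r (g j z) = z" if "j \<in> below \<kappa> \<alpha>" "z \<in> Q' j" for j z
    using r(3)[of z] hg[OF that] that unfolding R_def by auto
  have rgim: "r ` g j ` Z = Z" if "j \<in> below \<kappa> \<alpha>" "Z \<subseteq> Q' j" for j Z
  proof -
    have "r ` g j ` Z = (\<lambda>z. z) ` Z"
      unfolding image_image by (rule image_cong[OF refl]) (use rg that in blast)
    then show ?thesis by simp
  qed
  have rM: "fixes_pointwise r M"
    unfolding fixes_pointwise_def
  proof
    fix z assume "z \<in> M"
    then show "r z = z" using r(3)[of z] R(2) h(2) by (auto simp: fixes_pointwise_def)
  qed
  have "free_system \<alpha> x x' (\<lambda>j. g j (b j)) M"
    unfolding free_system_def
  proof (intro ballI conjI)
    fix j assume j: "j \<in> below \<kappa> \<alpha>"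
    show "x' j \<in> \<U>" "x j \<subseteq> x' j" "free (g j (b j)) (x j) M" using IA[OF j] by auto
    show "g j (b j) \<in> x' j" using IA(6,7)[OF j] Q(3)[OF j] by blast
    show "x' k \<subseteq> x j" if "k \<in> below \<kappa> j" for k using IB(1)[OF j that] .
  qed
  from free_system_image[OF this r(1) rM]
  have "free_system \<alpha> (\<lambda>j. r ` x j) (\<lambda>j. r ` x' j) b M"
    unfolding free_system_def using rg Q(3) by auto
  moreover have "univ_over (r ` x j) (Q j) \<and> Q' j \<subseteq> r ` x' j \<and> a \<in> r ` x j" if j: "j \<in> below \<kappa> \<alpha>" for j
  proof (intro conjI)
    show "univ_over (r ` x j) (Q j)"
      using univ_over_image[OF IA(12)[OF j] r(1)] rgim[OF j Q(2)[OF j]] by simp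
    have "r ` g j ` Q' j \<subseteq> r ` x' j" using IA(6,7)[OF j] by blast
    then show "Q' j \<subseteq> r ` x' j" using rgim[OF j order_refl] by simp
    show "a \<in> r ` x j" using IA(9)[OF j] r(2) by (metis imageI)
  qed
  ultimately show ?thesis by (rule that)
qed

text \<open>The \<open>a i\<close> are absorbed in turn, each into the whole chain of the
  \<open>b j\<close>. The model \<open>L\<close> contains all \<open>b j\<close> and lies below
  every \<open>P i\<close>, so the \<open>a i\<close> may be moved over \<open>L\<close> without
  disturbing \<open>b\<close>, and the final map back fixes \<open>L\<close> as well.\<close>

theorem free_systems_exchange:
  assumes sysP: "free_system \<alpha> P P' a M" and sysQ: "free_system \<beta> Q Q' b M"
    and \<alpha>: "below \<kappa> \<alpha> \<noteq> {}"
    and L: "L \<in> \<U>" "M \<subseteq> L" "\<And>i. i \<in> below \<kappa> \<alpha> \<Longrightarrow> L \<subseteq> P i" "\<And>j. j \<in> below \<kappa> \<beta> \<Longrightarrow> b j \<in> L"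
  obtains X X' where "free_system \<beta> X X' b M"
    "\<And>i j. i \<in> below \<kappa> \<alpha> \<Longrightarrow> j \<in> below \<kappa> \<beta> \<Longrightarrow> a i \<in> X j"
proof -
  note P = free_systemD[OF sysP]
  define A where "A i = (\<lambda>(x, x', f). i \<in> below \<kappa> \<alpha> \<longrightarrow>
    f \<in> G \<and> fixes_pointwise f L \<and> free_system \<beta> x x' b M \<and> (\<forall>j\<in>below \<kappa> \<beta>. f (a i) \<in> x j))" for i
  define B where "B k = (\<lambda>(x :: 'c set \<Rightarrow> 'a set, x' :: 'c set \<Rightarrow> 'a set, f :: 'a \<Rightarrow> 'a) i
    (x1 :: 'c set \<Rightarrow> 'a set, x1' :: 'c set \<Rightarrow> 'a set, f1 :: 'a \<Rightarrow> 'a). i \<in> below \<kappa> \<alpha> \<longrightarrow>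
    (\<forall>z\<in>P' k. f1 z = f z) \<and> (\<forall>j\<in>below \<kappa> \<beta>. univ_over (x1 j) (x j) \<and> x' j \<subseteq> x1' j))"
    for k :: "'c set"
  \<comment> \<open>Collecting earlier stages, needed both inside the recursion and at its end:
    embeddings are glued and chains are united index by index. Each \<open>b j\<close> stays free
    over the union because later chains are universal over earlier ones.\<close>
  have limit: thesis0 if \<gamma>: "\<gamma> = \<alpha> \<or> \<gamma> \<in> below \<kappa> \<alpha>"
    and f: "\<And>i. i \<in> below \<kappa> \<gamma> \<Longrightarrow> F i = (x i, x' i, f i)"
    and IH: "\<And>i. i \<in> below \<kappa> \<gamma> \<Longrightarrow> A i (F i) \<and> (\<forall>k\<in>below \<kappa> i. B k (F k) i (F i))"
    and conc: "\<And>g y y'. g \<in> G \<Longrightarrow> fixes_pointwise g L \<Longrightarrow>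
      (\<And>k z. k \<in> below \<kappa> \<gamma> \<Longrightarrow> z \<in> P' k \<Longrightarrow> g z = f k z) \<Longrightarrow> free_system \<beta> y y' b M \<Longrightarrow>
      (\<And>k j. k \<in> below \<kappa> \<gamma> \<Longrightarrow> j \<in> below \<kappa> \<beta> \<Longrightarrow> x k j \<subseteq> y j \<and> x' k j \<subseteq> y' j \<and> f k (a k) \<in> y j) \<Longrightarrow> thesis0"
    for \<gamma> F x x' f thesis0
  proof -
    have lt: "i \<in> below \<kappa> \<alpha>" if "i \<in> below \<kappa> \<gamma>" for i
      using \<gamma> that below_trans[of i \<gamma> \<alpha>] by blast
    have IA: "f i \<in> G" "fixes_pointwise (f i) L" "free_system \<beta> (x i) (x' i) b M"
      "\<And>j. j \<in> below \<kappa> \<beta> \<Longrightarrow> f i (a i) \<in> x i j" if "i \<in> below \<kappa> \<gamma>" for i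
      using conjunct1[OF IH[OF that]] lt[OF that] by (auto simp: A_def f[OF that])
    have IB: "\<And>z. z \<in> P' k \<Longrightarrow> f i z = f k z" "\<And>j. j \<in> below \<kappa> \<beta> \<Longrightarrow> univ_over (x i j) (x k j)"
      "\<And>j. j \<in> below \<kappa> \<beta> \<Longrightarrow> x' k j \<subseteq> x' i j" if i: "i \<in> below \<kappa> \<gamma>" and k: "k \<in> below \<kappa> i" for i k
      using bspec[OF conjunct2[OF IH[OF i]] k] lt[OF i] f[OF i] f[OF below_trans[OF k i]]
      by (auto simp: B_def)
    obtain g where g: "g \<in> G" "fixes_pointwise g L"
      "\<And>k z. k \<in> below \<kappa> \<gamma> \<Longrightarrow> z \<in> P' k \<Longrightarrow> g z = f k z"
    proof (rule glue_over[of L \<gamma> f P'])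
      fix k assume k: "k \<in> below \<kappa> \<gamma>"
      show "f k \<in> G \<and> fixes_pointwise (f k) L \<and> L \<subseteq> P' k \<and> P' k \<in> \<U>"
        using IA(1,2)[OF k] P(1,2)[OF lt[OF k]] L(3)[OF lt[OF k]] by auto
      fix l assume l: "l \<in> below \<kappa> k"
      show "P' l \<subseteq> P' k \<and> (\<forall>z\<in>P' l. f k z = f l z)"
        using IB(1)[OF k l] P(8)[OF lt[OF k] l] P(2)[OF lt[OF k]] by blast
    qed (use L in blast)+
    show thesis0
    proof (cases "below \<kappa> \<gamma> = {}")
      case True
      then show ?thesis using conc[OF g sysQ] by blast
    next
      case False
      define y where "y j = (\<Union>k\<in>below \<kappa> \<gamma>. x k j)" for j
      define y' where "y' j = (\<Union>k\<in>below \<kappa> \<gamma>. x' k j)" for j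
      have "free_system \<beta> y y' b M"
        unfolding free_system_def
      proof (intro ballI conjI)
        fix j assume j: "j \<in> below \<kappa> \<beta>"
        note sysD = free_systemD[OF IA(3) j]
        show "y' j \<in> \<U>"
          unfolding y'_def by (rule union_closed[OF False sysD(1) IB(3)[OF _ _ j]])
        show "y j \<subseteq> y' j" unfolding y_def y'_def using sysD(2) by blast
        show "b j \<in> y' j" unfolding y'_def using False sysD(3) by blast
        show "free (b j) (y j) M"
          unfolding y_def by (rule free_Union[OF False sysD(4) IB(2)[OF _ _ j]])
        fix k assume "k \<in> below \<kappa> j"
        then show "y' k \<subseteq> y j" unfolding y_def y'_def using sysD(8) by blast
      qed
      then show ?thesis
        using conc[OF g, of y y'] IA(4) unfolding y_def y'_def by blast
    qed
  qed
  have "\<exists>F. \<forall>i. A i (F i) \<and> (\<forall>k\<in>below \<kappa> i. B k (F k) i (F i))"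
  proof (rule ord_recursion_pairs)
    fix i F assume IH: "\<And>j. j \<in> below \<kappa> i \<Longrightarrow> A j (F j) \<and> (\<forall>k\<in>below \<kappa> j. B k (F k) j (F j))"
    show "\<exists>y. A i y \<and> (\<forall>k\<in>below \<kappa> i. B k (F k) i y)"
    proof (cases "i \<in> below \<kappa> \<alpha>")
      case False
      then have "A i y" "B k (F k) i y" for y k by (auto simp: A_def B_def split: prod.splits)
      then show ?thesis by blast
    next
      case i: True
      define x where "x j = fst (F j)" for j
      define x' where "x' j = fst (snd (F j))" for j
      define f where "f j = snd (snd (F j))" for j
      have F: "F j = (x j, x' j, f j)" for j by (simp add: x_def x'_def f_def)
      obtain g y y' where g: "g \<in> G" "fixes_pointwise g L"
        and gf: "\<And>k z. k \<in> below \<kappa> i \<Longrightarrow> z \<in> P' k \<Longrightarrow> g z = f k z"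
        and y: "free_system \<beta> y y' b M"
        and xy: "\<And>k j. k \<in> below \<kappa> i \<Longrightarrow> j \<in> below \<kappa> \<beta> \<Longrightarrow> x k j \<subseteq> y j \<and> x' k j \<subseteq> y' j \<and> f k (a k) \<in> y j"
        by (rule limit[of i F x x' f]) (use i F IH in blast)+
      \<comment> \<open>\<open>S\<close> bounds the entire current chain. The image of
        \<open>a i\<close> will be made free over a \<open>Y\<close> that also contains the image of
        \<open>P i\<close>, which is what absorbing it requires.\<close>
      obtain S where S: "S \<in> \<U>" "(\<Union>j\<in>below \<kappa> \<beta>. y' j) \<subseteq> S"
        using cover_family[of \<beta> y'] free_systemD(1)[OF y] by blast
      have gP: "g ` P i \<in> \<U>" using G_image[OF g(1)] P(5)[OF i] by blast
      obtain Y where Y: "Y \<in> \<U>" "S \<union> g ` P i \<subseteq> Y" using cover_Un[OF S(1) gP] by blast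
      have gM: "fixes_pointwise g M" using fixes_pointwise_subset g(2) L(2) by blast
      obtain g1 where g1: "g1 \<in> G" "\<And>z. z \<in> P i \<Longrightarrow> g1 z = g z" "free (g1 (a i)) Y M"
        using free_move_element[OF P(4)[OF i] g(1) gM, of Y] Y by blast
      obtain X X' where X: "free_system \<beta> X X' b M"
        "\<And>j. j \<in> below \<kappa> \<beta> \<Longrightarrow> univ_over (X j) (y j) \<and> y' j \<subseteq> X' j \<and> g1 (a i) \<in> X j"
        using free_system_absorb[OF y g1(3)] Y(2) S(2) by blast
      have "fixes_pointwise g1 L"
        using g(2) g1(2) L(3)[OF i] unfolding fixes_pointwise_def by (metis subsetD)
      then have "A i (X, X', g1)" unfolding A_def using g1(1) X by auto
      moreover have "B k (F k) i (X, X', g1)" if k: "k \<in> below \<kappa> i" for k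
        unfolding B_def F split
      proof (intro impI conjI ballI)
        show "g1 z = f k z" if "z \<in> P' k" for z
          using g1(2) gf[OF k that] P(8)[OF i k] that by auto
        fix j assume j: "j \<in> below \<kappa> \<beta>"
        have "x k j \<in> \<U>"
          using conjunct1[OF IH[OF k]] below_trans[OF k i] free_systemD(5)[OF _ j] by (auto simp: A_def F)
        then show "univ_over (X j) (x k j)"
          using univ_over_base X(2)[OF j] xy[OF k j] by blast
        show "x' k j \<subseteq> X' j" using X(2)[OF j] xy[OF k j] by blast
      qed
      ultimately show ?thesis by blast
    qed
  qed
  then obtain F where F0: "\<And>i. A i (F i) \<and> (\<forall>k\<in>below \<kappa> i. B k (F k) i (F i))" by blast
  define x where "x j = fst (F j)" for j
  define x' where "x' j = fst (snd (F j))" for j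
  define f where "f j = snd (snd (F j))" for j
  have F: "F j = (x j, x' j, f j)" for j by (simp add: x_def x'_def f_def)
  obtain g y y' where g: "g \<in> G" "fixes_pointwise g L"
    and gf: "\<And>k z. k \<in> below \<kappa> \<alpha> \<Longrightarrow> z \<in> P' k \<Longrightarrow> g z = f k z"
    and y: "free_system \<beta> y y' b M"
    and xy: "\<And>k j. k \<in> below \<kappa> \<alpha> \<Longrightarrow> j \<in> below \<kappa> \<beta> \<Longrightarrow> x k j \<subseteq> y j \<and> x' k j \<subseteq> y' j \<and> f k (a k) \<in> y j"
    by (rule limit[of \<alpha> F x x' f]) (use F F0 in blast)+
  have invL: "fixes_pointwise (inv g) L" by (rule fixes_pointwise_inv[OF g])
  then have invM: "fixes_pointwise (inv g) M" using fixes_pointwise_subset L(2) by blast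
  have "free_system \<beta> (\<lambda>j. inv g ` y j) (\<lambda>j. inv g ` y' j) (\<lambda>j. inv g (b j)) M"
    by (rule free_system_image[OF y G_inv[OF g(1)] invM])
  moreover have "inv g (b j) = b j" if "j \<in> below \<kappa> \<beta>" for j
    using invL L(4)[OF that] by (auto simp: fixes_pointwise_def)
  ultimately have "free_system \<beta> (\<lambda>j. inv g ` y j) (\<lambda>j. inv g ` y' j) b M"
    unfolding free_system_def by simp
  moreover have "a i \<in> inv g ` y j" if i: "i \<in> below \<kappa> \<alpha>" and j: "j \<in> below \<kappa> \<beta>" for i j
  proof -
    have "g (a i) \<in> y j" using gf[OF i P(3)[OF i]] xy[OF i j] by simp
    then show ?thesis using inv_apply[OF g(1), of "a i"] by (metis imageI)
  qed
  ultimately show ?thesis by (rule that)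
qed

end

section \<open>Structures and their isomorphic images\<close>

text \<open>Outside their domains the interpretations take the defaults demanded by
  \<open>is_struct\<close>. The copy of \<open>M\<close> along an injective \<open>f\<close> is then
  literally unique, and \<open>some isomorphic copy\<close> can be replaced by this term.\<close>

definition image_struct ::
    "('f, 'r) vocabulary \<Rightarrow> ('a \<Rightarrow> 'a) \<Rightarrow> ('a, 'f, 'r) struct \<Rightarrow> ('a, 'f, 'r) struct" where
  "image_struct \<tau> f M = \<lparr>universe = f ` universe M,
     fun_int = (\<lambda>F xs. if F \<in> fun_syms \<tau> \<and> xs \<in> tuples (f ` universe M) (fun_arity \<tau> F)
       then f (fun_int M F (map (inv_into (universe M) f) xs)) else undefined),
     rel_int = (\<lambda>R xs. R \<in> rel_syms \<tau> \<and> xs \<in> tuples (f ` universe M) (rel_arity \<tau> R) \<and>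
       rel_int M R (map (inv_into (universe M) f) xs))\<rparr>"

lemma universe_image_struct [simp]: "universe (image_struct \<tau> f M) = f ` universe M"
  by (simp add: image_struct_def)

lemma tuples_mono: "A \<subseteq> B \<Longrightarrow> tuples A n \<subseteq> tuples B n"
  by (auto simp: tuples_def)

lemma map_tuples: "xs \<in> tuples A n \<Longrightarrow> f ` A \<subseteq> B \<Longrightarrow> map f xs \<in> tuples B n"
  by (auto simp: tuples_def)

lemma tuples_elem: "xs \<in> tuples A n \<Longrightarrow> x \<in> set xs \<Longrightarrow> x \<in> A"
  by (auto simp: tuples_def)

lemma map_inv_into_tuples:
  assumes "inj_on f A"
  shows "xs \<in> tuples A n \<Longrightarrow> map (inv_into A f) (map f xs) = xs"
    and "ys \<in> tuples (f ` A) n \<Longrightarrow> map f (map (inv_into A f) ys) = ys"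
    and "ys \<in> tuples (f ` A) n \<Longrightarrow> map (inv_into A f) ys \<in> tuples A n"
proof -
  show "map (inv_into A f) (map f xs) = xs" if "xs \<in> tuples A n"
    unfolding map_map by (rule map_idI) (use that assms in \<open>auto dest: tuples_elem\<close>)
  show "map f (map (inv_into A f) ys) = ys" if "ys \<in> tuples (f ` A) n"
    unfolding map_map by (rule map_idI) (use that in \<open>auto dest: tuples_elem simp: f_inv_into_f\<close>)
  show "map (inv_into A f) ys \<in> tuples A n" if "ys \<in> tuples (f ` A) n"
    by (rule map_tuples[OF that]) (auto intro: inv_into_into)
qed

lemma struct_iso_image_struct:
  assumes "is_struct \<tau> M" "inj_on f (universe M)"
  shows "struct_iso \<tau> f M (image_struct \<tau> f M)"
proof -
  note inv = map_inv_into_tuples[OF assms(2)]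
  have t: "map f xs \<in> tuples (f ` universe M) n" if "xs \<in> tuples (universe M) n" for xs n
    using that by (rule map_tuples) simp
  have "is_struct \<tau> (image_struct \<tau> f M)"
    using assms(1) inv(3) unfolding is_struct_def image_struct_def by auto
  then show ?thesis
    using assms t inv(1) unfolding struct_iso_def by (auto simp: image_struct_def bij_betw_def)
qed

lemma struct_eqI:
  fixes M N :: "('a, 'f, 'r) struct"
  assumes "is_struct \<tau> M" "is_struct \<tau> N" "universe M = universe N"
    and "\<And>F xs. F \<in> fun_syms \<tau> \<Longrightarrow> xs \<in> tuples (universe M) (fun_arity \<tau> F) \<Longrightarrow> fun_int M F xs = fun_int N F xs"
    and "\<And>R xs. R \<in> rel_syms \<tau> \<Longrightarrow> xs \<in> tuples (universe M) (rel_arity \<tau> R) \<Longrightarrow> rel_int M R xs = rel_int N R xs"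
  shows "M = N"
proof -
  have "fun_int M = fun_int N"
    using assms unfolding is_struct_def by (intro ext) metis
  moreover have "rel_int M = rel_int N"
    using assms unfolding is_struct_def by (intro ext) metis
  ultimately show ?thesis using assms(3) by (cases M, cases N) simp
qed

lemma substructure_eqI: "substructure \<tau> M N \<Longrightarrow> universe M = universe N \<Longrightarrow> M = N"
  by (rule struct_eqI[of \<tau>]) (auto simp: substructure_def)

lemma substructureD:
  assumes "substructure \<tau> M N"
  shows "is_struct \<tau> M" "is_struct \<tau> N" "universe M \<subseteq> universe N"
  using assms by (auto simp: substructure_def)

lemma substructure_of_common:
  assumes "substructure \<tau> M P" "substructure \<tau> N P" "universe M \<subseteq> universe N"
  shows "substructure \<tau> M N"
  using assms tuples_mono[OF assms(3)] unfolding substructure_def by (auto simp: subset_iff)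

lemma struct_isoD:
  assumes "struct_iso \<tau> f M N"
  shows "is_struct \<tau> M" "is_struct \<tau> N" "inj_on f (universe M)" "universe N = f ` universe M"
  using assms by (auto simp: struct_iso_def bij_betw_def)

lemma struct_iso_unique:
  assumes "struct_iso \<tau> f M N" "struct_iso \<tau> f M N'"
  shows "N = N'"
proof (rule struct_eqI[of \<tau>])
  note N = struct_isoD[OF assms(1)] and N' = struct_isoD[OF assms(2)]
  show "is_struct \<tau> N" "is_struct \<tau> N'" "universe N = universe N'" using N N' by auto
  note inv = map_inv_into_tuples[OF N(3)]
  show "fun_int N F ys = fun_int N' F ys"
    if F: "F \<in> fun_syms \<tau>" "ys \<in> tuples (universe N) (fun_arity \<tau> F)" for F ys
  proof -
    let ?xs = "map (inv_into (universe M) f) ys"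
    have "?xs \<in> tuples (universe M) (fun_arity \<tau> F)" "map f ?xs = ys" using F inv(2,3) N(4) by auto
    then show ?thesis using assms F(1) unfolding struct_iso_def by metis
  qed
  show "rel_int N R ys = rel_int N' R ys"
    if R: "R \<in> rel_syms \<tau>" "ys \<in> tuples (universe N) (rel_arity \<tau> R)" for R ys
  proof -
    let ?xs = "map (inv_into (universe M) f) ys"
    have "?xs \<in> tuples (universe M) (rel_arity \<tau> R)" "map f ?xs = ys" using R inv(2,3) N(4) by auto
    then show ?thesis using assms R(1) unfolding struct_iso_def by metis
  qed
qed

lemma struct_iso_eq_image: "struct_iso \<tau> f M N \<Longrightarrow> N = image_struct \<tau> f M"
  using struct_iso_unique struct_iso_image_struct struct_isoD by metis

lemma struct_iso_cong:
  assumes "struct_iso \<tau> f M N" "\<And>x. x \<in> universe M \<Longrightarrow> f x = g x"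
  shows "struct_iso \<tau> g M N"
proof -
  have m: "map f xs = map g xs" if "xs \<in> tuples (universe M) n" for xs n
    using that assms(2) by (auto dest: tuples_elem)
  have "is_struct \<tau> M" using assms(1) by (simp add: struct_iso_def)
  then have "fun_int M F xs \<in> universe M"
    if "F \<in> fun_syms \<tau>" "xs \<in> tuples (universe M) (fun_arity \<tau> F)" for F xs
    using that by (simp add: is_struct_def)
  moreover have "bij_betw g (universe M) (universe N)"
    using assms bij_betw_cong[of "universe M" f g] by (auto simp: struct_iso_def)
  ultimately show ?thesis
    using assms m unfolding struct_iso_def by metis
qed

lemma image_struct_cong:
  assumes "is_struct \<tau> M" "inj_on f (universe M)" "\<And>x. x \<in> universe M \<Longrightarrow> f x = g x"
  shows "image_struct \<tau> f M = image_struct \<tau> g M"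
  using struct_iso_eq_image[OF struct_iso_cong[OF struct_iso_image_struct[OF assms(1,2)]]] assms(3) by blast

lemma struct_iso_id: "is_struct \<tau> M \<Longrightarrow> struct_iso \<tau> id M M"
  by (auto simp: struct_iso_def)

lemma struct_iso_comp:
  assumes "struct_iso \<tau> f M N" "struct_iso \<tau> g N P"
  shows "struct_iso \<tau> (g \<circ> f) M P"
proof -
  have m: "map f xs \<in> tuples (universe N) n" if "xs \<in> tuples (universe M) n" for xs n
    using that struct_isoD(4)[OF assms(1)] by (auto intro: map_tuples)
  show ?thesis
    using assms m unfolding struct_iso_def by (auto intro: bij_betw_trans)
qed

lemma struct_iso_inv_into:
  assumes "struct_iso \<tau> f M N"
  shows "struct_iso \<tau> (inv_into (universe M) f) N M"
proof -
  note M = struct_isoD[OF assms] and inv = map_inv_into_tuples[OF struct_isoD(3)[OF assms]]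
  let ?g = "inv_into (universe M) f"
  have "?g (fun_int N F ys) = fun_int M F (map ?g ys)"
    if F: "F \<in> fun_syms \<tau>" "ys \<in> tuples (universe N) (fun_arity \<tau> F)" for F ys
  proof -
    have t: "map ?g ys \<in> tuples (universe M) (fun_arity \<tau> F)" "map f (map ?g ys) = ys"
      using F inv(2,3) M(4) by auto
    then have "f (fun_int M F (map ?g ys)) = fun_int N F ys"
      using assms F(1) unfolding struct_iso_def by metis
    moreover have "fun_int M F (map ?g ys) \<in> universe M"
      using M(1) F(1) t(1) by (simp add: is_struct_def)
    ultimately show ?thesis using M(3) inv_into_f_f by metis
  qed
  moreover have "rel_int N R ys = rel_int M R (map ?g ys)"
    if R: "R \<in> rel_syms \<tau>" "ys \<in> tuples (universe N) (rel_arity \<tau> R)" for R ys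
  proof -
    have "map ?g ys \<in> tuples (universe M) (rel_arity \<tau> R)" "map f (map ?g ys) = ys"
      using R inv(2,3) M(4) by auto
    then show ?thesis using assms R(1) unfolding struct_iso_def by metis
  qed
  ultimately show ?thesis
    using assms bij_betw_inv_into unfolding struct_iso_def by blast
qed

lemma struct_iso_substructure:
  assumes "struct_iso \<tau> f M N" "substructure \<tau> M0 M"
  shows "struct_iso \<tau> f M0 (image_struct \<tau> f M0)" "substructure \<tau> (image_struct \<tau> f M0) N"
proof -
  note M = struct_isoD[OF assms(1)] and M0 = substructureD[OF assms(2)]
  have inj: "inj_on f (universe M0)" using inj_on_subset[OF M(3) M0(3)] .
  show iso: "struct_iso \<tau> f M0 (image_struct \<tau> f M0)"
    by (rule struct_iso_image_struct[OF M0(1) inj])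
  note inv = map_inv_into_tuples[OF inj] and sub = tuples_mono[OF M0(3)]
  let ?I = "image_struct \<tau> f M0" and ?g = "inv_into (universe M0) f"
  have "fun_int ?I F ys = fun_int N F ys"
    if F: "F \<in> fun_syms \<tau>" "ys \<in> tuples (universe ?I) (fun_arity \<tau> F)" for F ys
  proof -
    have t: "map ?g ys \<in> tuples (universe M0) (fun_arity \<tau> F)" "map f (map ?g ys) = ys"
      using F inv(2,3) by auto
    then have "fun_int ?I F ys = f (fun_int M0 F (map ?g ys))"
      using iso F(1) unfolding struct_iso_def by metis
    also have "\<dots> = f (fun_int M F (map ?g ys))"
      using assms(2) F(1) t(1) by (simp add: substructure_def)
    also have "\<dots> = fun_int N F (map f (map ?g ys))"
      using assms(1) F(1) t(1) sub unfolding struct_iso_def by blast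
    finally show ?thesis using t(2) by simp
  qed
  moreover have "rel_int ?I R ys = rel_int N R ys"
    if R: "R \<in> rel_syms \<tau>" "ys \<in> tuples (universe ?I) (rel_arity \<tau> R)" for R ys
  proof -
    have t: "map ?g ys \<in> tuples (universe M0) (rel_arity \<tau> R)" "map f (map ?g ys) = ys"
      using R inv(2,3) by auto
    then have "rel_int ?I R ys = rel_int M0 R (map ?g ys)"
      using iso R(1) unfolding struct_iso_def by metis
    also have "\<dots> = rel_int M R (map ?g ys)"
      using assms(2) R(1) t(1) by (simp add: substructure_def)
    also have "\<dots> = rel_int N R (map f (map ?g ys))"
      using assms(1) R(1) t(1) sub unfolding struct_iso_def by blast
    finally show ?thesis using t(2) by simp
  qed
  ultimately show "substructure \<tau> ?I N"
    using struct_isoD(2)[OF iso] M M0(3) unfolding substructure_def by auto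
qed

lemma image_struct_comp:
  assumes "is_struct \<tau> M" "inj_on f (universe M)" "inj_on g (f ` universe M)"
  shows "image_struct \<tau> g (image_struct \<tau> f M) = image_struct \<tau> (g \<circ> f) M"
proof -
  have f: "struct_iso \<tau> f M (image_struct \<tau> f M)" by (rule struct_iso_image_struct[OF assms(1,2)])
  have "struct_iso \<tau> g (image_struct \<tau> f M) (image_struct \<tau> g (image_struct \<tau> f M))"
    by (rule struct_iso_image_struct[OF struct_isoD(2)[OF f]]) (simp add: assms)
  from struct_iso_comp[OF f this] show ?thesis by (rule struct_iso_eq_image)
qed

lemma image_struct_fixes:
  assumes "is_struct \<tau> M" "fixes_pointwise f (universe M)"
  shows "image_struct \<tau> f M = M"
proof -
  have "struct_iso \<tau> f M M"
    by (rule struct_iso_cong[OF struct_iso_id[OF assms(1)]]) (use assms(2) in \<open>auto simp: fixes_pointwise_def\<close>)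
  then show ?thesis using struct_iso_eq_image by metis
qed

text \<open>A tuple is finite, so in a chain it lies in a single member. \<open>S xs\<close> selects
  such a member and symbols are interpreted there; any other member containing the tuple gives the
  same value.\<close>

lemma ex_union_struct:
  assumes "D \<noteq> {}" and chain: "\<And>M N. M \<in> D \<Longrightarrow> N \<in> D \<Longrightarrow> substructure \<tau> M N \<or> substructure \<tau> N M"
  shows "\<exists>U. is_union \<tau> D U"
proof -
  let ?A = "\<Union>M\<in>D. universe M"
  have cover: "\<exists>M\<in>D. X \<subseteq> universe M" if "finite X" "X \<subseteq> ?A" for X
    using that
  proof (induction X)
    case empty
    then show ?case using assms(1) by blast
  next
    case (insert x X)
    then obtain M N where "M \<in> D" "X \<subseteq> universe M" "N \<in> D" "x \<in> universe N" by auto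
    then show ?case using chain[of M N] substructureD(3) by blast
  qed
  define S where "S xs = (SOME M. M \<in> D \<and> set xs \<subseteq> universe M)" for xs
  have S: "S xs \<in> D" "set xs \<subseteq> universe (S xs)" if "set xs \<subseteq> ?A" for xs
    using someI_ex[of "\<lambda>M. M \<in> D \<and> set xs \<subseteq> universe M"] cover[OF _ that] unfolding S_def by auto
  define U where "U = \<lparr>universe = ?A,
     fun_int = (\<lambda>F xs. if F \<in> fun_syms \<tau> \<and> xs \<in> tuples ?A (fun_arity \<tau> F)
       then fun_int (S xs) F xs else undefined),
     rel_int = (\<lambda>R xs. R \<in> rel_syms \<tau> \<and> xs \<in> tuples ?A (rel_arity \<tau> R) \<and> rel_int (S xs) R xs)\<rparr>"
  have str: "is_struct \<tau> M" if "M \<in> D" for M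
    using chain[OF that that] substructureD(1) by blast
  have S_tuples: "S xs \<in> D" "xs \<in> tuples (universe (S xs)) n" if "xs \<in> tuples ?A n" for xs n
    using S[of xs] that by (auto simp: tuples_def)
  have "is_struct \<tau> U"
    unfolding is_struct_def U_def
  proof (intro conjI ballI allI impI; simp)
    fix F xs assume F: "F \<in> fun_syms \<tau>" and xs: "xs \<in> tuples ?A (fun_arity \<tau> F)"
    then have "fun_int (S xs) F xs \<in> universe (S xs)"
      using str[OF S_tuples(1)[OF xs]] S_tuples(2)[OF xs] by (simp add: is_struct_def)
    then show "\<exists>M\<in>D. fun_int (S xs) F xs \<in> universe M"
      using S_tuples(1)[OF xs] by blast
  qed auto
  moreover have "substructure \<tau> M U" if M: "M \<in> D" for M
  proof -
    have sub: "tuples (universe M) n \<subseteq> tuples ?A n" for n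
      by (rule tuples_mono) (use M in blast)
    have eqF: "fun_int M F xs = fun_int (S xs) F xs"
      if F: "F \<in> fun_syms \<tau>" and xs: "xs \<in> tuples (universe M) (fun_arity \<tau> F)" for F xs
    proof -
      have A: "xs \<in> tuples ?A (fun_arity \<tau> F)" using xs sub by blast
      show ?thesis
        using chain[OF M S_tuples(1)[OF A]] S_tuples(2)[OF A] xs F unfolding substructure_def by auto
    qed
    have eqR: "rel_int M R xs = rel_int (S xs) R xs"
      if R: "R \<in> rel_syms \<tau>" and xs: "xs \<in> tuples (universe M) (rel_arity \<tau> R)" for R xs
    proof -
      have A: "xs \<in> tuples ?A (rel_arity \<tau> R)" using xs sub by blast
      show ?thesis
        using chain[OF M S_tuples(1)[OF A]] S_tuples(2)[OF A] xs R unfolding substructure_def by auto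
    qed
    show ?thesis
      unfolding substructure_def
    proof (intro conjI ballI)
      show "is_struct \<tau> M" "is_struct \<tau> U" by (fact str[OF M], fact)
      show "universe M \<subseteq> universe U" using M by (auto simp: U_def)
      show "fun_int M F xs = fun_int U F xs"
        if "F \<in> fun_syms \<tau>" "xs \<in> tuples (universe M) (fun_arity \<tau> F)" for F xs
        using eqF[OF that] that sub by (auto simp: U_def)
      show "rel_int M R xs = rel_int U R xs"
        if "R \<in> rel_syms \<tau>" "xs \<in> tuples (universe M) (rel_arity \<tau> R)" for R xs
        using eqR[OF that] that sub by (auto simp: U_def)
    qed
  qed
  ultimately show ?thesis
    unfolding is_union_def by (intro exI[of _ U]) (simp add: U_def)
qed

section \<open>Amalgamation and universal extensions\<close>

text \<open>\<open>ex_limit_model\<close> will be read off from the nonforking clause of a given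
  independent sequence; categoricity then transfers limit chains to other models of size
  \<kappa>.\<close>

locale categorical_superstable =
  fixes K :: "('a, 'f, 'r) class_data" and \<kappa> :: "'c rel"
  assumes Card_order: "Card_order \<kappa>"
    and aec: "aec K"
    and superstable: "superstable K \<kappa>"
    and categorical: "categorical K \<kappa>"
    and ex_limit_model: "\<exists>M. limit_model K \<kappa> M"
begin

section \<open>Embeddings as canonical images\<close>

abbreviation "\<K> \<equiv> models_of_card K \<kappa>"
abbreviation "img f M \<equiv> image_struct (voc K) f M"

lemma models_of_cardD: "M \<in> \<K> \<Longrightarrow> M \<in> models K" "M \<in> \<K> \<Longrightarrow> |universe M| =o \<kappa>"
  by (auto simp: models_of_card_def)

lemma abstract_class: "abstract_class K" and coherence: "coherence K" and tarski_vaught: "tarski_vaught K"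
  using aec by (auto simp: aec_def)

lemma is_struct_model: "M \<in> models K \<Longrightarrow> is_struct (voc K) M"
  using conjunct1[OF abstract_class[unfolded abstract_class_def]] by blast

lemmas abstract_class_conjs = conjunct2[OF abstract_class[unfolded abstract_class_def]]

lemma leD:
  assumes "le K M N"
  shows "M \<in> models K" "N \<in> models K" "substructure (voc K) M N" "universe M \<subseteq> universe N"
proof -
  show "M \<in> models K" "N \<in> models K" and sub: "substructure (voc K) M N"
    using conjunct1[OF abstract_class_conjs] assms by blast+
  show "universe M \<subseteq> universe N" by (rule substructureD(3)[OF sub])
qed

lemma le_refl: "M \<in> models K \<Longrightarrow> le K M M"
  using abstract_class_conjs[THEN conjunct2, THEN conjunct1] by blast

lemma le_trans: "le K M N \<Longrightarrow> le K N P \<Longrightarrow> le K M P"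
  using abstract_class_conjs[THEN conjunct2, THEN conjunct2, THEN conjunct2, THEN conjunct1] by blast

lemma iso_models: "M \<in> models K \<Longrightarrow> struct_iso (voc K) f M N \<Longrightarrow> N \<in> models K"
  using abstract_class_conjs[THEN conjunct2, THEN conjunct2, THEN conjunct2, THEN conjunct2, THEN conjunct1]
  by blast

lemma iso_le: "le K M N \<Longrightarrow> struct_iso (voc K) f N N' \<Longrightarrow> struct_iso (voc K) f M M' \<Longrightarrow> le K M' N'"
  using abstract_class_conjs[THEN conjunct2, THEN conjunct2, THEN conjunct2, THEN conjunct2, THEN conjunct2]
  by blast

lemma le_common:
  assumes "le K M P" "le K N P" "universe M \<subseteq> universe N"
  shows "le K M N"
  using coherence substructure_of_common[OF leD(3)[OF assms(1)] leD(3)[OF assms(2)] assms(3)] assms leD(1)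
  unfolding coherence_def by blast

lemma img_iso: "M \<in> models K \<Longrightarrow> inj_on f (universe M) \<Longrightarrow> struct_iso (voc K) f M (img f M)"
  using struct_iso_image_struct is_struct_model by blast

lemma img_models: "M \<in> models K \<Longrightarrow> inj_on f (universe M) \<Longrightarrow> img f M \<in> models K"
  using img_iso iso_models by blast

lemma img_models_of_card:
  assumes "M \<in> \<K>" "inj_on f (universe M)"
  shows "img f M \<in> \<K>"
proof -
  have "bij_betw f (universe M) (f ` universe M)" using assms(2) by (simp add: bij_betw_def)
  then have "|universe M| =o |f ` universe M|" by (rule card_of_ordIsoI)
  then have "|f ` universe M| =o \<kappa>"
    using models_of_cardD(2)[OF assms(1)] ordIso_symmetric ordIso_transitive by blast
  then show ?thesis
    using img_models[OF models_of_cardD(1)[OF assms(1)] assms(2)] by (simp add: models_of_card_def)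
qed

lemma img_le: "le K M N \<Longrightarrow> inj_on f (universe N) \<Longrightarrow> le K (img f M) (img f N)"
  using iso_le img_iso leD inj_on_subset by metis

lemma img_comp:
  "M \<in> models K \<Longrightarrow> inj_on f (universe M) \<Longrightarrow> inj_on g (f ` universe M) \<Longrightarrow> img g (img f M) = img (g \<circ> f) M"
  using image_struct_comp is_struct_model by blast

lemma img_cong:
  "M \<in> models K \<Longrightarrow> inj_on f (universe M) \<Longrightarrow> (\<And>x. x \<in> universe M \<Longrightarrow> f x = g x) \<Longrightarrow> img f M = img g M"
  using image_struct_cong is_struct_model by blast

lemma img_fixes: "M \<in> models K \<Longrightarrow> fixes_pointwise f (universe M) \<Longrightarrow> img f M = M"
  using image_struct_fixes is_struct_model by blast

lemma K_embedding_iff: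
  "K_embedding K f M N \<longleftrightarrow> M \<in> models K \<and> inj_on f (universe M) \<and> le K (img f M) N"
proof
  assume "K_embedding K f M N"
  then obtain M' where M': "struct_iso (voc K) f M M'" "le K M' N" unfolding K_embedding_def by blast
  note iso = struct_isoD[OF M'(1)]
  have "M' = img f M" by (rule struct_iso_eq_image[OF M'(1)])
  moreover have "struct_iso (voc K) (inv_into (universe M) f) M' M" by (rule struct_iso_inv_into[OF M'(1)])
  ultimately show "M \<in> models K \<and> inj_on f (universe M) \<and> le K (img f M) N"
    using M'(2) iso(3) iso_models leD(1)[OF M'(2)] by blast
next
  assume "M \<in> models K \<and> inj_on f (universe M) \<and> le K (img f M) N"
  then show "K_embedding K f M N" unfolding K_embedding_def using img_iso by blast
qed

lemma K_embeddingD: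
  assumes "K_embedding K f M N"
  shows "M \<in> models K" "N \<in> models K" "inj_on f (universe M)" "le K (img f M) N" "f ` universe M \<subseteq> universe N"
    "x \<in> universe M \<Longrightarrow> f x \<in> universe N"
  using assms leD[of "img f M" N] unfolding K_embedding_iff by auto

lemma K_embedding_comp:
  assumes f: "K_embedding K f M N" and g: "K_embedding K g N P"
  shows "K_embedding K (g \<circ> f) M P"
proof -
  note f = K_embeddingD[OF f] and g = K_embeddingD[OF g]
  have inj: "inj_on g (f ` universe M)" using inj_on_subset[OF g(3) f(5)] .
  have "le K (img g (img f M)) P" using le_trans[OF img_le[OF f(4) g(3)] g(4)] .
  then show ?thesis
    unfolding K_embedding_iff using f(1,3) inj img_comp[OF f(1,3) inj] by (simp add: comp_inj_on)
qed

lemma K_embedding_cong: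
  "K_embedding K f M N \<Longrightarrow> (\<And>x. x \<in> universe M \<Longrightarrow> f x = g x) \<Longrightarrow> K_embedding K g M N"
  unfolding K_embedding_iff using img_cong[of M f g] inj_on_cong[of "universe M" f g] by metis

lemma K_embedding_le: "le K M N \<Longrightarrow> fixes_pointwise f (universe M) \<Longrightarrow> K_embedding K f M N"
  unfolding K_embedding_iff using leD(1)[of M N] img_fixes[of M f]
  by (auto simp: fixes_pointwise_def inj_on_def)

lemma K_embedding_id: "le K M N \<Longrightarrow> K_embedding K id M N"
  by (rule K_embedding_le) (auto simp: fixes_pointwise_def)

lemma K_embedding_subset: "le K M0 M \<Longrightarrow> K_embedding K f M N \<Longrightarrow> K_embedding K f M0 N"
  using K_embedding_comp[OF K_embedding_id] by force

lemma K_embedding_top: "K_embedding K f M N \<Longrightarrow> le K N P \<Longrightarrow> K_embedding K f M P"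
  unfolding K_embedding_iff using le_trans by blast

lemma K_embedding_img: "M \<in> models K \<Longrightarrow> inj_on f (universe M) \<Longrightarrow> K_embedding K f M (img f M)"
  unfolding K_embedding_iff using le_refl img_models by blast

lemma K_embedding_into:
  assumes "K_embedding K f M P" "le K N P" "f ` universe M \<subseteq> universe N"
  shows "K_embedding K f M N"
  using assms le_common[of "img f M" P N] unfolding K_embedding_iff by simp

lemma K_embedding_inverse:
  assumes "K_embedding K f M N" "\<And>x. x \<in> universe M \<Longrightarrow> g (f x) = x"
  shows "K_embedding K g (img f M) M" "img g (img f M) = M"
proof -
  note f = K_embeddingD[OF assms(1)]
  have inj: "inj_on g (f ` universe M)" using assms(2) by (auto simp: inj_on_def)
  have "img g (img f M) = img (g \<circ> f) M" by (rule img_comp[OF f(1,3) inj])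
  also have "\<dots> = M" by (rule img_fixes[OF f(1)]) (use assms(2) in \<open>auto simp: fixes_pointwise_def\<close>)
  finally show eq: "img g (img f M) = M" .
  show "K_embedding K g (img f M) M"
    unfolding K_embedding_iff eq using f inj img_models le_refl by auto
qed

section \<open>Cardinal bounds and submodels of size \<kappa>\<close>

lemma LS_bound: "\<exists>\<theta> :: ('a + 'f + 'r + nat) rel. lst_at K \<theta> \<and> \<theta> \<le>o \<kappa>"
proof -
  let ?S = "{\<theta> :: ('a + 'f + 'r + nat) rel. lst_at K \<theta>}"
  have "?S \<noteq> {}" using aec by (auto simp: aec_def)
  moreover have "\<forall>\<theta>\<in>?S. Card_order \<theta>" by (auto simp: lst_at_def)
  ultimately have "\<exists>\<theta>\<in>?S. \<forall>\<theta>'\<in>?S. \<theta> \<le>o \<theta>'"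
    by (rule exists_minim_Card_order)
  then have "\<exists>\<theta> :: ('a + 'f + 'r + nat) rel. lst_at K \<theta> \<and> (\<forall>\<theta>' :: ('a + 'f + 'r + nat) rel. lst_at K \<theta>' \<longrightarrow> \<theta> \<le>o \<theta>')"
    by auto
  then have "lst_at K (LS K)"
    unfolding LS_def by (rule someI2_ex) blast
  then show ?thesis using superstable unfolding superstable_def by blast
qed

lemma infinite_Field: "infinite (Field \<kappa>)"
proof -
  obtain \<theta> :: "('a + 'f + 'r + nat) rel" where t: "lst_at K \<theta>" "\<theta> \<le>o \<kappa>" using LS_bound by blast
  have "natLeq \<le>o |fun_syms (voc K) <+> rel_syms (voc K)| +c natLeq"
    by (rule ordLeq_csum2[OF natLeq_Card_order])
  then have "natLeq \<le>o \<kappa>"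
    using t unfolding lst_at_def by (meson ordLeq_transitive)
  then show ?thesis
    using cinfinite_mono natLeq_cinfinite unfolding cinfinite_def by blast
qed

sublocale infinite_card \<kappa>
  by unfold_locales (rule Card_order infinite_Field)+

lemma card_Field: "|Field \<kappa>| =o \<kappa>"
  using card_of_Field_ordIso[OF Card_order] .

lemma card_le_Field: "|A| \<le>o \<kappa> \<longleftrightarrow> |A| \<le>o |Field \<kappa>|"
  using card_Field ordIso_symmetric ordLeq_ordIso_trans by blast

lemma card_UN_le:
  assumes "|I| \<le>o \<kappa>" "\<And>i. i \<in> I \<Longrightarrow> |A i| \<le>o \<kappa>"
  shows "|\<Union>i\<in>I. A i| \<le>o \<kappa>"
  using card_of_UNION_ordLeq_infinite[OF infinite_Field, of I A] assms unfolding card_le_Field by blast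

lemma card_Un_le: "|A| \<le>o \<kappa> \<Longrightarrow> |B| \<le>o \<kappa> \<Longrightarrow> |A \<union> B| \<le>o \<kappa>"
  using card_of_Un_ordLeq_infinite_Field[OF infinite_Field _ _ Card_order] by blast

lemma card_subset_le: "|B| \<le>o \<kappa> \<Longrightarrow> A \<subseteq> B \<Longrightarrow> |A| \<le>o \<kappa>"
  using card_of_mono1 ordLeq_transitive by blast

lemma card_image_le: "|B| \<le>o \<kappa> \<Longrightarrow> |f ` B| \<le>o \<kappa>"
  using card_of_image ordLeq_transitive by blast

lemma card_model: "M \<in> \<K> \<Longrightarrow> |universe M| \<le>o \<kappa>"
  using models_of_cardD(2) ordIso_imp_ordLeq by blast

lemma models_of_cardI:
  assumes "M \<in> models K" "|universe M| \<le>o \<kappa>" "N \<in> \<K>" "universe N \<subseteq> universe M"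
  shows "M \<in> \<K>"
proof -
  have "\<kappa> \<le>o |universe M|"
    using models_of_cardD(2)[OF assms(3)] card_of_mono1[OF assms(4)] ordIso_symmetric ordIso_ordLeq_trans by blast
  then show ?thesis using assms(1,2) ordIso_iff_ordLeq unfolding models_of_card_def by blast
qed

lemma lowenheim_skolem:
  assumes "N \<in> models K" "A \<subseteq> universe N" "|A| \<le>o \<kappa>" "M0 \<in> \<K>" "universe M0 \<subseteq> universe N"
  obtains M where "M \<in> \<K>" "le K M N" "A \<subseteq> universe M"
proof -
  obtain \<theta> :: "('a + 'f + 'r + nat) rel" where t: "lst_at K \<theta>" "\<theta> \<le>o \<kappa>" using LS_bound by blast
  have sub: "A \<union> universe M0 \<subseteq> universe N" using assms by blast
  then obtain M where M: "le K M N" "A \<union> universe M0 \<subseteq> universe M" "|universe M| \<le>o |A \<union> universe M0| +c \<theta>"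
    using t(1) assms(1) unfolding lst_at_def by meson
  have "|A \<union> universe M0| \<le>o \<kappa>" by (rule card_Un_le[OF assms(3) card_model[OF assms(4)]])
  then have "|A \<union> universe M0| +c \<theta> \<le>o \<kappa>"
    using csum_cinfinite_bound[OF _ t(2) card_of_Card_order] t(1) infinite_Field Card_order
    unfolding cinfinite_def lst_at_def by blast
  then have "|universe M| \<le>o \<kappa>" using M(3) ordLeq_transitive by blast
  then have "M \<in> \<K>" using models_of_cardI[OF leD(1)[OF M(1)] _ assms(4)] M(2) by blast
  then show ?thesis using that M by blast
qed

lemma ex_model: "\<exists>M. M \<in> \<K>"
  using superstable by (auto simp: superstable_def)

text \<open>Provides the room outside a model that renaming needs: a copy of a model filling the
  whole type would be maximal.\<close>

lemma UNIV_large: "\<not> |UNIV :: 'a set| \<le>o \<kappa>"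
proof
  assume le: "|UNIV :: 'a set| \<le>o \<kappa>"
  obtain M where M: "M \<in> \<K>" using ex_model by blast
  have "|universe M| \<le>o |UNIV :: 'a set|" by (rule card_of_mono1) simp
  moreover have "|UNIV :: 'a set| \<le>o |universe M|"
    using le models_of_cardD(2)[OF M] ordIso_symmetric ordLeq_ordIso_trans by blast
  ultimately have "|universe M| =o |UNIV :: 'a set|" using ordIso_iff_ordLeq by blast
  then obtain f where f: "bij_betw f (universe M) (UNIV :: 'a set)"
    using card_of_ordIso by blast
  then have "img f M \<in> \<K>" using img_models_of_card[OF M] by (simp add: bij_betw_def)
  then obtain N where N: "le K (img f M) N" "img f M \<noteq> N"
    using superstable unfolding superstable_def no_maximal_models_def by blast
  have "universe (img f M) = universe N"
    using f leD(4)[OF N(1)] by (auto simp: bij_betw_def)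
  then show False using substructure_eqI[OF leD(3)[OF N(1)]] N(2) by blast
qed

text \<open>The complement of the image of \<open>X\<close> is still not bounded by \<kappa>, so the
  remaining elements of \<open>Y\<close> can be sent into it. This replaces the choice of fresh
  elements in the class of all sets.\<close>

lemma inj_extend:
  assumes "inj_on f X" "|Y| \<le>o \<kappa>" "X \<subseteq> Y"
  obtains f' :: "'a \<Rightarrow> 'a" where "inj_on f' Y" "\<And>x. x \<in> X \<Longrightarrow> f' x = f x"
proof -
  let ?R = "UNIV - f ` X"
  have fX: "|f ` X| \<le>o \<kappa>" by (rule card_image_le[OF card_subset_le[OF assms(2,3)]])
  have "\<not> |?R| \<le>o \<kappa>"
  proof
    assume "|?R| \<le>o \<kappa>"
    from card_Un_le[OF this fX] show False using UNIV_large by simp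
  qed
  then have "\<kappa> \<le>o |?R|"
    using ordLeq_total[OF card_of_Well_order card_order_on_well_order_on[OF Card_order]] by blast
  then have "|Y| \<le>o |?R|" using assms(2) ordLeq_transitive by blast
  then obtain g where g: "inj_on g Y" "g ` Y \<subseteq> ?R" unfolding card_of_ordLeq[symmetric] by blast
  define f' where "f' x = (if x \<in> X then f x else g x)" for x
  have neq: "g y \<noteq> f x" if "y \<in> Y" "x \<in> X" for x y
    using g(2) that by blast
  have "inj_on f' Y"
  proof (rule inj_onI)
    fix x y assume xy: "x \<in> Y" "y \<in> Y" "f' x = f' y"
    show "x = y"
      using xy neq[of x y] neq[of y x] inj_onD[OF assms(1), of x y] inj_onD[OF g(1), of x y]
      unfolding f'_def by (metis (full_types))
  qed
  then show ?thesis using that[of f'] by (simp add: f'_def)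
qed

lemma extend_iso:
  assumes "M \<in> \<K>" "inj_on f (universe M)" "le K M N" "N \<in> \<K>"
  obtains f' where "inj_on f' (universe N)" "\<And>x. x \<in> universe M \<Longrightarrow> f' x = f x"
    "le K (img f M) (img f' N)" "img f' N \<in> \<K>"
proof -
  obtain f' where f': "inj_on f' (universe N)" "\<And>x. x \<in> universe M \<Longrightarrow> f' x = f x"
    by (rule inj_extend[OF assms(2) card_model[OF assms(4)] leD(4)[OF assms(3)]]) blast
  have eq: "img f M = img f' M"
    by (rule img_cong[OF models_of_cardD(1)[OF assms(1)] assms(2)]) (simp add: f'(2))
  show ?thesis
    by (rule that[OF f']) (use img_le[OF assms(3) f'(1)] img_models_of_card[OF assms(4) f'(1)] eq in simp_all)
qed

text \<open>Renaming the amalgam along the inverse of the second embedding turns \<open>M2\<close>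
  into an actual submodel, so that only one map remains.\<close>

lemma amalgamate:
  assumes "M0 \<in> \<K>" "M1 \<in> \<K>" "M2 \<in> \<K>" "le K M0 M1" "le K M0 M2"
  obtains N f where "N \<in> \<K>" "le K M2 N" "K_embedding K f M1 N" "fixes_pointwise f (universe M0)"
proof -
  obtain M3 f1 f2 where M3: "M3 \<in> \<K>" and f1: "K_embedding K f1 M1 M3" "fixes_pointwise f1 (universe M0)"
    and f2: "K_embedding K f2 M2 M3" "fixes_pointwise f2 (universe M0)"
    using superstable assms unfolding superstable_def amalgamation_def by meson
  note f2D = K_embeddingD[OF f2(1)]
  let ?g = "inv_into (universe M2) f2"
  have g: "?g (f2 x) = x" if "x \<in> universe M2" for x using f2D(3) that by simp
  note gD = K_embedding_inverse[OF f2(1) g]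
  obtain g' where g': "inj_on g' (universe M3)" "\<And>x. x \<in> universe (img f2 M2) \<Longrightarrow> g' x = ?g x"
    "le K (img ?g (img f2 M2)) (img g' M3)" "img g' M3 \<in> \<K>"
    using extend_iso[OF img_models_of_card[OF assms(3) f2D(3)] K_embeddingD(3)[OF gD(1)] f2D(4) M3] by blast
  show ?thesis
  proof (rule that[of "img g' M3" "g' \<circ> f1"])
    show "img g' M3 \<in> \<K>" by fact
    show "le K M2 (img g' M3)" using g'(3) gD(2) by simp
    show "K_embedding K (g' \<circ> f1) M1 (img g' M3)"
      by (rule K_embedding_comp[OF f1(1) K_embedding_img[OF models_of_cardD(1)[OF M3] g'(1)]])
    show "fixes_pointwise (g' \<circ> f1) (universe M0)"
      unfolding fixes_pointwise_def
    proof
      fix x assume x: "x \<in> universe M0"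
      then have "f1 x = x" "f2 x = x" "x \<in> universe M2"
        using f1(2) f2(2) leD(4)[OF assms(5)] by (auto simp: fixes_pointwise_def)
      then show "(g' \<circ> f1) x = x" using g'(2)[of x] g[of x] by (metis comp_apply imageI universe_image_struct)
    qed
  qed
qed

section \<open>Universal extensions\<close>

lemma universal_overD:
  assumes "universal_over K \<kappa> N M"
  shows "M \<in> \<K>" "N \<in> \<K>" "le K M N"
  using assms by (auto simp: universal_over_def)

text \<open>Amalgamating \<open>A\<close> with \<open>M\<close> over \<open>B\<close> reduces the
  claim to universality over \<open>M\<close>; the composite of the two maps fixes
  \<open>B\<close>.\<close>

lemma universal_over_embed:
  assumes "universal_over K \<kappa> N M" "B \<in> \<K>" "le K B M" "A \<in> \<K>" "le K B A"
  obtains f where "K_embedding K f A N" "fixes_pointwise f (universe B)"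
proof -
  note M = universal_overD[OF assms(1)]
  obtain P f where P: "P \<in> \<K>" "le K M P" "K_embedding K f A P" "fixes_pointwise f (universe B)"
    using amalgamate[OF assms(2,4) M(1) assms(5,3)] by blast
  obtain g where g: "K_embedding K g P N" "fixes_pointwise g (universe M)"
    using assms(1) P(1,2) unfolding universal_over_def by blast
  have "fixes_pointwise (g \<circ> f) (universe B)"
    using P(4) g(2) leD(4)[OF assms(3)] by (auto simp: fixes_pointwise_def)
  then show ?thesis using that K_embedding_comp[OF P(3) g(1)] by blast
qed

lemma universal_over_base:
  assumes "universal_over K \<kappa> N M" "B \<in> \<K>" "le K B M"
  shows "universal_over K \<kappa> N B"
  unfolding universal_over_def
  using universal_overD[OF assms(1)] assms(2,3) le_trans universal_over_embed[OF assms] by metis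

text \<open>The first step of a limit model is a universal extension, and by categoricity its base
  is isomorphic to \<open>M\<close>. The step is copied along this isomorphism, while a test
  extension of \<open>M\<close> is carried back along its inverse.\<close>

lemma ex_universal_over:
  assumes M: "M \<in> \<K>"
  obtains N where "universal_over K \<kappa> N M"
proof -
  obtain L \<delta> Q where d: "limit_ord \<kappa> \<delta>" "limit_over K \<kappa> \<delta> Q L"
    using ex_limit_model unfolding limit_model_def by blast
  have "ord_zero \<kappa> \<in> below \<kappa> \<delta>" using d(1) zero_below unfolding limit_ord_def by blast
  then obtain N0 M0 where u: "universal_over K \<kappa> N0 M0" using d(2) unfolding limit_over_def by blast
  note uD = universal_overD[OF u]
  obtain f where f: "struct_iso (voc K) f M0 M"
    using categorical uD(1) M unfolding categorical_def by blast
  note fD = struct_isoD[OF f] and fimg = struct_iso_eq_image[OF f]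
  obtain f' where f': "inj_on f' (universe N0)" "\<And>x. x \<in> universe M0 \<Longrightarrow> f' x = f x"
    "le K M (img f' N0)" "img f' N0 \<in> \<K>"
    using extend_iso[OF uD(1) fD(3) uD(3,2)] fimg by metis
  let ?g = "inv_into (universe M0) f"
  have g: "struct_iso (voc K) ?g M M0" by (rule struct_iso_inv_into[OF f])
  note gD = struct_isoD[OF g] and gimg = struct_iso_eq_image[OF g]
  have "\<exists>h. K_embedding K h M' (img f' N0) \<and> fixes_pointwise h (universe M)"
    if M': "M' \<in> \<K>" "le K M M'" for M'
  proof -
    obtain g' where g': "inj_on g' (universe M')" "\<And>x. x \<in> universe M \<Longrightarrow> g' x = ?g x"
      "le K M0 (img g' M')" "img g' M' \<in> \<K>"
      using extend_iso[OF M gD(3) M'(2,1)] gimg by metis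
    obtain h where h: "K_embedding K h (img g' M') N0" "fixes_pointwise h (universe M0)"
      using u g'(3,4) unfolding universal_over_def by blast
    have "K_embedding K (f' \<circ> (h \<circ> g')) M' (img f' N0)"
      by (rule K_embedding_comp[OF K_embedding_comp[OF K_embedding_img[OF models_of_cardD(1)[OF M'(1)] g'(1)] h(1)]
          K_embedding_img[OF models_of_cardD(1)[OF uD(2)] f'(1)]])
    moreover have "fixes_pointwise (f' \<circ> (h \<circ> g')) (universe M)"
      unfolding fixes_pointwise_def
    proof
      fix x assume x: "x \<in> universe M"
      then have "?g x \<in> universe M0" using gD(4) by blast
      then show "(f' \<circ> (h \<circ> g')) x = x"
        using g'(2)[OF x] h(2) f'(2) x fD(4) by (simp add: fixes_pointwise_def f_inv_into_f)
    qed
    ultimately show ?thesis by blast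
  qed
  then have "universal_over K \<kappa> (img f' N0) M"
    unfolding universal_over_def using M f' by blast
  then show ?thesis by (rule that)
qed

section \<open>Unions of chains\<close>

lemma union_of_chain:
  assumes "D \<noteq> {}" "D \<subseteq> models K" "\<And>M N. M \<in> D \<Longrightarrow> N \<in> D \<Longrightarrow> le K M N \<or> le K N M" "is_union (voc K) D U"
  shows "U \<in> models K" "M \<in> D \<Longrightarrow> le K M U" "N \<in> models K \<Longrightarrow> (\<And>M. M \<in> D \<Longrightarrow> le K M N) \<Longrightarrow> le K U N"
proof -
  have "directed_system K D"
    unfolding directed_system_def using assms(1-3) le_refl by (metis subsetD)
  then show "U \<in> models K" "M \<in> D \<Longrightarrow> le K M U"
    "N \<in> models K \<Longrightarrow> (\<And>M. M \<in> D \<Longrightarrow> le K M N) \<Longrightarrow> le K U N"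
    using tarski_vaught assms(4) unfolding tarski_vaught_def by blast+
qed

lemma ex_union_of_chain:
  assumes "D \<noteq> {}" "D \<subseteq> models K" "\<And>M N. M \<in> D \<Longrightarrow> N \<in> D \<Longrightarrow> le K M N \<or> le K N M"
  obtains U where "is_union (voc K) D U"
  using ex_union_struct[OF assms(1), of "voc K"] assms(3) leD(3) by blast

lemma is_unionD: "is_union \<tau> D U \<Longrightarrow> universe U = (\<Union>M\<in>D. universe M)"
  by (simp add: is_union_def)

lemma union_models_of_card:
  assumes "i \<in> I" "|I| \<le>o \<kappa>" "\<And>i. i \<in> I \<Longrightarrow> M i \<in> \<K>"
    and "\<And>i j. i \<in> I \<Longrightarrow> j \<in> I \<Longrightarrow> le K (M i) (M j) \<or> le K (M j) (M i)"
  obtains U where "U \<in> \<K>" "is_union (voc K) (M ` I) U" "\<And>i. i \<in> I \<Longrightarrow> le K (M i) U"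
    "\<And>N. N \<in> models K \<Longrightarrow> (\<And>i. i \<in> I \<Longrightarrow> le K (M i) N) \<Longrightarrow> le K U N"
proof -
  have ne: "M ` I \<noteq> {}" using assms(1) by blast
  have models: "M ` I \<subseteq> models K" using assms(3) models_of_cardD(1) by blast
  have chain: "le K P Q \<or> le K Q P" if PQ: "P \<in> M ` I" "Q \<in> M ` I" for P Q
    using PQ assms(4) by blast
  obtain U where U: "is_union (voc K) (M ` I) U" by (rule ex_union_of_chain[OF ne models chain])
  note UD = union_of_chain[OF ne models chain U]
  have "|universe U| \<le>o \<kappa>"
    using card_UN_le[OF assms(2) card_model[OF assms(3)]] unfolding is_unionD[OF U] by simp
  then have "U \<in> \<K>"
    using models_of_cardI[OF UD(1) _ assms(3)[OF assms(1)]] leD(4)[OF UD(2)] assms(1) by blast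
  then show ?thesis using that U UD(2,3) by blast
qed

lemma K_embedding_union:
  assumes "D \<noteq> {}" "\<And>M N. M \<in> D \<Longrightarrow> N \<in> D \<Longrightarrow> le K M N \<or> le K N M" "is_union (voc K) D P"
    and f: "\<And>M. M \<in> D \<Longrightarrow> K_embedding K f M C"
  shows "K_embedding K f P C"
proof -
  have D: "D \<subseteq> models K" using f K_embeddingD(1) by blast
  note P = union_of_chain[OF assms(1) D assms(2,3)] and PU = is_unionD[OF assms(3)]
  have inj: "inj_on f (universe P)"
  proof (rule inj_onI)
    fix x y assume xy: "x \<in> universe P" "y \<in> universe P" "f x = f y"
    then obtain M N where "M \<in> D" "x \<in> universe M" "N \<in> D" "y \<in> universe N" unfolding PU by blast
    then obtain L where "L \<in> D" "x \<in> universe L" "y \<in> universe L" using assms(2)[of M N] leD(4) by blast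
    then show "x = y" using K_embeddingD(3)[OF f] xy(3) by (meson inj_onD)
  qed
  have iso: "struct_iso (voc K) f P (img f P)" by (rule img_iso[OF P(1) inj])
  have un: "is_union (voc K) (img f ` D) (img f P)"
    unfolding is_union_def using struct_isoD(2)[OF iso] struct_iso_substructure(2)[OF iso leD(3)[OF P(2)]] PU by auto
  have "le K (img f P) C"
  proof (rule union_of_chain(3)[OF _ _ _ un])
    show "img f ` D \<noteq> {}" using assms(1) by simp
    show "img f ` D \<subseteq> models K" using f K_embeddingD(4) leD(1) by blast
    show "le K M N \<or> le K N M" if MN: "M \<in> img f ` D" "N \<in> img f ` D" for M N
    proof -
      obtain M' N' where "M' \<in> D" "M = img f M'" "N' \<in> D" "N = img f N'" using MN by blast
      then show ?thesis
        using assms(2)[of M' N'] img_le[of M' N' f] img_le[of N' M' f] f K_embeddingD(3) by blast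
    qed
    show "C \<in> models K" using assms(1) f K_embeddingD(2) by blast
    show "le K M C" if "M \<in> img f ` D" for M using that f K_embeddingD(4) by blast
  qed
  then show ?thesis unfolding K_embedding_iff using P(1) inj by blast
qed

text \<open>Each stage after the first is universal over the union of all earlier ones, hence over
  each of them; continuity is not sought. The length is the successor of \<kappa>, so that every
  subset of \<open>C\<close> of size at most \<kappa> is contained in some stage.\<close>

lemma ex_universal_chain:
  assumes "M0 \<in> \<K>"
  obtains C Ms where "C \<in> models K" "is_union (voc K) (Ms ` ords \<kappa>) C"
    "\<And>i. i \<in> ords \<kappa> \<Longrightarrow> Ms i \<in> \<K> \<and> le K M0 (Ms i) \<and> le K (Ms i) C"
    "\<And>i k. i \<in> ords \<kappa> \<Longrightarrow> k \<in> below \<kappa> i \<Longrightarrow> universal_over K \<kappa> (Ms i) (Ms k)"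
proof -
  have "\<exists>Ms. \<forall>i. (Ms i \<in> \<K> \<and> le K M0 (Ms i)) \<and> (\<forall>k\<in>below \<kappa> i. universal_over K \<kappa> (Ms i) (Ms k))"
  proof (rule ord_recursion_pairs[where A = "\<lambda>i M. M \<in> \<K> \<and> le K M0 M" and B = "\<lambda>k N i M. universal_over K \<kappa> M N"])
    fix i f assume IH: "\<And>j. j \<in> below \<kappa> i \<Longrightarrow> (f j \<in> \<K> \<and> le K M0 (f j)) \<and> (\<forall>k\<in>below \<kappa> j. universal_over K \<kappa> (f j) (f k))"
    show "\<exists>M. (M \<in> \<K> \<and> le K M0 M) \<and> (\<forall>k\<in>below \<kappa> i. universal_over K \<kappa> M (f k))"
    proof (cases "below \<kappa> i = {}")
      case True
      then show ?thesis using assms le_refl models_of_cardD(1) by blast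
    next
      case False
      then obtain k0 where k0: "k0 \<in> below \<kappa> i" by blast
      have chain: "le K (f j) (f k) \<or> le K (f k) (f j)" if "j \<in> below \<kappa> i" "k \<in> below \<kappa> i" for j k
        using ord_total[OF below_ords(1)[OF that(1)] below_ords(1)[OF that(2)]] IH that
          universal_overD(3) le_refl models_of_cardD(1) by metis
      have fK: "f j \<in> \<K>" if "j \<in> below \<kappa> i" for j using IH[OF that] by blast
      obtain U where U: "U \<in> \<K>" "\<And>j. j \<in> below \<kappa> i \<Longrightarrow> le K (f j) U"
        by (rule union_models_of_card[OF k0 card_below fK chain]) blast+
      obtain N where N: "universal_over K \<kappa> N U" by (rule ex_universal_over[OF U(1)])
      have "le K M0 N"
        using IH[OF k0] U(2)[OF k0] universal_overD(3)[OF N] le_trans by blast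
      then show ?thesis
        using universal_over_base[OF N fK U(2)] universal_overD(2)[OF N] by blast
    qed
  qed
  then obtain Ms where Ms: "\<And>i. Ms i \<in> \<K> \<and> le K M0 (Ms i)"
    "\<And>i k. k \<in> below \<kappa> i \<Longrightarrow> universal_over K \<kappa> (Ms i) (Ms k)" by blast
  have ne: "Ms ` ords \<kappa> \<noteq> {}" using ord_zero_ords by blast
  have models: "Ms ` ords \<kappa> \<subseteq> models K" using Ms models_of_cardD(1) by blast
  have chain: "le K P Q \<or> le K Q P" if PQ: "P \<in> Ms ` ords \<kappa>" "Q \<in> Ms ` ords \<kappa>" for P Q
  proof -
    obtain i j where ij: "i \<in> ords \<kappa>" "P = Ms i" "j \<in> ords \<kappa>" "Q = Ms j" using PQ by blast
    show ?thesis
      using ord_total[OF ij(1,3)] Ms universal_overD(3) le_refl models_of_cardD(1) ij(2,4) by metis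
  qed
  obtain C where C: "is_union (voc K) (Ms ` ords \<kappa>) C" by (rule ex_union_of_chain[OF ne models chain])
  note CD = union_of_chain[OF ne models chain C]
  show ?thesis
  proof (rule that[OF CD(1) C])
    show "Ms i \<in> \<K> \<and> le K M0 (Ms i) \<and> le K (Ms i) C" if "i \<in> ords \<kappa>" for i
      using Ms(1)[of i] CD(2)[of "Ms i"] that by blast
    show "universal_over K \<kappa> (Ms i) (Ms k)" if "k \<in> below \<kappa> i" for i k
      using Ms(2)[OF that] .
  qed
qed

end

section \<open>A homogeneous model of size \<open>\<kappa>\<^sup>+\<close>\<close>

locale monster = categorical_superstable K \<kappa>
  for K :: "('a, 'f, 'r) class_data" and \<kappa> :: "'c rel" +
  fixes C :: "('a, 'f, 'r) struct" and Ms :: "'c set \<Rightarrow> ('a, 'f, 'r) struct"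
  assumes C_union: "is_union (voc K) (Ms ` ords \<kappa>) C"
    and Ms: "i \<in> ords \<kappa> \<Longrightarrow> Ms i \<in> \<K> \<and> le K (Ms i) C"
    and Ms_universal: "i \<in> ords \<kappa> \<Longrightarrow> k \<in> below \<kappa> i \<Longrightarrow> universal_over K \<kappa> (Ms i) (Ms k)"
begin

section \<open>Covering and extending inside the homogeneous model\<close>

lemma C_model: "C \<in> models K"
  using Ms[OF ord_zero_ords] leD(2) by blast

lemma universe_C: "universe C = (\<Union>i\<in>ords \<kappa>. universe (Ms i))"
  using is_unionD[OF C_union] by simp

lemma Ms_mono: "ord_le \<kappa> i j \<Longrightarrow> le K (Ms i) (Ms j)"
  using below_or_eq[of i j] Ms_universal[of j i] universal_overD(3) Ms[of i] le_refl models_of_cardD(1)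
    ord_le_ords[of i j] by metis

text \<open>Regularity of the successor of \<kappa>: in an increasing chain of that length, at most
  \<kappa> elements of the union are already found in one member.\<close>

lemma small_subset:
  assumes "A \<subseteq> universe C" "|A| \<le>o \<kappa>"
  obtains i where "i \<in> ords \<kappa>" "A \<subseteq> universe (Ms i)"
proof -
  have "relChain (cardSuc \<kappa>) (\<lambda>i. universe (Ms i))"
    unfolding relChain_def using Ms_mono leD(4) by (auto simp: ord_le_def)
  then have "\<exists>i\<in>Field (cardSuc \<kappa>). A \<subseteq> universe (Ms i)"
    using cardSuc_UNION[OF Card_order infinite_Field, of "\<lambda>i. universe (Ms i)" A] assms
    unfolding universe_C ords_def by blast
  then show ?thesis using that by (auto simp: ords_def)
qed

lemma cover:
  assumes "A \<subseteq> universe C" "|A| \<le>o \<kappa>"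
  obtains M where "M \<in> \<K>" "le K M C" "A \<subseteq> universe M"
  using small_subset[OF assms] Ms by metis

lemma embed_over:
  assumes "A \<in> \<K>" "le K A C" "B \<in> \<K>" "le K A B"
  obtains f where "K_embedding K f B C" "fixes_pointwise f (universe A)"
proof -
  obtain i where i: "i \<in> ords \<kappa>" "universe A \<subseteq> universe (Ms i)"
    using small_subset[OF leD(4)[OF assms(2)] card_model[OF assms(1)]] by blast
  have A: "le K A (Ms i)" using le_common[OF assms(2)] Ms i by blast
  let ?j = "ord_suc \<kappa> i"
  have j: "?j \<in> ords \<kappa>" "i \<in> below \<kappa> ?j" using ord_suc_ords below_ord_suc i(1) by auto
  obtain f where "K_embedding K f B (Ms ?j)" "fixes_pointwise f (universe A)"
    using universal_over_embed[OF Ms_universal[OF j] assms(1) A assms(3,4)] by blast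
  then show ?thesis using that K_embedding_top Ms[OF j(1)] by blast
qed

lemma embed_extend:
  assumes "A \<in> \<K>" "le K A B" "B \<in> \<K>" "K_embedding K h A C"
  obtains h' where "K_embedding K h' B C" "\<And>x. x \<in> universe A \<Longrightarrow> h' x = h x"
proof -
  note h = K_embeddingD[OF assms(4)]
  obtain g where g: "inj_on g (universe B)" "\<And>x. x \<in> universe A \<Longrightarrow> g x = h x"
    "le K (img h A) (img g B)" "img g B \<in> \<K>"
    using extend_iso[OF assms(1) h(3) assms(2,3)] by blast
  obtain k where k: "K_embedding K k (img g B) C" "fixes_pointwise k (universe (img h A))"
    using embed_over[OF img_models_of_card[OF assms(1) h(3)] h(4) g(4,3)] by blast
  show ?thesis
  proof (rule that[of "k \<circ> g"])
    show "K_embedding K (k \<circ> g) B C"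
      by (rule K_embedding_comp[OF K_embedding_img[OF models_of_cardD(1)[OF assms(3)] g(1)] k(1)])
    show "(k \<circ> g) x = h x" if "x \<in> universe A" for x
      using g(2)[OF that] k(2) that by (simp add: fixes_pointwise_def)
  qed
qed

text \<open>Extending by the identity off \<open>C\<close> makes each automorphism a bijection of
  the whole type, so that composition and \<open>inv\<close> on the type give the group
  operations.\<close>

definition aut :: "('a \<Rightarrow> 'a) set" where
  "aut = {\<sigma>. bij \<sigma> \<and> struct_iso (voc K) \<sigma> C C \<and> (\<forall>x. x \<notin> universe C \<longrightarrow> \<sigma> x = x)}"

definition small :: "'a set set" where
  "small = universe ` {M \<in> \<K>. le K M C}"

lemma smallI: "M \<in> \<K> \<Longrightarrow> le K M C \<Longrightarrow> universe M \<in> small"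
  by (auto simp: small_def)

lemma smallE:
  assumes "X \<in> small"
  obtains M where "M \<in> \<K>" "le K M C" "X = universe M"
  using assms by (auto simp: small_def)

lemma small_subset_C: "X \<in> small \<Longrightarrow> X \<subseteq> universe C"
  using leD(4) by (auto elim!: smallE)

lemma card_small: "X \<in> small \<Longrightarrow> |X| \<le>o \<kappa>"
  using card_model by (auto elim!: smallE)

lemma aut_iso: "\<sigma> \<in> aut \<Longrightarrow> struct_iso (voc K) \<sigma> C C"
  by (simp add: aut_def)

lemma aut_off: "\<sigma> \<in> aut \<Longrightarrow> x \<notin> universe C \<Longrightarrow> \<sigma> x = x"
  by (simp add: aut_def)

lemma ex_aut:
  assumes "struct_iso (voc K) f C C"
  obtains \<sigma> where "\<sigma> \<in> aut" "\<And>x. x \<in> universe C \<Longrightarrow> \<sigma> x = f x"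
proof -
  define \<sigma> where "\<sigma> x = (if x \<in> universe C then f x else x)" for x
  have "bij_betw f (universe C) (universe C)" using assms by (simp add: struct_iso_def)
  then have "bij_betw \<sigma> (universe C) (universe C)"
    using bij_betw_cong[of "universe C" f \<sigma>] by (simp add: \<sigma>_def)
  moreover have "bij_betw \<sigma> (- universe C) (- universe C)"
    by (auto simp: bij_betw_def inj_on_def \<sigma>_def)
  ultimately have "bij_betw \<sigma> (universe C \<union> - universe C) (universe C \<union> - universe C)"
    by (rule bij_betw_combine) blast
  then have "bij \<sigma>" by (simp add: Un_commute)
  moreover have "struct_iso (voc K) \<sigma> C C"
    by (rule struct_iso_cong[OF assms]) (simp add: \<sigma>_def)
  ultimately show ?thesis using that[of \<sigma>] by (auto simp: aut_def \<sigma>_def)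
qed

lemma aut_id: "id \<in> aut"
  using struct_iso_id is_struct_model C_model by (auto simp: aut_def)

lemma aut_comp: "\<sigma> \<in> aut \<Longrightarrow> \<rho> \<in> aut \<Longrightarrow> \<sigma> \<circ> \<rho> \<in> aut"
  unfolding aut_def using struct_iso_comp by (auto intro: bij_comp)

lemma aut_inv:
  assumes "\<sigma> \<in> aut"
  shows "inv \<sigma> \<in> aut"
proof -
  have b: "bij \<sigma>" using assms by (simp add: aut_def)
  note iso = aut_iso[OF assms]
  have "inv_into (universe C) \<sigma> x = inv \<sigma> x" if "x \<in> universe C" for x
  proof (rule inv_into_f_eq[OF struct_isoD(3)[OF iso]])
    show eq: "\<sigma> (inv \<sigma> x) = x" using b by (simp add: bij_is_surj surj_f_inv_f)
    show "inv \<sigma> x \<in> universe C" using aut_off[OF assms, of "inv \<sigma> x"] eq that by metis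
  qed
  then have "struct_iso (voc K) (inv \<sigma>) C C"
    using struct_iso_cong[OF struct_iso_inv_into[OF iso]] by blast
  moreover have "inv \<sigma> x = x" if "x \<notin> universe C" for x
    using aut_off[OF assms that] b by (metis bij_inv_eq_iff)
  ultimately show ?thesis using b by (simp add: aut_def bij_imp_bij_inv)
qed

lemma aut_embedding:
  assumes "\<sigma> \<in> aut" "le K M C"
  shows "K_embedding K \<sigma> M C"
proof -
  have "K_embedding K \<sigma> C C"
    unfolding K_embedding_def using aut_iso[OF assms(1)] le_refl[OF C_model] by blast
  then show ?thesis by (rule K_embedding_subset[OF assms(2)])
qed

lemma embedding_small:
  assumes "K_embedding K f M C" "M \<in> \<K>"
  shows "f ` universe M \<in> small" "img f M \<in> \<K>" "le K (img f M) C"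
proof -
  note f = K_embeddingD[OF assms(1)]
  show "img f M \<in> \<K>" "le K (img f M) C" using img_models_of_card[OF assms(2) f(3)] f(4) by auto
  then show "f ` universe M \<in> small" using smallI by fastforce
qed

lemma aut_small: "\<sigma> \<in> aut \<Longrightarrow> X \<in> small \<Longrightarrow> \<sigma> ` X \<in> small"
  using embedding_small(1)[OF aut_embedding] by (auto elim!: smallE)

lemma extend_to_aut:
  assumes "M \<in> \<K>" "le K M C" "K_embedding K f M C"
  obtains \<sigma> where "\<sigma> \<in> aut" "\<And>x. x \<in> universe M \<Longrightarrow> \<sigma> x = f x"
proof -
  txt \<open>Back and forth along \<open>\<kappa>\<^sup>+\<close>: at stage \<open>i\<close> both domain and range absorb \<open>Ms i\<close>.\<close>
  define A where "A i = (\<lambda>(P, g). P \<in> \<K> \<and> le K P C \<and> K_embedding K g P C \<and> universe M \<subseteq> universe P \<and>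
    (\<forall>x\<in>universe M. g x = f x) \<and>
    (i \<in> ords \<kappa> \<longrightarrow> universe (Ms i) \<subseteq> universe P \<and> universe (Ms i) \<subseteq> g ` universe P))" for i
  define B where "B k = (\<lambda>(P :: ('a, 'f, 'r) struct, g :: 'a \<Rightarrow> 'a) (i :: 'c set) (P' :: ('a, 'f, 'r) struct, g' :: 'a \<Rightarrow> 'a).
    universe P \<subseteq> universe P' \<and> (\<forall>x\<in>universe P. g' x = g x))" for k :: "'c set"
  have glue: thesis0 if I: "I \<noteq> {}" "I \<subseteq> ords \<kappa>"
    and PA: "\<And>i. i \<in> I \<Longrightarrow> A i (P i, g i)"
    and PB: "\<And>i k. i \<in> I \<Longrightarrow> k \<in> I \<Longrightarrow> k \<in> below \<kappa> i \<Longrightarrow> universe (P k) \<subseteq> universe (P i) \<and> (\<forall>x\<in>universe (P k). g i x = g k x)"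
    and conc: "\<And>h. (\<And>i x. i \<in> I \<Longrightarrow> x \<in> universe (P i) \<Longrightarrow> h x = g i x) \<Longrightarrow>
      (\<And>U. is_union (voc K) (P ` I) U \<Longrightarrow> K_embedding K h U C) \<Longrightarrow>
      (\<And>i j. i \<in> I \<Longrightarrow> j \<in> I \<Longrightarrow> le K (P i) (P j) \<or> le K (P j) (P i)) \<Longrightarrow> thesis0"
    for I P g thesis0
  proof -
    obtain h where h: "\<And>i x. i \<in> I \<Longrightarrow> x \<in> universe (P i) \<Longrightarrow> h x = g i x"
      by (rule glue_functions[OF I(2), of "\<lambda>i. universe (P i)" g]) (use PB in blast)+
    have PC: "le K (P i) C" "P i \<in> \<K>" "K_embedding K (g i) (P i) C" if "i \<in> I" for i
      using PA[OF that] by (auto simp: A_def)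
    have chain: "le K (P i) (P j) \<or> le K (P j) (P i)" if "i \<in> I" "j \<in> I" for i j
      using ord_total[of i j] PB[of i j] PB[of j i] that I(2) le_common PC(1)
      by (metis order_refl subsetD)
    have "K_embedding K h U C" if U: "is_union (voc K) (P ` I) U" for U
    proof (rule K_embedding_union[OF _ _ U])
      show "P ` I \<noteq> {}" using I by blast
      show "le K M N \<or> le K N M" if "M \<in> P ` I" "N \<in> P ` I" for M N
        using that chain by blast
      show "K_embedding K h M C" if M: "M \<in> P ` I" for M
      proof -
        obtain i where i: "i \<in> I" "M = P i" using M by blast
        show ?thesis unfolding i(2) by (rule K_embedding_cong[OF PC(3)[OF i(1)]]) (simp add: h[OF i(1)])
      qed
    qed
    then show ?thesis using conc[of h] h chain by blast
  qed
  have "\<exists>F. \<forall>i. A i (F i) \<and> (\<forall>k\<in>below \<kappa> i. B k (F k) i (F i))"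
  proof (rule ord_recursion_pairs)
    fix i F assume IH: "\<And>j. j \<in> below \<kappa> i \<Longrightarrow> A j (F j) \<and> (\<forall>k\<in>below \<kappa> j. B k (F k) j (F j))"
    define P where "P j = fst (F j)" for j
    define g where "g j = snd (F j)" for j
    have F: "F j = (P j, g j)" for j by (simp add: P_def g_def)
    have IA: "P j \<in> \<K>" "le K (P j) C" "universe M \<subseteq> universe (P j)" "\<And>x. x \<in> universe M \<Longrightarrow> g j x = f x"
      if "j \<in> below \<kappa> i" for j
      using conjunct1[OF IH[OF that]] by (auto simp: A_def F)
    obtain P0 h0 where P0: "P0 \<in> \<K>" "le K P0 C" "K_embedding K h0 P0 C" "universe M \<subseteq> universe P0"
      and h0: "\<And>x. x \<in> universe M \<Longrightarrow> h0 x = f x"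
        "\<And>k. k \<in> below \<kappa> i \<Longrightarrow> universe (P k) \<subseteq> universe P0"
        "\<And>k x. k \<in> below \<kappa> i \<Longrightarrow> x \<in> universe (P k) \<Longrightarrow> h0 x = g k x"
    proof (cases "below \<kappa> i = {}")
      case True
      show ?thesis by (rule that[of M f]) (use assms True in auto)
    next
      case False
      then obtain k0 where k0: "k0 \<in> below \<kappa> i" by blast
      show ?thesis
      proof (rule glue[of "below \<kappa> i" P g])
        show "below \<kappa> i \<noteq> {}" by fact
        show "below \<kappa> i \<subseteq> ords \<kappa>" using below_ords by blast
        show "A j (P j, g j)" if "j \<in> below \<kappa> i" for j using IH[OF that] F by simp
        show "universe (P k) \<subseteq> universe (P j) \<and> (\<forall>x\<in>universe (P k). g j x = g k x)"
          if "j \<in> below \<kappa> i" "k \<in> below \<kappa> i" "k \<in> below \<kappa> j" for j k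
          using conjunct2[OF IH[OF that(1)]] that(3) by (auto simp: B_def F)
        fix h assume h: "\<And>j x. j \<in> below \<kappa> i \<Longrightarrow> x \<in> universe (P j) \<Longrightarrow> h x = g j x"
          "\<And>U. is_union (voc K) (P ` below \<kappa> i) U \<Longrightarrow> K_embedding K h U C"
          "\<And>j k. j \<in> below \<kappa> i \<Longrightarrow> k \<in> below \<kappa> i \<Longrightarrow> le K (P j) (P k) \<or> le K (P k) (P j)"
        obtain U where U: "U \<in> \<K>" "is_union (voc K) (P ` below \<kappa> i) U"
          "\<And>j. j \<in> below \<kappa> i \<Longrightarrow> le K (P j) U"
          "\<And>N. N \<in> models K \<Longrightarrow> (\<And>j. j \<in> below \<kappa> i \<Longrightarrow> le K (P j) N) \<Longrightarrow> le K U N"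
          by (rule union_models_of_card[OF k0 card_below IA(1) h(3)]) blast+
        show ?thesis
        proof (rule that[of U h])
          show "U \<in> \<K>" by fact
          show "le K U C" by (rule U(4)[OF C_model IA(2)])
          show "K_embedding K h U C" by (rule h(2)[OF U(2)])
          show "universe M \<subseteq> universe U" using IA(3)[OF k0] leD(4)[OF U(3)[OF k0]] by blast
          show "h x = f x" if "x \<in> universe M" for x
            using h(1)[OF k0] IA(3,4)[OF k0] that by auto
          show "universe (P k) \<subseteq> universe U" if "k \<in> below \<kappa> i" for k
            using leD(4)[OF U(3)[OF that]] .
          show "h x = g k x" if "k \<in> below \<kappa> i" "x \<in> universe (P k)" for k x
            using h(1)[OF that] .
        qed
      qed
    qed
    \<comment> \<open>The recursion runs over the whole type \<open>'c set\<close>; an index that is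
      not in \<open>ords \<kappa>\<close> absorbs nothing.\<close>
    define T where "T = (if i \<in> ords \<kappa> then universe (Ms i) else {})"
    have T: "T \<subseteq> universe C" "|T| \<le>o \<kappa>"
      using Ms[of i] leD(4)[of "Ms i" C] card_model[of "Ms i"] card_subset_le[OF card_model[OF P0(1)], of "{}"]
      by (auto simp: T_def)
    obtain P1 where P1: "P1 \<in> \<K>" "le K P1 C" "universe P0 \<union> T \<subseteq> universe P1"
      using cover[of "universe P0 \<union> T"] T leD(4)[OF P0(2)] card_Un_le[OF card_model[OF P0(1)] T(2)] by blast
    have P01: "le K P0 P1" using le_common[OF P0(2) P1(2)] P1(3) by blast
    obtain h1 where h1: "K_embedding K h1 P1 C" "\<And>x. x \<in> universe P0 \<Longrightarrow> h1 x = h0 x"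
      using embed_extend[OF P0(1) P01 P1(1) P0(3)] by blast
    note h1D = K_embeddingD[OF h1(1)]
    obtain S where S: "S \<in> \<K>" "le K S C" "h1 ` universe P1 \<union> T \<subseteq> universe S"
      using cover[of "h1 ` universe P1 \<union> T"] T h1D(5)
        card_Un_le[OF card_image_le[OF card_model[OF P1(1)]] T(2)] by blast
    \<comment> \<open>\<open>h1\<close> was the step forth. For the step back, its inverse is
      extended to \<open>S\<close>, and the inverse \<open>?g\<close> of that extension is the new
      map: its domain contains \<open>P1\<close> and its range is \<open>S\<close>, and both contain
      \<open>T\<close>.\<close>
    let ?k = "inv_into (universe P1) h1"
    have k: "?k (h1 x) = x" if "x \<in> universe P1" for x using h1D(3) that by simp
    have kE: "K_embedding K ?k (img h1 P1) C"
      using K_embedding_top[OF K_embedding_inverse(1)[OF h1(1) k] P1(2)] .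
    have imgS: "le K (img h1 P1) S" using le_common[OF h1D(4) S(2)] S(3) by simp
    obtain k' where k': "K_embedding K k' S C" "\<And>x. x \<in> universe (img h1 P1) \<Longrightarrow> k' x = ?k x"
      using embed_extend[OF embedding_small(2)[OF h1(1) P1(1)] imgS S(1) kE] by blast
    note k'D = K_embeddingD[OF k'(1)]
    let ?g = "inv_into (universe S) k'"
    have g: "?g (k' x) = x" if "x \<in> universe S" for x using k'D(3) that by simp
    note gE = K_embedding_inverse[OF k'(1) g]
    have k'h1: "k' (h1 x) = x" if "x \<in> universe P1" for x
      using k'(2)[of "h1 x"] k[OF that] that by simp
    have P12: "universe P1 \<subseteq> k' ` universe S"
    proof
      fix x assume x: "x \<in> universe P1"
      then have "h1 x \<in> universe S" using S(3) by blast
      then show "x \<in> k' ` universe S" using k'h1[OF x] by (metis imageI)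
    qed
    have gh1: "?g x = h1 x" if "x \<in> universe P1" for x
      using g[of "h1 x"] k'h1[OF that] S(3) that by auto
    have gim: "?g ` k' ` universe S = universe S" using g by force
    have gh0: "?g x = h0 x" if "x \<in> universe P0" for x
      using gh1[of x] h1(2)[OF that] P1(3) that by auto
    have P02: "universe P0 \<subseteq> k' ` universe S" using P12 P1(3) by blast
    have "A i (img k' S, ?g)"
      unfolding A_def split
    proof (intro conjI ballI impI)
      show "img k' S \<in> \<K>" "le K (img k' S) C" using embedding_small[OF k'(1) S(1)] by auto
      show "K_embedding K ?g (img k' S) C" using K_embedding_top[OF gE(1) S(2)] .
      show "universe M \<subseteq> universe (img k' S)" using P0(4) P02 by simp
      show "?g x = f x" if "x \<in> universe M" for x using gh0[of x] h0(1)[OF that] P0(4) that by auto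
      assume "i \<in> ords \<kappa>"
      then have "T = universe (Ms i)" by (simp add: T_def)
      then show "universe (Ms i) \<subseteq> universe (img k' S)" "universe (Ms i) \<subseteq> ?g ` universe (img k' S)"
        using P1(3) P12 S(3) gim by auto
    qed
    moreover have "B k (F k) i (img k' S, ?g)" if kb: "k \<in> below \<kappa> i" for k
      unfolding B_def F split
    proof (intro conjI ballI)
      show "universe (P k) \<subseteq> universe (img k' S)" using h0(2)[OF kb] P02 by simp
      show "?g x = g k x" if "x \<in> universe (P k)" for x
        using gh0[of x] h0(2)[OF kb] h0(3)[OF kb that] that by auto
    qed
    ultimately show "\<exists>y. A i y \<and> (\<forall>k\<in>below \<kappa> i. B k (F k) i y)" by blast
  qed
  then obtain F where F0: "\<And>i. A i (F i)" "\<And>i k. k \<in> below \<kappa> i \<Longrightarrow> B k (F k) i (F i)" by blast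
  define P where "P j = fst (F j)" for j
  define g where "g j = snd (F j)" for j
  have F: "F j = (P j, g j)" for j by (simp add: P_def g_def)
  have FA: "P i \<in> \<K>" "le K (P i) C" "universe M \<subseteq> universe (P i)" "\<And>x. x \<in> universe M \<Longrightarrow> g i x = f x"
    "i \<in> ords \<kappa> \<Longrightarrow> universe (Ms i) \<subseteq> universe (P i)" "i \<in> ords \<kappa> \<Longrightarrow> universe (Ms i) \<subseteq> g i ` universe (P i)"
    for i
    using F0(1)[of i] by (auto simp: A_def F)
  have ne: "ords \<kappa> \<noteq> {}" using ord_zero_ords by blast
  show ?thesis
  proof (rule glue[of "ords \<kappa>" P g])
    show "A i (P i, g i)" for i using F0(1)[of i] F by simp
    show "universe (P k) \<subseteq> universe (P i) \<and> (\<forall>x\<in>universe (P k). g i x = g k x)"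
      if "k \<in> below \<kappa> i" for i k
      using F0(2)[OF that] by (auto simp: B_def F)
    fix h assume h: "\<And>i x. i \<in> ords \<kappa> \<Longrightarrow> x \<in> universe (P i) \<Longrightarrow> h x = g i x"
      "\<And>U. is_union (voc K) (P ` ords \<kappa>) U \<Longrightarrow> K_embedding K h U C"
    have "universe C = (\<Union>i\<in>ords \<kappa>. universe (P i))"
      using FA(5) leD(4)[OF FA(2)] unfolding universe_C by blast
    then have "is_union (voc K) (P ` ords \<kappa>) C"
      unfolding is_union_def using is_struct_model[OF C_model] leD(3)[OF FA(2)] by auto
    note hE = K_embeddingD[OF h(2)[OF this]]
    \<comment> \<open>Every \<open>Ms i\<close> was put into the range, so \<open>h\<close> is onto;
      a submodel of \<open>C\<close> with the same universe is \<open>C\<close> itself.\<close>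
    have "universe C \<subseteq> h ` universe C"
    proof
      fix x assume "x \<in> universe C"
      then obtain i where i: "i \<in> ords \<kappa>" "x \<in> universe (Ms i)" unfolding universe_C by blast
      then obtain y where y: "y \<in> universe (P i)" "x = g i y" using FA(6) by blast
      then have "x = h y" "y \<in> universe C" using h(1)[OF i(1)] leD(4)[OF FA(2)] by auto
      then show "x \<in> h ` universe C" by blast
    qed
    then have "universe (img h C) = universe C" using hE(5) by auto
    then have "img h C = C" using substructure_eqI[OF leD(3)[OF hE(4)]] by blast
    then have "struct_iso (voc K) h C C" using img_iso[OF hE(1,3)] by simp
    then obtain \<sigma> where s: "\<sigma> \<in> aut" "\<And>x. x \<in> universe C \<Longrightarrow> \<sigma> x = h x" by (rule ex_aut) blast
    have "\<sigma> x = f x" if x: "x \<in> universe M" for x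
    proof -
      have "x \<in> universe (P (ord_zero \<kappa>))" "x \<in> universe C"
        using x FA(3) leD(4)[OF assms(2)] by auto
      then show ?thesis using s(2) h(1)[OF ord_zero_ords] FA(4)[OF x] by simp
    qed
    then show ?thesis using that s(1) by blast
  qed (use ne in auto)
qed

text \<open>Submodels of \<open>C\<close> are determined by their universes, and coherence turns
  inclusion between them into \<open>le K\<close>. A continuous chain of models can therefore be
  prescribed by sets alone.\<close>

lemma small_cont_chain:
  assumes small: "\<And>j. ord_le \<kappa> j \<alpha> \<Longrightarrow> Y j \<in> small"
    and mono: "\<And>i j. ord_le \<kappa> i j \<Longrightarrow> ord_le \<kappa> j \<alpha> \<Longrightarrow> Y i \<subseteq> Y j"
    and lim: "\<And>i. limit_ord \<kappa> i \<Longrightarrow> ord_le \<kappa> i \<alpha> \<Longrightarrow> Y i \<subseteq> (\<Union>j\<in>below \<kappa> i. Y j)"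
  obtains Q where "cont_chain K \<kappa> \<alpha> Q"
    "\<forall>k. ord_le \<kappa> k \<alpha> \<longrightarrow> Q k \<in> \<K> \<and> le K (Q k) C \<and> universe (Q k) = Y k"
proof -
  have "\<forall>k. \<exists>P. ord_le \<kappa> k \<alpha> \<longrightarrow> P \<in> \<K> \<and> le K P C \<and> universe P = Y k"
    using small by (metis smallE)
  then obtain Q where Q0: "\<forall>k. ord_le \<kappa> k \<alpha> \<longrightarrow> Q k \<in> \<K> \<and> le K (Q k) C \<and> universe (Q k) = Y k"
    by metis
  have Q: "Q k \<in> \<K>" "le K (Q k) C" "universe (Q k) = Y k" if "ord_le \<kappa> k \<alpha>" for k
    using Q0 that by auto
  have Qle: "le K (Q i) (Q j)" if "ord_le \<kappa> i j" "ord_le \<kappa> j \<alpha>" for i j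
    by (rule le_common[OF Q(2)[OF ord_le_trans[OF that]] Q(2)[OF that(2)]])
      (simp add: Q(3)[OF ord_le_trans[OF that]] Q(3)[OF that(2)] mono[OF that])
  have "cont_chain K \<kappa> \<alpha> Q"
    unfolding cont_chain_def
  proof (intro conjI allI impI)
    fix i assume i: "limit_ord \<kappa> i" "ord_le \<kappa> i \<alpha>"
    have le: "ord_le \<kappa> j i" "ord_le \<kappa> j \<alpha>" if "j \<in> below \<kappa> i" for j
      using that below_le_trans[OF that i(2)] by (auto simp: below_iff)
    have "Y i = (\<Union>j\<in>below \<kappa> i. Y j)"
      using lim[OF i] mono[OF le(1) i(2)] by blast
    then have "universe (Q i) = (\<Union>P\<in>Q ` below \<kappa> i. universe P)" using Q(3)[OF i(2)] Q(3)[OF le(2)] by simp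
    moreover have "substructure (voc K) (Q j) (Q i)" if "j \<in> below \<kappa> i" for j
      using leD(3)[OF Qle[OF le(1)[OF that] i(2)]] .
    ultimately show "is_union (voc K) (Q ` below \<kappa> i) (Q i)"
      unfolding is_union_def using is_struct_model[OF models_of_cardD(1)[OF Q(1)[OF i(2)]]] by auto
  qed (use Q Qle in auto)
  then show ?thesis using Q0 by (rule that)
qed


lemma small_union:
  assumes "below \<kappa> j \<noteq> {}" "\<And>k. k \<in> below \<kappa> j \<Longrightarrow> V k \<in> small"
    and "\<And>k l. k \<in> below \<kappa> j \<Longrightarrow> l \<in> below \<kappa> k \<Longrightarrow> V l \<subseteq> V k"
  obtains U P where "U \<in> \<K>" "le K U C" "is_union (voc K) (P ` below \<kappa> j) U"
    "\<And>k. k \<in> below \<kappa> j \<Longrightarrow> P k \<in> \<K> \<and> le K (P k) C \<and> universe (P k) = V k"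
    "\<And>k l. k \<in> below \<kappa> j \<Longrightarrow> l \<in> below \<kappa> j \<Longrightarrow> le K (P k) (P l) \<or> le K (P l) (P k)"
    "universe U = (\<Union>k\<in>below \<kappa> j. V k)"
proof -
  have "\<forall>k\<in>below \<kappa> j. \<exists>M. M \<in> \<K> \<and> le K M C \<and> universe M = V k"
    using assms(2) by (metis smallE)
  then obtain P where P: "\<And>k. k \<in> below \<kappa> j \<Longrightarrow> P k \<in> \<K> \<and> le K (P k) C \<and> universe (P k) = V k"
    by metis
  obtain k0 where k0: "k0 \<in> below \<kappa> j" using assms(1) by blast
  have chain: "le K (P k) (P l) \<or> le K (P l) (P k)" if "k \<in> below \<kappa> j" "l \<in> below \<kappa> j" for k l
    using ord_total[OF below_ords(1)[OF that(1)] below_ords(1)[OF that(2)]]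
      assms(3)[OF that(1), of l] assms(3)[OF that(2), of k] P[OF that(1)] P[OF that(2)] le_common
    by (metis order_refl)
  have PK: "P k \<in> \<K>" if "k \<in> below \<kappa> j" for k using P[OF that] by blast
  obtain U where U: "U \<in> \<K>" "is_union (voc K) (P ` below \<kappa> j) U"
    "\<And>N. N \<in> models K \<Longrightarrow> (\<And>k. k \<in> below \<kappa> j \<Longrightarrow> le K (P k) N) \<Longrightarrow> le K U N"
    by (rule union_models_of_card[OF k0 card_below PK chain]) blast+
  have "le K U C" by (rule U(3)[OF C_model]) (use P in blast)
  moreover have "universe U = (\<Union>k\<in>below \<kappa> j. V k)" using is_unionD[OF U(2)] P by simp
  ultimately show ?thesis using that U(1,2) P chain by blast
qed

sublocale homogeneous_family \<kappa> small aut
proof unfold_locales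
  show "bij \<sigma>" if "\<sigma> \<in> aut" for \<sigma> using that by (simp add: aut_def)
  show "id \<in> aut" by (rule aut_id)
  show "\<sigma> \<circ> \<rho> \<in> aut" if "\<sigma> \<in> aut" "\<rho> \<in> aut" for \<sigma> \<rho> using aut_comp that .
  show "inv \<sigma> \<in> aut" if "\<sigma> \<in> aut" for \<sigma> using aut_inv that .
  show "\<sigma> ` X \<in> small" if "\<sigma> \<in> aut" "X \<in> small" for \<sigma> X using aut_small that .
  show "(\<Union>k\<in>below \<kappa> j. V k) \<in> small"
    if H: "below \<kappa> j \<noteq> {}" "\<And>k. k \<in> below \<kappa> j \<Longrightarrow> V k \<in> small"
      "\<And>k l. k \<in> below \<kappa> j \<Longrightarrow> l \<in> below \<kappa> k \<Longrightarrow> V l \<subseteq> V k" for j and V :: "'c set \<Rightarrow> 'a set"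
  proof -
    obtain U where "U \<in> \<K>" "le K U C" "universe U = (\<Union>k\<in>below \<kappa> j. V k)"
      by (rule small_union[OF H]) blast+
    then show ?thesis using smallI by metis
  qed
  show "\<exists>Z\<in>small. (\<Union>k\<in>below \<kappa> j. V k) \<subseteq> Z"
    if V: "\<And>k. k \<in> below \<kappa> j \<Longrightarrow> V k \<in> small" for j and V :: "'c set \<Rightarrow> 'a set"
  proof -
    have sub: "(\<Union>k\<in>below \<kappa> j. V k) \<subseteq> universe C" using V small_subset_C by blast
    have "|\<Union>k\<in>below \<kappa> j. V k| \<le>o \<kappa>" by (rule card_UN_le[OF card_below card_small[OF V]])
    from cover[OF sub this] show ?thesis using smallI by metis
  qed
  show "\<exists>Z\<in>small. X \<union> Y \<subseteq> Z" if "X \<in> small" "Y \<in> small" for X Y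
    using cover[of "X \<union> Y"] card_Un_le[OF card_small card_small] that small_subset_C smallI
    by (metis Un_least)
  show "\<exists>\<tau>\<in>aut. \<forall>k\<in>below \<kappa> j. \<forall>x\<in>V k. \<tau> x = f k x"
    if fV: "\<And>k. k \<in> below \<kappa> j \<Longrightarrow> f k \<in> aut \<and> V k \<in> small"
      and VV: "\<And>k l. k \<in> below \<kappa> j \<Longrightarrow> l \<in> below \<kappa> k \<Longrightarrow> V l \<subseteq> V k \<and> (\<forall>x\<in>V l. f k x = f l x)"
    for j f and V :: "'c set \<Rightarrow> 'a set"
  proof (cases "below \<kappa> j = {}")
    case True
    then show ?thesis using aut_id by blast
  next
    case False
    have Vs: "V k \<in> small" if "k \<in> below \<kappa> j" for k using fV[OF that] by blast
    have Vsub: "V l \<subseteq> V k" if "k \<in> below \<kappa> j" "l \<in> below \<kappa> k" for k l using VV[OF that] by blast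
    obtain U P where U: "U \<in> \<K>" "le K U C" "is_union (voc K) (P ` below \<kappa> j) U"
      and P: "\<And>k. k \<in> below \<kappa> j \<Longrightarrow> P k \<in> \<K> \<and> le K (P k) C \<and> universe (P k) = V k"
      and chain: "\<And>k l. k \<in> below \<kappa> j \<Longrightarrow> l \<in> below \<kappa> j \<Longrightarrow> le K (P k) (P l) \<or> le K (P l) (P k)"
      by (rule small_union[OF False Vs Vsub]) blast+
    obtain h where h: "\<And>k x. k \<in> below \<kappa> j \<Longrightarrow> x \<in> V k \<Longrightarrow> h x = f k x"
      by (rule glue_functions[of "below \<kappa> j" V f]) (use VV below_ords(1) in blast)+
    \<comment> \<open>The glued map embeds the union, which still has size \<kappa>, and therefore
      extends to an automorphism.\<close>
    have "K_embedding K h U C"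
    proof (rule K_embedding_union[OF _ _ U(3)])
      show "P ` below \<kappa> j \<noteq> {}" using False by blast
      show "le K M N \<or> le K N M" if "M \<in> P ` below \<kappa> j" "N \<in> P ` below \<kappa> j" for M N
        using that chain by blast
      show "K_embedding K h M C" if M: "M \<in> P ` below \<kappa> j" for M
      proof -
        obtain k where k: "k \<in> below \<kappa> j" "M = P k" using M by blast
        have "K_embedding K (f k) (P k) C" using aut_embedding fV[OF k(1)] P[OF k(1)] by blast
        then show ?thesis
          unfolding k(2) by (rule K_embedding_cong) (use h[OF k(1)] P[OF k(1)] in auto)
      qed
    qed
    then obtain \<tau> where t: "\<tau> \<in> aut" "\<And>x. x \<in> universe U \<Longrightarrow> \<tau> x = h x"
      using extend_to_aut[OF U(1,2)] by blast
    have "\<tau> x = f k x" if "k \<in> below \<kappa> j" "x \<in> V k" for k x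
      using t(2)[of x] h[OF that] is_unionD[OF U(3)] P[OF that(1)] that by auto
    then show ?thesis using t(1) by blast
  qed
qed

lemma Union_small: "\<Union> small = universe C"
proof
  show "\<Union> small \<subseteq> universe C" using small_subset_C by blast
  show "universe C \<subseteq> \<Union> small"
  proof
    fix x assume "x \<in> universe C"
    then obtain i where "i \<in> ords \<kappa>" "x \<in> universe (Ms i)" unfolding universe_C by blast
    then show "x \<in> \<Union> small" using Ms smallI by blast
  qed
qed

section \<open>Orbital types as orbits\<close>

text \<open>
  Ambient models of a type may be larger than \<open>C\<close>, so a triple is compared with elements of \<open>C\<close>
  through \<open>\<kappa>\<close>-sized submodels; allowing a map \<open>e\<close> on the base other than the identity makes the
  notion usable for models that are only embedded into \<open>C\<close>.
\<close>

definition realizes :: "('a \<Rightarrow> 'a) \<Rightarrow> 'a \<Rightarrow> 'a set \<Rightarrow> ('a, 'f, 'r) struct \<Rightarrow> 'a \<Rightarrow> bool" where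
  "realizes e b X N a \<longleftrightarrow> (\<exists>P f. P \<in> \<K> \<and> le K P N \<and> X \<subseteq> universe P \<and> b \<in> universe P \<and>
     K_embedding K f P C \<and> (\<forall>x\<in>X. f x = e x) \<and> f b = a)"

lemma card_insert_le: "|A| \<le>o \<kappa> \<Longrightarrow> |insert b A| \<le>o \<kappa>"
proof -
  assume "|A| \<le>o \<kappa>"
  moreover have "Field \<kappa> \<noteq> {}" using infinite_Field by auto
  then have "|{b}| \<le>o \<kappa>" unfolding card_le_Field by (rule card_of_singl_ordLeq)
  ultimately show ?thesis using card_Un_le[of "{b}" A] by simp
qed

lemma realizesI:
  assumes "K_embedding K e N C" "X \<in> \<K>" "le K X N" "b \<in> universe N"
  shows "realizes e b (universe X) N (e b)"
proof -
  have "insert b (universe X) \<subseteq> universe N" using assms leD(4) by blast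
  then obtain P where "P \<in> \<K>" "le K P N" "insert b (universe X) \<subseteq> universe P"
    using lowenheim_skolem[OF K_embeddingD(1)[OF assms(1)] _ card_insert_le[OF card_model[OF assms(2)]]
      assms(2) leD(4)[OF assms(3)]] by blast
  then show ?thesis
    unfolding realizes_def using K_embedding_subset assms(1) by blast
qed

lemma realizes_mono: "realizes e b X N a \<Longrightarrow> Y \<subseteq> X \<Longrightarrow> realizes e b Y N a"
  unfolding realizes_def by blast

lemma realizes_cong: "realizes e b X N a \<Longrightarrow> (\<And>x. x \<in> X \<Longrightarrow> e x = e' x) \<Longrightarrow> realizes e' b X N a"
  unfolding realizes_def by metis

text \<open>The amalgam \<open>N'\<close> may be too large for \<open>C\<close>, but a
  \<kappa>-sized submodel \<open>T\<close> containing both relevant images suffices. Its embedding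
  into \<open>C\<close> can be chosen to extend the one already given on the first side.\<close>

lemma realizes_step:
  assumes X: "X \<in> \<K>" and r: "realizes e b1 (universe X) N1 a"
    and step: "((b1, universe X, N1), (b2, A, N2)) \<in> tp_step K"
  shows "A = universe X \<and> realizes e b2 (universe X) N2 a"
proof -
  obtain N' f1 f2 where A: "A = universe X" and N2: "N2 \<in> models K" "universe X \<subseteq> universe N2" "b2 \<in> universe N2"
    and N': "N' \<in> models K" and f1: "K_embedding K f1 N1 N'" "fixes_pointwise f1 (universe X)"
    and f2: "K_embedding K f2 N2 N'" "fixes_pointwise f2 (universe X)" and b: "f1 b1 = f2 b2"
    using step unfolding tp_step_def by blast
  obtain P1 g where P1: "P1 \<in> \<K>" "le K P1 N1" "universe X \<subseteq> universe P1" "b1 \<in> universe P1"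
    and g: "K_embedding K g P1 C" "\<And>x. x \<in> universe X \<Longrightarrow> g x = e x" "g b1 = a"
    using r unfolding realizes_def by blast
  obtain P2 where P2: "P2 \<in> \<K>" "le K P2 N2" "insert b2 (universe X) \<subseteq> universe P2"
    using lowenheim_skolem[OF N2(1) _ card_insert_le[OF card_model[OF X]] X N2(2)] N2(2,3) by blast
  have f1P: "K_embedding K f1 P1 N'" by (rule K_embedding_subset[OF P1(2) f1(1)])
  have f2P: "K_embedding K f2 P2 N'" by (rule K_embedding_subset[OF P2(2) f2(1)])
  note f1D = K_embeddingD[OF f1P] and f2D = K_embeddingD[OF f2P]
  have imgP1: "img f1 P1 \<in> \<K>" by (rule img_models_of_card[OF P1(1) f1D(3)])
  have "|f1 ` universe P1 \<union> f2 ` universe P2| \<le>o \<kappa>"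
    by (rule card_Un_le[OF card_image_le[OF card_model[OF P1(1)]] card_image_le[OF card_model[OF P2(1)]]])
  then obtain T where T: "T \<in> \<K>" "le K T N'" "f1 ` universe P1 \<union> f2 ` universe P2 \<subseteq> universe T"
    using lowenheim_skolem[OF N' _ _ imgP1 leD(4)[OF f1D(4)], of "f1 ` universe P1 \<union> f2 ` universe P2"] f1D(5) f2D(5)
    by blast
  let ?k = "inv_into (universe P1) f1"
  have k: "?k (f1 x) = x" if "x \<in> universe P1" for x using f1D(3) that by simp
  have kE: "K_embedding K (g \<circ> ?k) (img f1 P1) C"
    by (rule K_embedding_comp[OF K_embedding_inverse(1)[OF f1P k] g(1)])
  have leT: "le K (img f1 P1) T" using le_common[OF f1D(4) T(2)] T(3) by simp
  obtain h where h: "K_embedding K h T C" "\<And>x. x \<in> universe (img f1 P1) \<Longrightarrow> h x = (g \<circ> ?k) x"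
    using embed_extend[OF imgP1 leT T(1) kE] by blast
  have hf1: "h (f1 x) = g x" if "x \<in> universe P1" for x
    using h(2)[of "f1 x"] k[OF that] that by simp
  have f2T: "K_embedding K f2 P2 T" by (rule K_embedding_into[OF f2P T(2)]) (use T(3) in blast)
  have "realizes e b2 (universe X) N2 a"
    unfolding realizes_def
  proof (intro exI conjI ballI)
    show "K_embedding K (h \<circ> f2) P2 C" by (rule K_embedding_comp[OF f2T h(1)])
    show "(h \<circ> f2) x = e x" if "x \<in> universe X" for x
    proof -
      have "f2 x = f1 x" using f1(2) f2(2) that by (simp add: fixes_pointwise_def)
      then show ?thesis using hf1[of x] g(2)[OF that] P1(3) that by auto
    qed
    show "(h \<circ> f2) b2 = a" using b hf1[OF P1(4)] g(3) by (metis comp_apply)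
  qed (use P2 in auto)
  then show ?thesis using A by blast
qed

lemma realizes_tp:
  assumes "X \<in> \<K>" "realizes e b (universe X) N a" "(c, A, N') \<in> tp K b (universe X) N"
  shows "A = universe X \<and> realizes e c (universe X) N' a"
proof -
  have "((b, universe X, N), (c, A, N')) \<in> (tp_step K)\<^sup>+"
    using assms(3) by (simp add: tp_def)
  then show ?thesis
  proof (induction "(c, A, N')" arbitrary: c A N' rule: trancl_induct)
    case base
    then show ?case using realizes_step assms(1,2) by blast
  next
    case (step y)
    obtain c1 A1 N1 where y: "y = (c1, A1, N1)" by (cases y)
    have "A1 = universe X \<and> realizes e c1 (universe X) N1 a" using step(3) y by blast
    then show ?case using realizes_step[OF assms(1)] step(2) y by blast
  qed
qed

text \<open>Both witnesses lie in one \<kappa>-sized \<open>T\<close> below \<open>N\<close>.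
  Extending both embeddings to \<open>T\<close> and composing one with the inverse of the other
  gives a map between submodels of \<open>C\<close>, which extends to the required
  automorphism.\<close>

lemma realizes_unique:
  assumes X: "X \<in> \<K>" and "realizes e b (universe X) N a" "realizes e b (universe X) N a'"
  shows "same_type a a' (e ` universe X)"
proof -
  obtain P f where P: "P \<in> \<K>" "le K P N" "universe X \<subseteq> universe P" "b \<in> universe P"
    and f: "K_embedding K f P C" "\<And>x. x \<in> universe X \<Longrightarrow> f x = e x" "f b = a"
    using assms(2) unfolding realizes_def by blast
  obtain P' f' where P': "P' \<in> \<K>" "le K P' N" "universe X \<subseteq> universe P'" "b \<in> universe P'"
    and f': "K_embedding K f' P' C" "\<And>x. x \<in> universe X \<Longrightarrow> f' x = e x" "f' b = a'"
    using assms(3) unfolding realizes_def by blast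
  obtain T where T: "T \<in> \<K>" "le K T N" "universe P \<union> universe P' \<subseteq> universe T"
    using lowenheim_skolem[OF leD(2)[OF P(2)] _ _ P(1) leD(4)[OF P(2)], of "universe P \<union> universe P'"]
      card_Un_le[OF card_model[OF P(1)] card_model[OF P'(1)]] leD(4)[OF P(2)] leD(4)[OF P'(2)] by blast
  obtain h where h: "K_embedding K h T C" "\<And>x. x \<in> universe P \<Longrightarrow> h x = f x"
    using embed_extend[OF P(1) le_common[OF P(2) T(2)] T(1) f(1)] T(3) by blast
  obtain h' where h': "K_embedding K h' T C" "\<And>x. x \<in> universe P' \<Longrightarrow> h' x = f' x"
    using embed_extend[OF P'(1) le_common[OF P'(2) T(2)] T(1) f'(1)] T(3) by blast
  let ?k = "inv_into (universe T) h"
  have k: "?k (h x) = x" if "x \<in> universe T" for x using K_embeddingD(3)[OF h(1)] that by simp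
  have kE: "K_embedding K (h' \<circ> ?k) (img h T) C"
    by (rule K_embedding_comp[OF K_embedding_inverse(1)[OF h(1) k] h'(1)])
  obtain \<sigma> where s: "\<sigma> \<in> aut" "\<And>x. x \<in> universe (img h T) \<Longrightarrow> \<sigma> x = (h' \<circ> ?k) x"
    using extend_to_aut[OF embedding_small(2,3)[OF h(1) T(1)] kE] by blast
  have sh: "\<sigma> (h x) = h' x" if "x \<in> universe T" for x
    using s(2)[of "h x"] k[OF that] that by simp
  have "\<sigma> (e x) = e x" if "x \<in> universe X" for x
  proof -
    have "x \<in> universe P" "x \<in> universe P'" "x \<in> universe T" using P(3) P'(3) T(3) that by auto
    then show ?thesis using sh[of x] h(2)[of x] h'(2)[of x] f(2)[OF that] f'(2)[OF that] by simp
  qed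
  then have "fixes_pointwise \<sigma> (e ` universe X)" by (simp add: fixes_pointwise_def)
  moreover have "\<sigma> a = a'"
  proof -
    have "b \<in> universe T" using P(4) T(3) by auto
    then show ?thesis using sh[of b] h(2)[OF P(4)] h'(2)[OF P'(4)] f(3) f'(3) by simp
  qed
  ultimately show ?thesis unfolding same_type_def using s(1) by blast
qed

section \<open>Equality of orbital types\<close>

lemma tp_step_sym: "(s, t) \<in> tp_step K \<Longrightarrow> (t, s) \<in> tp_step K"
proof -
  assume "(s, t) \<in> tp_step K"
  then obtain b1 b2 A N1 N2 where st: "s = (b1, A, N1)" "t = (b2, A, N2)"
    and H: "N1 \<in> models K" "N2 \<in> models K" "A \<subseteq> universe N1" "A \<subseteq> universe N2" "b1 \<in> universe N1" "b2 \<in> universe N2"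
    and "\<exists>N'\<in>models K. \<exists>f1 f2. K_embedding K f1 N1 N' \<and> fixes_pointwise f1 A \<and>
        K_embedding K f2 N2 N' \<and> fixes_pointwise f2 A \<and> f1 b1 = f2 b2"
    unfolding tp_step_def by blast
  then obtain N' f1 f2 where N': "N' \<in> models K" "K_embedding K f1 N1 N'" "fixes_pointwise f1 A"
    "K_embedding K f2 N2 N'" "fixes_pointwise f2 A" "f1 b1 = f2 b2" by blast
  then have "\<exists>N'\<in>models K. \<exists>f1 f2. K_embedding K f1 N2 N' \<and> fixes_pointwise f1 A \<and>
        K_embedding K f2 N1 N' \<and> fixes_pointwise f2 A \<and> f1 b2 = f2 b1"
    by (intro bexI[of _ N'] exI[of _ f2] exI[of _ f1]) auto
  then show ?thesis using H unfolding tp_step_def st by blast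
qed

lemma tp_eq_step:
  assumes "((b1, A, N1), (b2, A, N2)) \<in> tp_step K"
  shows "tp K b1 A N1 = tp K b2 A N2"
  unfolding tp_def using assms tp_step_sym[OF assms]
  by (auto intro: trancl_into_trancl2)

lemma tp_step_embed:
  assumes "K_embedding K f N N'" "fixes_pointwise f A" "A \<subseteq> universe N" "b \<in> universe N"
  shows "((b, A, N), (f b, A, N')) \<in> tp_step K"
proof -
  note f = K_embeddingD[OF assms(1)]
  have "A \<subseteq> universe N'" using f(5) assms(2,3) unfolding fixes_pointwise_def by (metis image_subset_iff subset_iff)
  moreover have "\<exists>N''\<in>models K. \<exists>f1 f2. K_embedding K f1 N N'' \<and> fixes_pointwise f1 A \<and>
        K_embedding K f2 N' N'' \<and> fixes_pointwise f2 A \<and> f1 b = f2 (f b)"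
    using assms(1,2) f(2) K_embedding_id[OF le_refl[OF f(2)]]
    by (intro bexI[of _ N'] exI[of _ f] exI[of _ id]) (auto simp: fixes_pointwise_def)
  ultimately show ?thesis
    using f assms(3,4) unfolding tp_step_def by blast
qed

lemma tp_self: "A \<subseteq> universe N \<Longrightarrow> b \<in> universe N \<Longrightarrow> N \<in> models K \<Longrightarrow> (b, A, N) \<in> tp K b A N"
  using tp_step_embed[OF K_embedding_id[OF le_refl], of N A b]
  by (auto simp: tp_def fixes_pointwise_def)

lemma realizes_tp_eq:
  assumes "realizes id b X N a"
  shows "tp K b X N = tp K a X C"
proof -
  obtain P f where P: "P \<in> \<K>" "le K P N" "X \<subseteq> universe P" "b \<in> universe P"
    and f: "K_embedding K f P C" "\<And>x. x \<in> X \<Longrightarrow> f x = x" "f b = a"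
    using assms unfolding realizes_def by auto
  have "((b, X, P), (b, X, N)) \<in> tp_step K"
    using tp_step_embed[OF K_embedding_id[OF P(2)] _ P(3,4)] by (simp add: fixes_pointwise_def)
  moreover have "((b, X, P), (a, X, C)) \<in> tp_step K"
    using tp_step_embed[OF f(1) _ P(3,4)] f(2,3) by (simp add: fixes_pointwise_def)
  ultimately show ?thesis using tp_eq_step by metis
qed


section \<open>Nonforking in the homogeneous model\<close>

text \<open>An extension \<open>X\<close> of the image of \<open>M\<close> is pulled back along
  \<open>e\<close>, embedded into \<open>N\<close> by universality and pushed forward again; the
  resulting map extends to an automorphism.\<close>

lemma universal_over_image:
  assumes e: "K_embedding K e N C" and u: "universal_over K \<kappa> N M"
  shows "univ_over (e ` universe N) (e ` universe M)"
  unfolding univ_over_def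
proof (intro conjI ballI impI)
  note uD = universal_overD[OF u]
  have eM: "K_embedding K e M C" by (rule K_embedding_subset[OF uD(3) e])
  show "e ` universe M \<in> small" "e ` universe N \<in> small" "e ` universe M \<subseteq> e ` universe N"
    using embedding_small(1) eM e uD leD(4)[OF uD(3)] by auto
  fix X assume X: "X \<in> small" "e ` universe M \<subseteq> X"
  obtain S where S: "S \<in> \<K>" "le K S C" "X = universe S" by (rule smallE[OF X(1)])
  let ?k = "inv_into (universe M) e"
  have k: "?k (e x) = x" if "x \<in> universe M" for x using K_embeddingD(3)[OF eM] that by simp
  have kE: "K_embedding K ?k (img e M) M" "img ?k (img e M) = M"
    using K_embedding_inverse[OF eM, of ?k] k by auto
  note I = embedding_small[OF eM uD(1)]
  have leS: "le K (img e M) S" using le_common[OF I(3) S(2)] X(2) S(3) by simp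
  obtain g where g: "inj_on g (universe S)" "\<And>x. x \<in> universe (img e M) \<Longrightarrow> g x = ?k x"
    "le K (img ?k (img e M)) (img g S)" "img g S \<in> \<K>"
    using extend_iso[OF I(2) K_embeddingD(3)[OF kE(1)] leS S(1)] by blast
  obtain h where h: "K_embedding K h (img g S) N" "fixes_pointwise h (universe M)"
    using u g(3,4) unfolding universal_over_def kE(2) by blast
  have E: "K_embedding K (e \<circ> (h \<circ> g)) S C"
    by (rule K_embedding_comp[OF K_embedding_comp[OF K_embedding_img[OF models_of_cardD(1)[OF S(1)] g(1)] h(1)] e])
  obtain \<sigma> where s: "\<sigma> \<in> aut" "\<And>x. x \<in> universe S \<Longrightarrow> \<sigma> x = (e \<circ> (h \<circ> g)) x"
    using extend_to_aut[OF S(1,2) E] by blast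
  have "\<sigma> y = y" if y: "y \<in> e ` universe M" for y
  proof -
    obtain x where x: "x \<in> universe M" "y = e x" using y by blast
    have "y \<in> universe S" using y X(2) S(3) by blast
    then have "\<sigma> y = e (h (g y))" using s(2) by simp
    also have "g y = x" using g(2)[of y] k[OF x(1)] x by simp
    also have "h x = x" using h(2) x(1) by (simp add: fixes_pointwise_def)
    finally show ?thesis using x(2) by simp
  qed
  then have "fixes_pointwise \<sigma> (e ` universe M)" by (simp add: fixes_pointwise_def)
  moreover have "\<sigma> ` X \<subseteq> e ` universe N"
  proof
    fix y assume "y \<in> \<sigma> ` X"
    then obtain x where x: "x \<in> universe S" "y = e (h (g x))" using s(2) S(3) by auto
    have "h (g x) \<in> universe N" using K_embeddingD(6)[OF h(1), of "g x"] x(1) by simp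
    then show "y \<in> e ` universe N" using x(2) by blast
  qed
  ultimately show "\<exists>\<sigma>\<in>aut. fixes_pointwise \<sigma> (e ` universe M) \<and> \<sigma> ` X \<subseteq> e ` universe N"
    using s(1) by blast
qed

lemma universal_over_iff:
  assumes "M \<in> \<K>" "le K M C" "N \<in> \<K>" "le K N C"
  shows "universal_over K \<kappa> N M \<longleftrightarrow> univ_over (universe N) (universe M)"
proof
  assume "universal_over K \<kappa> N M"
  from universal_over_image[OF K_embedding_id[OF assms(4)] this]
  show "univ_over (universe N) (universe M)" by simp
next
  assume u: "univ_over (universe N) (universe M)"
  have "\<exists>f. K_embedding K f M' N \<and> fixes_pointwise f (universe M)" if M': "M' \<in> \<K>" "le K M M'" for M'
  proof -
    obtain e where e: "K_embedding K e M' C" "fixes_pointwise e (universe M)"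
      by (rule embed_over[OF assms(1,2) M'])
    have "universe M \<subseteq> e ` universe M'"
      using image_mono[OF leD(4)[OF M'(2)], of e] e(2) by (simp add: fixes_pointwise_image)
    then obtain \<sigma> where s: "\<sigma> \<in> aut" "fixes_pointwise \<sigma> (universe M)" "\<sigma> ` e ` universe M' \<subseteq> universe N"
      using univ_over_embed[OF u embedding_small(1)[OF e(1) M'(1)]] by blast
    have "K_embedding K (\<sigma> \<circ> e) M' C"
      by (rule K_embedding_comp[OF e(1) aut_embedding[OF s(1) le_refl[OF C_model]]])
    then have "K_embedding K (\<sigma> \<circ> e) M' N"
      by (rule K_embedding_into[OF _ assms(4)]) (use s(3) in \<open>simp add: image_comp\<close>)
    moreover have "fixes_pointwise (\<sigma> \<circ> e) (universe M)"
      using e(2) s(2) by (simp add: fixes_pointwise_def)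
    ultimately show ?thesis by blast
  qed
  then show "universal_over K \<kappa> N M"
    unfolding universal_over_def using assms le_common[OF assms(2,4) univ_overD(3)[OF u]] by blast
qed

lemma realizes_iso:
  assumes r: "realizes e c X N a" and g: "struct_iso (voc K) g N N'" "N \<in> models K"
    and f: "\<And>x. x \<in> X \<Longrightarrow> g x = f x" "\<And>x. x \<in> X \<Longrightarrow> e' (f x) = e x"
  shows "realizes e' (g c) (f ` X) N' a"
proof -
  obtain P h where P: "P \<in> \<K>" "le K P N" "X \<subseteq> universe P" "c \<in> universe P"
    and h: "K_embedding K h P C" "\<And>x. x \<in> X \<Longrightarrow> h x = e x" "h c = a"
    using r unfolding realizes_def by blast
  have "K_embedding K g N N'"
    unfolding K_embedding_def using g(1) le_refl[OF iso_models[OF g(2,1)]] by blast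
  then have gP: "K_embedding K g P N'" by (rule K_embedding_subset[OF P(2)])
  note gD = K_embeddingD[OF gP]
  let ?k = "inv_into (universe P) g"
  have k: "?k (g x) = x" if "x \<in> universe P" for x using gD(3) that by simp
  show ?thesis
    unfolding realizes_def
  proof (intro exI[of _ "img g P"] exI[of _ "h \<circ> ?k"] conjI ballI)
    show "img g P \<in> \<K>" by (rule img_models_of_card[OF P(1) gD(3)])
    show "le K (img g P) N'" by (rule gD(4))
    show "f ` X \<subseteq> universe (img g P)" using P(3) f(1) by force
    show "g c \<in> universe (img g P)" using P(4) by simp
    show "K_embedding K (h \<circ> ?k) (img g P) C"
      by (rule K_embedding_comp[OF K_embedding_inverse(1)[OF gP k] h(1)])
    show "(h \<circ> ?k) y = e' y" if y: "y \<in> f ` X" for y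
    proof -
      obtain x where x: "x \<in> X" "y = f x" using y by blast
      then have "?k y = x" using k[of x] f(1)[OF x(1)] P(3) by auto
      then show ?thesis using h(2)[OF x(1)] f(2)[OF x(1)] x(2) by simp
    qed
    show "(h \<circ> ?k) (g c) = a" using k[OF P(4)] h(3) by simp
  qed
qed

lemma realizes_aut:
  assumes "realizes e b X N a" "\<sigma> \<in> aut"
  shows "realizes (\<sigma> \<circ> e) b X N (\<sigma> a)"
proof -
  obtain P f where P: "P \<in> \<K>" "le K P N" "X \<subseteq> universe P" "b \<in> universe P"
    and f: "K_embedding K f P C" "\<And>x. x \<in> X \<Longrightarrow> f x = e x" "f b = a"
    using assms(1) unfolding realizes_def by blast
  have "K_embedding K (\<sigma> \<circ> f) P C"
    by (rule K_embedding_comp[OF f(1) aut_embedding[OF assms(2) le_refl[OF C_model]]])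
  then show ?thesis unfolding realizes_def using P f by (metis comp_apply)
qed

lemma realizes_restrict:
  assumes "X \<in> \<K>" "Y \<in> \<K>" "universe Y \<subseteq> universe X" "realizes e b (universe X) N a"
    and "(c, A, N') \<in> tp_restrict K (tp K b (universe X) N) (universe Y)"
  shows "A = universe Y \<and> realizes e c (universe Y) N' a"
proof -
  obtain d A0 N0 where d: "(d, A0, N0) \<in> tp K b (universe X) N" "(c, A, N') \<in> tp K d (universe Y) N0"
    using assms(5) unfolding tp_restrict_def by blast
  have "realizes e d (universe X) N0 a" using realizes_tp[OF assms(1,4) d(1)] by blast
  then show ?thesis using realizes_tp[OF assms(2) realizes_mono[OF _ assms(3)] d(2)] by blast
qed

lemma tp_restrict_self:
  assumes "le K X N" "b \<in> universe N" "Y \<subseteq> universe X"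
  shows "(b, Y, N) \<in> tp_restrict K (tp K b (universe X) N) Y"
proof -
  have "(b, universe X, N) \<in> tp K b (universe X) N"
    by (rule tp_self) (use leD[OF assms(1)] assms(2) in auto)
  moreover have "(b, Y, N) \<in> tp K b Y N"
    by (rule tp_self) (use leD[OF assms(1)] assms in auto)
  ultimately show ?thesis unfolding tp_restrict_def by blast
qed

text \<open>A pair \<open>X\<close>, \<open>\<sigma>\<close> testing the orbit version is pulled
  back along \<open>e\<close> to submodels \<open>N1\<close>, \<open>N2\<close> of \<open>Q\<close>
  and an isomorphism \<open>f\<close>. The triple of \<open>b\<close> over \<open>N2\<close> then
  lies in the image of the restriction to \<open>N1\<close>. Tracing it shows that
  \<open>e b\<close> and \<open>inv \<sigma> (e b)\<close> both realize it under the base map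
  \<open>inv \<sigma> \<circ> e\<close>, so they are conjugate over \<open>X\<close>.\<close>

lemma nonsplitting_image:
  assumes e: "K_embedding K e Q' C" and Q: "Q \<in> \<K>" "le K Q Q'" and b: "b \<in> universe Q'" and U: "U \<in> \<K>"
    and ns: "nonsplitting K \<kappa> (tp K b (universe Q) Q') U Q"
  shows "nonsplit (e b) (e ` universe U) (e ` universe Q)"
  unfolding nonsplit_def
proof (intro conjI ballI impI)
  have UQ: "le K U Q" using ns unfolding nonsplitting_def by blast
  have eQ: "K_embedding K e Q C" by (rule K_embedding_subset[OF Q(2) e])
  have eU: "K_embedding K e U C" by (rule K_embedding_subset[OF UQ eQ])
  show "e b \<in> \<Union> small" unfolding Union_small by (rule K_embeddingD(6)[OF e b])
  show "e ` universe U \<in> small" "e ` universe Q \<in> small" "e ` universe U \<subseteq> e ` universe Q"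
    using embedding_small(1)[OF eU U] embedding_small(1)[OF eQ Q(1)] leD(4)[OF UQ] by auto
  fix X \<sigma> assume X: "X \<in> small" and s: "\<sigma> \<in> aut" "e ` universe U \<subseteq> X" "X \<subseteq> e ` universe Q"
    "\<sigma> ` X \<subseteq> e ` universe Q" "fixes_pointwise \<sigma> (e ` universe U)"
  obtain S where S: "S \<in> \<K>" "le K S C" "X = universe S" by (rule smallE[OF X])
  let ?k = "inv_into (universe Q') e"
  have k: "?k (e x) = x" if "x \<in> universe Q" for x
    using K_embeddingD(3)[OF e] leD(4)[OF Q(2)] that by auto
  have ek: "e (?k y) = y" if "y \<in> e ` universe Q" for y using k that by auto
  note kE = K_embedding_inverse(1)[OF eQ k] and imgQ = K_embeddingD(4)[OF eQ]
  have S_le: "le K S (img e Q)" using le_common[OF S(2) imgQ] S(3) s(3) by simp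
  have kS: "K_embedding K ?k S Q" by (rule K_embedding_subset[OF S_le kE])
  define N1 where "N1 = img ?k S"
  have N1: "N1 \<in> \<K>" "le K N1 Q" "universe N1 = ?k ` X"
    unfolding N1_def using img_models_of_card[OF S(1) K_embeddingD(3)[OF kS]] K_embeddingD(4)[OF kS] S(3) by auto
  have eN1: "e ` universe N1 = X" using N1(3) ek s(3) by (force simp: image_image)
  have sS: "K_embedding K \<sigma> S (img e Q)"
    by (rule K_embedding_into[OF aut_embedding[OF s(1) S(2)] imgQ]) (use s(4) S(3) in simp)
  have eN1S: "K_embedding K e N1 S"
    by (rule K_embedding_into[OF K_embedding_subset[OF N1(2) eQ] S(2)]) (use eN1 S(3) in simp)
  define f where "f = ?k \<circ> (\<sigma> \<circ> e)"
  have f: "K_embedding K f N1 Q"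
    unfolding f_def by (rule K_embedding_comp[OF K_embedding_comp[OF eN1S sS] kE])
  note fD = K_embeddingD[OF f]
  define N2 where "N2 = img f N1"
  have N2: "N2 \<in> \<K>" "le K N2 Q" "universe N2 = f ` universe N1"
    unfolding N2_def using img_models_of_card[OF N1(1) fD(3)] fD(4) by auto
  have iso: "struct_iso (voc K) f N1 N2" unfolding N2_def by (rule img_iso[OF fD(1,3)])
  have U_sub: "universe U \<subseteq> universe N1" unfolding N1(3)
  proof
    fix u assume u: "u \<in> universe U"
    then have "u = ?k (e u)" using k leD(4)[OF UQ] by auto
    then show "u \<in> ?k ` X" using u s(2) by blast
  qed
  have fU: "fixes_pointwise f (universe U)"
    unfolding fixes_pointwise_def f_def using s(5) k leD(4)[OF UQ] by (auto simp: fixes_pointwise_def)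
  have U1: "le K U N1" by (rule le_common[OF UQ N1(2) U_sub])
  have "universe U \<subseteq> universe N2"
    using image_mono[OF U_sub, of f] fU N2(3) by (simp add: fixes_pointwise_image)
  then have U2: "le K U N2" by (rule le_common[OF UQ N2(2)])
  let ?p = "tp K b (universe Q) Q'"
  have eq: "tp_image K f (tp_restrict K ?p (universe N1)) = tp_restrict K ?p (universe N2)"
    using ns N1(1) N2(1) U1 N1(2) U2 N2(2) iso fU unfolding nonsplitting_def by blast
  have "(b, universe N2, Q') \<in> tp_image K f (tp_restrict K ?p (universe N1))"
    unfolding eq by (rule tp_restrict_self[OF Q(2) b leD(4)[OF N2(2)]])
  then obtain c A N N' g where c: "(c, A, N) \<in> tp_restrict K ?p (universe N1)"
    and g: "struct_iso (voc K) g N N'" "\<forall>x\<in>A. g x = f x"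
    and m: "(b, universe N2, Q') \<in> tp K (g c) (f ` A) N'"
    unfolding tp_image_def by blast
  have rb: "realizes e b (universe Q) Q' (e b)" by (rule realizesI[OF e Q b])
  have rc: "A = universe N1" "realizes e c (universe N1) N (e b)"
    using realizes_restrict[OF Q(1) N1(1) leD(4)[OF N1(2)] rb c] by auto
  then have Nm: "N \<in> models K" unfolding realizes_def using leD(2) by blast
  let ?e = "inv \<sigma> \<circ> e"
  have ef: "?e (f x) = e x" if "x \<in> universe N1" for x
  proof -
    have "e x \<in> X" using eN1 that by blast
    then have "\<sigma> (e x) \<in> e ` universe Q" using s(4) by blast
    then show ?thesis unfolding f_def using ek[of "\<sigma> (e x)"] inv_apply[OF s(1)] by simp
  qed
  have "realizes ?e (g c) (f ` universe N1) N' (e b)"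
    by (rule realizes_iso[OF rc(2) g(1) Nm]) (use g(2) rc(1) ef in auto)
  then have r1: "realizes ?e b (universe N2) Q' (e b)"
    using realizes_tp[OF N2(1)] m rc(1) N2(3) by metis
  have r2: "realizes ?e b (universe N2) Q' (inv \<sigma> (e b))"
    by (rule realizes_aut[OF realizes_mono[OF rb leD(4)[OF N2(2)]] aut_inv[OF s(1)]])
  have "?e ` universe N2 = X"
    unfolding N2(3) using ef eN1 by (force simp: image_image)
  then have "same_type (e b) (inv \<sigma> (e b)) X" using realizes_unique[OF N2(1) r1 r2] by simp
  then have "same_type (\<sigma> (e b)) (\<sigma> (inv \<sigma> (e b))) (\<sigma> ` X)" by (rule same_type_image[OF _ s(1)])
  then show "same_type (\<sigma> (e b)) (e b) (\<sigma> ` X)" by (simp add: apply_inv[OF s(1)])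
qed

section \<open>From orbits back to orbital types\<close>

lemma same_type_tp_eq:
  assumes "same_type a b X" "X \<subseteq> universe C" "a \<in> universe C"
  shows "tp K a X C = tp K b X C"
proof -
  obtain \<sigma> where s: "\<sigma> \<in> aut" "fixes_pointwise \<sigma> X" "\<sigma> a = b"
    using assms(1) unfolding same_type_def by blast
  have "((a, X, C), (\<sigma> a, X, C)) \<in> tp_step K"
    by (rule tp_step_embed[OF aut_embedding[OF s(1) le_refl[OF C_model]] s(2) assms(2,3)])
  then show ?thesis using tp_eq_step s(3) by simp
qed

lemma realizes_id:
  assumes "X \<in> \<K>" "le K X N" "le K N C" "a \<in> universe N"
  shows "realizes id a (universe X) N a"
  using realizesI[OF K_embedding_id[OF assms(3)] assms(1,2,4)] by simp

text \<open>All representatives give the same restricted type, so the union in the definition is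
  that of a single set; images of types behave likewise.\<close>

lemma tp_restrict_eq:
  assumes "X \<in> \<K>" "le K X N" "le K N C" "a \<in> universe N" "Y \<subseteq> universe X"
  shows "tp_restrict K (tp K a (universe X) N) Y = tp K a Y C"
proof -
  let ?p = "tp K a (universe X) N"
  have "tp K b Y N0 = tp K a Y C" if "(b, A, N0) \<in> ?p" for b A N0
    using realizes_tp[OF assms(1) realizes_id[OF assms(1-4)] that] realizes_mono[OF _ assms(5)] realizes_tp_eq
    by blast
  moreover have "(a, universe X, N) \<in> ?p"
    by (rule tp_self) (use leD[OF assms(2)] assms(4) in auto)
  ultimately have "{tp K b Y N0 | b A N0. (b, A, N0) \<in> ?p} = {tp K a Y C}" by blast
  then show ?thesis unfolding tp_restrict_def by simp
qed

lemma tp_image_eq: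
  assumes N1: "N1 \<in> \<K>" "le K N1 C" and s: "\<sigma> \<in> aut" "\<And>x. x \<in> universe N1 \<Longrightarrow> f x = \<sigma> x"
    and a: "a \<in> universe C"
  shows "tp_image K f (tp K a (universe N1) C) = tp K (\<sigma> a) (f ` universe N1) C"
proof -
  have ra: "realizes id a (universe N1) C a" by (rule realizes_id[OF N1 le_refl[OF C_model] a])
  have "tp K (g c) (f ` A) N' = tp K (\<sigma> a) (f ` universe N1) C"
    if H: "(c, A, N) \<in> tp K a (universe N1) C" "struct_iso (voc K) g N N'" "\<forall>x\<in>A. g x = f x" for c A N N' g
  proof -
    have rc: "A = universe N1" "realizes id c (universe N1) N a"
      using realizes_tp[OF N1(1) ra H(1)] by auto
    then have Nm: "N \<in> models K" unfolding realizes_def using leD(2) by blast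
    have "realizes (inv \<sigma>) (g c) (f ` universe N1) N' a"
      by (rule realizes_iso[OF rc(2) H(2) Nm]) (use H(3) rc(1) s(2) inv_apply[OF s(1)] in auto)
    from realizes_aut[OF this s(1)] have "realizes id (g c) (f ` universe N1) N' (\<sigma> a)"
      by (rule realizes_cong) (simp add: apply_inv[OF s(1)])
    then show ?thesis using realizes_tp_eq rc(1) by blast
  qed
  moreover have "(a, universe N1, C) \<in> tp K a (universe N1) C"
    by (rule tp_self[OF leD(4)[OF N1(2)] a C_model])
  moreover have "struct_iso (voc K) \<sigma> C C" "\<forall>x\<in>universe N1. \<sigma> x = f x" using aut_iso[OF s(1)] s(2) by auto
  ultimately have "{tp K (g c) (f ` A) N' | c A N N' g. (c, A, N) \<in> tp K a (universe N1) C \<and>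
      struct_iso (voc K) g N N' \<and> (\<forall>x\<in>A. g x = f x)} = {tp K (\<sigma> a) (f ` universe N1) C}"
    by blast
  then show ?thesis unfolding tp_image_def by simp
qed

text \<open>An isomorphism between submodels of \<open>X\<close> embeds its domain into
  \<open>C\<close>, hence extends to an automorphism, and automorphisms are what the orbit version
  quantifies over.\<close>

lemma nonsplit_nonsplitting:
  assumes X: "X \<in> \<K>" "le K X N" and N: "le K N C" and a: "a \<in> universe N" and U: "U \<in> \<K>" "le K U C"
    and ns: "nonsplit a (universe U) (universe X)"
  shows "nonsplitting K \<kappa> (tp K a (universe X) N) U X"
  unfolding nonsplitting_def
proof (intro conjI ballI allI impI)
  have XC: "le K X C" by (rule le_trans[OF X(2) N])
  have aC: "a \<in> universe C" using a leD(4)[OF N] by blast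
  show "tp K a (universe X) N \<in> types_over K X" unfolding types_over_def using X a by blast
  show "le K U X" by (rule le_common[OF U(2) XC nonsplitD(4)[OF ns]])
  fix N1 N2 f
  assume N1: "N1 \<in> \<K>" and N2: "N2 \<in> \<K>" and le: "le K U N1" "le K N1 X" "le K U N2" "le K N2 X"
    and f: "struct_iso (voc K) f N1 N2" "fixes_pointwise f (universe U)"
  have N1C: "le K N1 C" and N2C: "le K N2 C" using le_trans[OF _ XC] le by auto
  have "K_embedding K f N1 C" unfolding K_embedding_def using f(1) N2C by blast
  then obtain \<sigma> where s: "\<sigma> \<in> aut" "\<And>x. x \<in> universe N1 \<Longrightarrow> \<sigma> x = f x"
    using extend_to_aut[OF N1 N1C] by blast
  have im: "f ` universe N1 = universe N2" using struct_isoD(4)[OF f(1)] by simp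
  have sim: "\<sigma> ` universe N1 = universe N2" using im s(2) by force
  have "same_type (\<sigma> a) a (\<sigma> ` universe N1)"
  proof (rule nonsplit_apply[OF ns smallI[OF N1 N1C] s(1)])
    show "universe U \<subseteq> universe N1" "universe N1 \<subseteq> universe X" "\<sigma> ` universe N1 \<subseteq> universe X"
      using leD(4) le sim by auto
    show "fixes_pointwise \<sigma> (universe U)"
      using f(2) s(2) leD(4)[OF le(1)] by (auto simp: fixes_pointwise_def)
  qed
  then have eq: "tp K (\<sigma> a) (universe N2) C = tp K a (universe N2) C"
    using same_type_tp_eq[OF _ leD(4)[OF N2C]] K_embeddingD(6)[OF aut_embedding[OF s(1) le_refl[OF C_model]] aC] sim
    by simp
  have "tp_image K f (tp_restrict K (tp K a (universe X) N) (universe N1)) = tp K (\<sigma> a) (f ` universe N1) C"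
    unfolding tp_restrict_eq[OF X N a leD(4)[OF le(2)]]
    by (rule tp_image_eq[OF N1 N1C s(1) _ aC]) (simp add: s(2))
  also have "\<dots> = tp_restrict K (tp K a (universe X) N) (universe N2)"
    unfolding tp_restrict_eq[OF X N a leD(4)[OF le(4)]] im eq ..
  finally show "tp_image K f (tp_restrict K (tp K a (universe X) N) (universe N1)) =
    tp_restrict K (tp K a (universe X) N) (universe N2)" .
qed

section \<open>Limit models and the translation of nonforking\<close>

lemma limit_model_card: "limit_model K \<kappa> M \<Longrightarrow> M \<in> \<K>"
  unfolding limit_model_def limit_over_def cont_chain_def using limit_ord_ords ord_le_refl by metis

text \<open>By categoricity \<open>M\<close> is isomorphic to the given limit model, and the whole
  chain witnessing limitness is copied. Universality of its steps is transferred through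
  \<open>univ_over\<close>.\<close>

lemma all_limit:
  assumes M: "M \<in> \<K>" "le K M C"
  shows "limit_model K \<kappa> M"
proof -
  obtain L \<delta> L0 where d: "limit_ord \<kappa> \<delta>" and lim: "limit_over K \<kappa> \<delta> L L0"
    using ex_limit_model unfolding limit_model_def by blast
  obtain Ls where Ls: "cont_chain K \<kappa> \<delta> Ls" "Ls \<delta> = L"
    and univ: "\<And>i. i \<in> below \<kappa> \<delta> \<Longrightarrow> universal_over K \<kappa> (Ls (ord_suc \<kappa> i)) (Ls i)"
    using lim unfolding limit_over_def by blast
  have LK: "Ls i \<in> \<K>" if "ord_le \<kappa> i \<delta>" for i using Ls(1) that unfolding cont_chain_def by blast
  have Lle: "le K (Ls i) (Ls j)" if "ord_le \<kappa> i j" "ord_le \<kappa> j \<delta>" for i j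
    using Ls(1) that unfolding cont_chain_def by blast
  have Lun: "is_union (voc K) (Ls ` below \<kappa> i) (Ls i)" if "limit_ord \<kappa> i" "ord_le \<kappa> i \<delta>" for i
    using Ls(1) that unfolding cont_chain_def by blast
  have dd: "ord_le \<kappa> \<delta> \<delta>" by (rule ord_le_refl[OF limit_ord_ords[OF d]])
  have "L \<in> \<K>" using LK[OF dd] Ls(2) by simp
  then obtain f where f: "struct_iso (voc K) f L M"
    using categorical M(1) unfolding categorical_def by blast
  have fE: "K_embedding K f L C" unfolding K_embedding_def using f M(2) by blast
  have fL: "K_embedding K f (Ls i) C" if "ord_le \<kappa> i \<delta>" for i
    using K_embedding_subset[OF Lle[OF that dd]] fE Ls(2) by simp
  note I = embedding_small[OF fL LK]
  have imle: "le K (img f (Ls i)) (img f (Ls j))" if "ord_le \<kappa> i j" "ord_le \<kappa> j \<delta>" for i j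
    by (rule img_le[OF Lle[OF that] K_embeddingD(3)[OF fL[OF that(2)]]])
  have chain: "cont_chain K \<kappa> \<delta> (\<lambda>i. img f (Ls i))"
    unfolding cont_chain_def
  proof (intro conjI allI impI)
    fix i assume i: "limit_ord \<kappa> i" "ord_le \<kappa> i \<delta>"
    have "substructure (voc K) (img f (Ls j)) (img f (Ls i))" if "j \<in> below \<kappa> i" for j
      using leD(3)[OF imle] i(2) that by (simp add: below_iff)
    then show "is_union (voc K) ((\<lambda>i. img f (Ls i)) ` below \<kappa> i) (img f (Ls i))"
      unfolding is_union_def
      using is_struct_model[OF models_of_cardD(1)[OF I(2)[OF i(2) i(2)]]] is_unionD[OF Lun[OF i]] by auto
  qed (use I imle in auto)
  have "universal_over K \<kappa> (img f (Ls (ord_suc \<kappa> i))) (img f (Ls i))" if i: "i \<in> below \<kappa> \<delta>" for i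
  proof -
    have le: "ord_le \<kappa> i \<delta>" "ord_le \<kappa> (ord_suc \<kappa> i) \<delta>"
      using limit_ord_suc[OF d i] i by (auto simp: below_iff)
    show ?thesis
      using universal_over_image[OF fL[OF le(2)] univ[OF i]]
        universal_over_iff[OF I(2,3)[OF le(1) le(1)] I(2,3)[OF le(2) le(2)]] by simp
  qed
  then have "limit_over K \<kappa> \<delta> (img f (Ls \<delta>)) (img f (Ls (ord_zero \<kappa>)))"
    unfolding limit_over_def using chain by blast
  moreover have "img f (Ls \<delta>) = M" using struct_iso_eq_image[OF f] Ls(2) by simp
  ultimately show ?thesis unfolding limit_model_def using d by blast
qed

lemma free_nonforking:
  assumes X: "X \<in> \<K>" "le K X N" and N: "le K N C" and a: "a \<in> universe N" and M: "M \<in> \<K>" "le K M C"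
    and fr: "free a (universe X) (universe M)"
  shows "nonforking K \<kappa> (tp K a (universe X) N) M X"
proof -
  have XC: "le K X C" by (rule le_trans[OF X(2) N])
  obtain B where B: "univ_over (universe M) B" "nonsplit a B (universe X)"
    using fr unfolding free_def by blast
  obtain U where U: "U \<in> \<K>" "le K U C" "B = universe U"
    using smallE[OF univ_overD(1)[OF B(1)]] by blast
  have "universal_over K \<kappa> M U" using universal_over_iff[OF U(1,2) M] B(1) U(3) by simp
  moreover have "nonsplitting K \<kappa> (tp K a (universe X) N) U X"
    using nonsplit_nonsplitting[OF X N a U(1,2)] B(2) U(3) by simp
  moreover have "tp K a (universe X) N \<in> types_over K X" unfolding types_over_def using X a by blast
  ultimately show ?thesis
    unfolding nonforking_def using all_limit M X(1) XC le_common[OF M(2) XC freeD(3)[OF fr]] U(1) by blast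
qed

lemma nonforking_free:
  assumes nf: "nonforking K \<kappa> (tp K b (universe Q) Q') M Q" and Q: "le K Q Q'" and b: "b \<in> universe Q'"
    and e: "K_embedding K e Q' C"
  shows "free (e b) (e ` universe Q) (e ` universe M)"
proof -
  have QK: "Q \<in> \<K>" and MK: "M \<in> \<K>" and MQ: "le K M Q"
    using nf limit_model_card unfolding nonforking_def by auto
  obtain U where U: "U \<in> \<K>" "universal_over K \<kappa> M U" "nonsplitting K \<kappa> (tp K b (universe Q) Q') U Q"
    using nf unfolding nonforking_def by blast
  have eQ: "K_embedding K e Q C" by (rule K_embedding_subset[OF Q e])
  have eM: "K_embedding K e M C" by (rule K_embedding_subset[OF MQ eQ])
  show ?thesis
    unfolding free_def
    using embedding_small(1)[OF eM MK] embedding_small(1)[OF eQ QK] leD(4)[OF MQ]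
      universal_over_image[OF eM U(2)] nonsplitting_image[OF e QK Q b U(1,3)] by blast
qed

end

locale symmetric_monster = monster +
  assumes symmetry: "has_symmetry K \<kappa>"
begin

section \<open>The axioms of a superstable family\<close>

lemma ex_univ_over:
  assumes "X \<in> small"
  shows "\<exists>Y. univ_over Y X"
proof -
  obtain M where M: "M \<in> \<K>" "le K M C" "X = universe M" by (rule smallE[OF assms])
  obtain N where N: "universal_over K \<kappa> N M" by (rule ex_universal_over[OF M(1)])
  obtain e where e: "K_embedding K e N C" "fixes_pointwise e (universe M)"
    using embed_over[OF M(1,2)] universal_overD[OF N] by blast
  have "univ_over (e ` universe N) (e ` universe M)" by (rule universal_over_image[OF e(1) N])
  then show ?thesis using e(2) M(3) fixes_pointwise_image by metis
qed

lemma local_character_small: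
  assumes d: "limit_ord \<kappa> \<delta>" and a: "a \<in> \<Union> small"
    and V: "\<And>k l. k \<in> below \<kappa> \<delta> \<Longrightarrow> l \<in> below \<kappa> k \<Longrightarrow> univ_over (V k) (V l)"
  shows "\<exists>k\<in>below \<kappa> \<delta>. nonsplit a (V k) (\<Union>k\<in>below \<kappa> \<delta>. V k)"
proof -
  have VS: "V k \<in> small" if "k \<in> below \<kappa> \<delta>" for k
    using univ_overD(1)[OF V[OF limit_ord_suc[OF d that] below_ord_suc[OF below_ords(1)[OF that]]]] .
  have Vmono: "V l \<subseteq> V k" if "k \<in> below \<kappa> \<delta>" "l \<in> below \<kappa> k" for k l
    using univ_overD(3)[OF V[OF that]] .
  txt \<open>Taking unions at limits makes the chain continuous, and it stays universal at successors.\<close>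
  define W where "W k = (if limit_ord \<kappa> k then \<Union>l\<in>below \<kappa> k. V l else V k)" for k
  have lt: "l \<in> below \<kappa> \<delta>" if "l \<in> below \<kappa> k" "ord_le \<kappa> k \<delta>" for k l
    using below_le_trans that .
  have WS: "W k \<in> small" if k: "ord_le \<kappa> k \<delta>" for k
  proof (cases "limit_ord \<kappa> k")
    case True
    then have ne: "below \<kappa> k \<noteq> {}" using zero_below unfolding limit_ord_def by blast
    have "(\<Union>l\<in>below \<kappa> k. V l) \<in> small"
      by (rule union_closed[OF ne VS[OF lt[OF _ k]] Vmono[OF lt[OF _ k]]])
    then show ?thesis using True by (simp add: W_def)
  next
    case False
    then have "k \<in> below \<kappa> \<delta>" using k d by (auto simp: below_iff)
    then show ?thesis using VS False by (simp add: W_def)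
  qed
  have WV: "W k \<subseteq> V k" if "k \<in> below \<kappa> \<delta>" for k
    using Vmono[OF that] by (auto simp: W_def)
  have VW: "V l \<subseteq> W k" if "l \<in> below \<kappa> k" "ord_le \<kappa> k \<delta>" for k l
  proof (cases "limit_ord \<kappa> k")
    case True
    then show ?thesis using that(1) by (auto simp: W_def)
  next
    case False
    then have "k \<in> below \<kappa> \<delta>" using that(2) d by (auto simp: below_iff)
    then show ?thesis using Vmono that(1) False by (auto simp: W_def)
  qed
  have Wmono: "W k \<subseteq> W l" if "ord_le \<kappa> k l" "ord_le \<kappa> l \<delta>" for k l
  proof (cases "k = l")
    case False
    then have "k \<in> below \<kappa> l" using that(1) by (simp add: below_iff)
    then show ?thesis using WV[OF lt[OF _ that(2)]] VW[OF _ that(2)] by blast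
  qed simp
  have Wlim: "W i \<subseteq> (\<Union>j\<in>below \<kappa> i. W j)" if i: "limit_ord \<kappa> i" "ord_le \<kappa> i \<delta>" for i
  proof -
    have "V j \<subseteq> (\<Union>j\<in>below \<kappa> i. W j)" if j: "j \<in> below \<kappa> i" for j
    proof -
      have suc: "ord_suc \<kappa> j \<in> below \<kappa> i" by (rule limit_ord_suc[OF i(1) j])
      then have "ord_le \<kappa> (ord_suc \<kappa> j) \<delta>" using lt[OF suc i(2)] by (simp add: below_iff)
      from VW[OF below_ord_suc[OF below_ords(1)[OF j]] this] show ?thesis using suc by blast
    qed
    then show ?thesis using i(1) by (simp add: W_def[of i] UN_least)
  qed
  obtain N where chain: "cont_chain K \<kappa> \<delta> N"
    and N0: "\<forall>k. ord_le \<kappa> k \<delta> \<longrightarrow> N k \<in> \<K> \<and> le K (N k) C \<and> universe (N k) = W k"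
    by (rule small_cont_chain[of \<delta> W, OF WS Wmono Wlim])
  have N: "N k \<in> \<K>" "le K (N k) C" "universe (N k) = W k" if "ord_le \<kappa> k \<delta>" for k
    using N0 that by auto
  have dd: "ord_le \<kappa> \<delta> \<delta>" by (rule ord_le_refl[OF limit_ord_ords[OF d]])
  have suc_nl: "W (ord_suc \<kappa> k) = V (ord_suc \<kappa> k)" if "k \<in> ords \<kappa>" for k
    using not_limit_suc[OF that] by (simp add: W_def)
  have univ: "universal_over K \<kappa> (N (ord_suc \<kappa> i)) (N i)" if i: "i \<in> below \<kappa> \<delta>" for i
  proof -
    have le: "ord_le \<kappa> i \<delta>" "ord_le \<kappa> (ord_suc \<kappa> i) \<delta>"
      using limit_ord_suc[OF d i] i by (auto simp: below_iff)
    have "univ_over (V (ord_suc \<kappa> i)) (V i)"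
      by (rule V[OF limit_ord_suc[OF d i] below_ord_suc[OF below_ords(1)[OF i]]])
    then have "univ_over (V (ord_suc \<kappa> i)) (W i)"
      by (rule univ_over_base[OF _ WV[OF i] WS[OF le(1)]])
    then show ?thesis
      using universal_over_iff[OF N(1,2)[OF le(1)] N(1,2)[OF le(2)]] N(3)[OF le(1)] N(3)[OF le(2)]
        suc_nl[OF below_ords(1)[OF i]] by simp
  qed
  have aC: "a \<in> universe C" using a Union_small by simp
  have "tp K a (universe (N \<delta>)) C \<in> types_over K (N \<delta>)"
    unfolding types_over_def using N(2)[OF dd] aC by blast
  then obtain i where i: "i \<in> below \<kappa> \<delta>" "nonsplitting K \<kappa> (tp K a (universe (N \<delta>)) C) (N i) (N \<delta>)"
    using superstable d chain univ unfolding superstable_def by blast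
  have ile: "ord_le \<kappa> i \<delta>" using i(1) by (simp add: below_iff)
  have "nonsplit (id a) (id ` universe (N i)) (id ` universe (N \<delta>))"
    by (rule nonsplitting_image[OF K_embedding_id[OF le_refl[OF C_model]] N(1,2)[OF dd] aC N(1)[OF ile] i(2)])
  then have ns: "nonsplit a (W i) (W \<delta>)" using N(3)[OF ile] N(3)[OF dd] by simp
  have Wd: "W \<delta> = (\<Union>k\<in>below \<kappa> \<delta>. V k)" using d by (simp add: W_def)
  have "nonsplit a (V i) (W \<delta>)"
    by (rule nonsplit_mono[OF ns]) (use WV[OF i(1)] VW[OF i(1) dd] VS[OF i(1)] WS[OF dd] in auto)
  then show ?thesis using i(1) Wd by auto
qed

text \<open>A small \<open>N\<close> containing \<open>a\<close> and \<open>Z\<close> plays the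
  ambient model in the symmetry hypothesis. The models it returns may lie outside \<open>C\<close>;
  embedding them over \<open>N\<close> fixes \<open>a\<close>, \<open>b\<close> and
  \<open>M\<close>.\<close>

lemma free_symmetric_small:
  assumes M: "M \<in> small" and a: "a \<in> \<Union> small" and Z: "Z \<in> small" "b \<in> Z" and fr: "free a Z M"
  shows "\<exists>Z'\<in>small. a \<in> Z' \<and> free b Z' M"
proof -
  obtain P where P: "P \<in> \<K>" "le K P C" "M = universe P" by (rule smallE[OF M])
  obtain Q where Q: "Q \<in> \<K>" "le K Q C" "Z = universe Q" by (rule smallE[OF Z(1)])
  have aC: "a \<in> universe C" using a Union_small by simp
  obtain N where N: "N \<in> \<K>" "le K N C" "insert a Z \<subseteq> universe N"
    using cover[of "insert a Z"] aC small_subset_C[OF Z(1)] card_insert_le[OF card_small[OF Z(1)]] by blast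
  have PQ: "le K P Q" using le_common[OF P(2) Q(2)] freeD(3)[OF fr] P(3) Q(3) by simp
  have QN: "le K Q N" using le_common[OF Q(2) N(2)] N(3) Q(3) by simp
  have PN: "le K P N" by (rule le_trans[OF PQ QN])
  have "nonforking K \<kappa> (tp K a (universe Q) N) P Q"
    by (rule free_nonforking[OF Q(1) QN N(2) _ P(1,2)]) (use N(3) fr Q(3) P(3) in auto)
  then have "symmetry_witness K \<kappa> P N a b"
    unfolding symmetry_witness_def
    using all_limit[OF Q(1,2)] all_limit[OF N(1,2)] QN le_refl[OF models_of_cardD(1)[OF N(1)]] PQ Z(2) Q(3) by blast
  then have "symmetry_witness K \<kappa> P N b a"
    using symmetry all_limit[OF P(1,2)] all_limit[OF N(1,2)] PN N(3) Z(2) unfolding has_symmetry_def by blast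
  then obtain R N' where R: "limit_model K \<kappa> R" "limit_model K \<kappa> N'" "le K R N'" "le K N N'" "le K P R"
    "a \<in> universe R" "nonforking K \<kappa> (tp K b (universe R) N') P R"
    unfolding symmetry_witness_def by blast
  obtain e where e: "K_embedding K e N' C" "fixes_pointwise e (universe N)"
    by (rule embed_over[OF N(1,2) limit_model_card[OF R(2)] R(4)])
  have eb: "e b = b" "e a = a" using e(2) N(3) Z(2) by (auto simp: fixes_pointwise_def)
  have eP: "e ` universe P = M"
    using fixes_pointwise_image[OF fixes_pointwise_subset[OF e(2) leD(4)[OF PN]]] P(3) by simp
  have "b \<in> universe N'" using N(3) Z(2) leD(4)[OF R(4)] by blast
  from nonforking_free[OF R(7,3) this e(1)] have fb: "free b (e ` universe R) M" using eb eP by simp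
  have "a \<in> e ` universe R" using R(6) eb(2) by (metis imageI)
  then show ?thesis using fb freeD(2) by blast
qed

sublocale superstable_family \<kappa> small aut
  by unfold_locales (fact ex_univ_over local_character_small free_symmetric_small)+


section \<open>Independent sequences\<close>

lemma not_nonalgebraic:
  assumes "le K Q Q'" "a \<in> universe Q"
  shows "\<not> nonalgebraic K (tp K a (universe Q) Q') Q"
proof -
  have "((a, universe Q, Q), (id a, universe Q, Q')) \<in> tp_step K"
    by (rule tp_step_embed[OF K_embedding_id[OF assms(1)] _ order_refl assms(2)]) (simp add: fixes_pointwise_def)
  then show ?thesis using tp_eq_step assms(2) unfolding nonalgebraic_def by fastforce
qed

text \<open>An element of \<open>Q\<close> with the same type would be conjugate to \<open>a\<close>
  over \<open>Q\<close>, hence equal to \<open>a\<close>.\<close>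

lemma nonalgebraicI:
  assumes Q: "Q \<in> \<K>" "le K Q Q'" "le K Q' C" and a: "a \<in> universe Q'" "a \<notin> universe Q"
  shows "nonalgebraic K (tp K a (universe Q) Q') Q"
  unfolding nonalgebraic_def
proof
  assume "\<exists>c\<in>universe Q. tp K c (universe Q) Q = tp K a (universe Q) Q'"
  then obtain c where c: "c \<in> universe Q" "tp K c (universe Q) Q = tp K a (universe Q) Q'" by blast
  have QC: "le K Q C" by (rule le_trans[OF Q(2,3)])
  have "realizes id c (universe Q) Q c"
    by (rule realizes_id[OF Q(1) le_refl[OF leD(1)[OF Q(2)]] QC c(1)])
  moreover have "(a, universe Q, Q') \<in> tp K c (universe Q) Q"
    unfolding c(2) by (rule tp_self) (use leD[OF Q(2)] a in auto)
  ultimately have "realizes id a (universe Q) Q' c" using realizes_tp[OF Q(1)] by blast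
  then have "same_type c a (universe Q)"
    using realizes_unique[OF Q(1) _ realizes_id[OF Q a(1)]] by simp
  then show False using same_type_realized[OF _ c(1)] c(1) a(2) by blast
qed

end

context symmetric_monster
begin

text \<open>The map \<open>e\<close> is there because the model in which an independent sequence is
  witnessed need not lie in \<open>C\<close>.\<close>

lemma chain_free_system:
  assumes \<alpha>: "\<alpha> \<in> ords \<kappa>" and chain: "cont_chain K \<kappa> \<alpha> Q" and e: "K_embedding K e (Q \<alpha>) C"
    and a: "\<And>i. i \<in> below \<kappa> \<alpha> \<Longrightarrow> a i \<in> universe (Q (ord_suc \<kappa> i)) \<and>
      nonforking K \<kappa> (tp K (a i) (universe (Q i)) (Q (ord_suc \<kappa> i))) M (Q i)"
  shows "free_system \<alpha> (\<lambda>i. e ` universe (Q i)) (\<lambda>i. e ` universe (Q (ord_suc \<kappa> i))) (\<lambda>i. e (a i)) (e ` universe M)"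
  unfolding free_system_def
proof (intro ballI conjI)
  have QK: "Q i \<in> \<K>" if "ord_le \<kappa> i \<alpha>" for i using chain that unfolding cont_chain_def by blast
  have Qle: "le K (Q i) (Q j)" if "ord_le \<kappa> i j" "ord_le \<kappa> j \<alpha>" for i j
    using chain that unfolding cont_chain_def by blast
  have eQ: "K_embedding K e (Q i) C" if "ord_le \<kappa> i \<alpha>" for i
    by (rule K_embedding_subset[OF Qle[OF that ord_le_refl[OF \<alpha>]] e])
  fix i assume i: "i \<in> below \<kappa> \<alpha>"
  have le: "ord_le \<kappa> i \<alpha>" "ord_le \<kappa> (ord_suc \<kappa> i) \<alpha>" "ord_le \<kappa> i (ord_suc \<kappa> i)"
    using i ord_suc_least[OF below_ords(1)[OF i] i] below_ord_suc[OF below_ords(1)[OF i]] by (auto simp: below_iff)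
  show "e ` universe (Q (ord_suc \<kappa> i)) \<in> small" by (rule embedding_small(1)[OF eQ QK, OF le(2) le(2)])
  show "e ` universe (Q i) \<subseteq> e ` universe (Q (ord_suc \<kappa> i))" by (rule image_mono[OF leD(4)[OF Qle[OF le(3,2)]]])
  show "e (a i) \<in> e ` universe (Q (ord_suc \<kappa> i))" using a[OF i] by blast
  show "free (e (a i)) (e ` universe (Q i)) (e ` universe M)"
    using nonforking_free[OF _ Qle[OF le(3,2)] _ eQ[OF le(2)]] a[OF i] by blast
  show "e ` universe (Q (ord_suc \<kappa> k)) \<subseteq> e ` universe (Q i)" if k: "k \<in> below \<kappa> i" for k
    by (rule image_mono[OF leD(4)[OF Qle[OF ord_suc_least[OF below_ords(1)[OF k] k] le(1)]]])
qed

text \<open>Replacing \<open>X j\<close> by the union of all earlier \<open>X' k\<close> restores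
  continuity and only shrinks the set over which \<open>a j\<close> is free. The model
  \<open>M1\<close> has universe \<open>X\<close> at zero, which in the application contains the
  other sequence.\<close>

lemma free_system_independent:
  assumes sys: "free_system \<alpha> X X' a (universe M)" and ne: "below \<kappa> \<alpha> \<noteq> {}" and M: "M \<in> \<K>" "le K M C"
    and N: "N \<in> \<K>" "le K N C" "\<And>i. i \<in> below \<kappa> \<alpha> \<Longrightarrow> a i \<in> universe N"
    and a: "\<And>i. i \<in> below \<kappa> \<alpha> \<Longrightarrow> a i \<notin> universe M"
  obtains M1 N' where "M1 \<in> \<K>" "N' \<in> \<K>" "le K M M1" "le K M1 N'" "le K N N'"
    "universe M1 = X (ord_zero \<kappa>)" "independent K \<kappa> \<alpha> a M M1 N'"
proof -
  let ?z = "ord_zero \<kappa>"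
  have \<alpha>: "\<alpha> \<in> ords \<kappa>" using ne below_ords(2) by blast
  have dd: "ord_le \<kappa> \<alpha> \<alpha>" by (rule ord_le_refl[OF \<alpha>])
  have z: "?z \<in> below \<kappa> \<alpha>" using zero_below[OF \<alpha>] ne below_zero by blast
  note X = free_systemD[OF sys]
  have X'mono: "X' l \<subseteq> X' k" if "k \<in> below \<kappa> \<alpha>" "l \<in> below \<kappa> k" for k l
    using X(8)[OF that] X(2)[OF that(1)] by blast
  \<comment> \<open>At zero the union would be empty, so \<open>X\<close> is kept there. At a
    successor \<open>ord_suc \<kappa> k\<close> the union is \<open>X' k\<close>, which contains
    \<open>a k\<close>.\<close>
  define Y where "Y j = (if j = ?z then X ?z else \<Union>k\<in>below \<kappa> j. X' k)" for j
  have lt: "l \<in> below \<kappa> \<alpha>" if "l \<in> below \<kappa> k" "ord_le \<kappa> k \<alpha>" for k l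
    by (rule below_le_trans[OF that])
  have Ysmall: "Y j \<in> small" if j: "ord_le \<kappa> j \<alpha>" for j
  proof (cases "j = ?z")
    case True
    then show ?thesis using X(5)[OF z] by (simp add: Y_def)
  next
    case False
    then have "below \<kappa> j \<noteq> {}" using zero_below ord_le_ords(1)[OF j] by blast
    from union_closed[OF this X(1)[OF lt[OF _ j]] X'mono[OF lt[OF _ j]]] show ?thesis
      using False by (simp add: Y_def)
  qed
  have X0Y: "X ?z \<subseteq> Y j" if j: "ord_le \<kappa> j \<alpha>" for j
  proof (cases "j = ?z")
    case False
    then have "?z \<in> below \<kappa> j" using zero_below ord_le_ords(1)[OF j] by blast
    then show ?thesis using X(2)[OF z] False by (auto simp: Y_def)
  qed (simp add: Y_def)
  have YX: "Y j \<subseteq> X j" if "j \<in> below \<kappa> \<alpha>" for j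
    using X(8)[OF that] by (auto simp: Y_def)
  have X'Y: "X' k \<subseteq> Y j" if "k \<in> below \<kappa> j" for k j
    using that below_zero by (auto simp: Y_def)
  have Ymono: "Y i \<subseteq> Y j" if ij: "ord_le \<kappa> i j" "ord_le \<kappa> j \<alpha>" for i j
  proof (cases "i = ?z")
    case True
    then show ?thesis using X0Y[OF ij(2)] by (simp add: Y_def)
  next
    case False
    then show ?thesis using X'Y below_le_trans[OF _ ij(1)] by (auto simp: Y_def[of i])
  qed
  have Ylim: "Y i \<subseteq> (\<Union>j\<in>below \<kappa> i. Y j)" if i: "limit_ord \<kappa> i" for i
  proof -
    have "X' j \<subseteq> (\<Union>j\<in>below \<kappa> i. Y j)" if "j \<in> below \<kappa> i" for j
      using X'Y[OF below_ord_suc[OF below_ords(1)[OF that]]] limit_ord_suc[OF i that] by blast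
    moreover have "i \<noteq> ?z" using i not_limit_zero by blast
    then have "Y i = (\<Union>j\<in>below \<kappa> i. X' j)" by (simp add: Y_def)
    ultimately show ?thesis by (simp add: UN_least)
  qed
  obtain Q where chain: "cont_chain K \<kappa> \<alpha> Q"
    and Q0: "\<forall>k. ord_le \<kappa> k \<alpha> \<longrightarrow> Q k \<in> \<K> \<and> le K (Q k) C \<and> universe (Q k) = Y k"
    by (rule small_cont_chain[of \<alpha> Y, OF Ysmall Ymono Ylim])
  have Q: "Q k \<in> \<K>" "le K (Q k) C" "universe (Q k) = Y k" if "ord_le \<kappa> k \<alpha>" for k
    using Q0 that by auto
  have Qle: "le K (Q i) (Q j)" if "ord_le \<kappa> i j" "ord_le \<kappa> j \<alpha>" for i j
    using chain that unfolding cont_chain_def by blast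
  have zle: "ord_le \<kappa> ?z \<alpha>" by (rule ord_zero_le[OF \<alpha>])
  obtain N' where N': "N' \<in> \<K>" "le K N' C" "universe N \<union> Y \<alpha> \<subseteq> universe N'"
    using cover[of "universe N \<union> Y \<alpha>"] leD(4)[OF N(2)] small_subset_C[OF Ysmall[OF dd]]
      card_Un_le[OF card_model[OF N(1)] card_small[OF Ysmall[OF dd]]] by blast
  have QN': "le K (Q \<alpha>) N'" by (rule le_common[OF Q(2)[OF dd] N'(2)]) (use Q(3)[OF dd] N'(3) in simp)
  have NN': "le K N N'" by (rule le_common[OF N(2) N'(2)]) (use N'(3) in simp)
  have Q0N': "le K (Q ?z) N'" by (rule le_trans[OF Qle[OF zle dd] QN'])
  have MY: "universe M \<subseteq> Y j" if "ord_le \<kappa> j \<alpha>" for j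
    using X(7)[OF z] X0Y[OF that] by blast
  have MQ: "le K M (Q ?z)" by (rule le_common[OF M(2) Q(2)[OF zle]]) (use MY[OF zle] Q(3)[OF zle] in simp)
  have step: "a i \<in> universe (Q (ord_suc \<kappa> i)) \<and>
      nonalgebraic K (tp K (a i) (universe (Q i)) (Q (ord_suc \<kappa> i))) (Q i) \<and>
      nonforking K \<kappa> (tp K (a i) (universe (Q i)) (Q (ord_suc \<kappa> i))) M (Q i)"
    if i: "i \<in> below \<kappa> \<alpha>" for i
  proof -
    have le: "ord_le \<kappa> i \<alpha>" "ord_le \<kappa> (ord_suc \<kappa> i) \<alpha>" "ord_le \<kappa> i (ord_suc \<kappa> i)"
      using i ord_suc_least[OF below_ords(1)[OF i] i] below_ord_suc[OF below_ords(1)[OF i]] by (auto simp: below_iff)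
    have ai: "a i \<in> universe (Q (ord_suc \<kappa> i))"
      using X(3)[OF i] X'Y[OF below_ord_suc[OF below_ords(1)[OF i]]] Q(3)[OF le(2)] by auto
    have fr: "free (a i) (universe (Q i)) (universe M)"
      unfolding Q(3)[OF le(1)]
      by (rule free_mono[OF X(4)[OF i]]) (use MY[OF le(1)] YX[OF i] smallI[OF M] Ysmall[OF le(1)] in auto)
    have "a i \<notin> universe (Q i)" using free_realized[OF fr] a[OF i] by blast
    then have "nonalgebraic K (tp K (a i) (universe (Q i)) (Q (ord_suc \<kappa> i))) (Q i)"
      by (rule nonalgebraicI[OF Q(1)[OF le(1)] Qle[OF le(3,2)] Q(2)[OF le(2)] ai])
    moreover have "nonforking K \<kappa> (tp K (a i) (universe (Q i)) (Q (ord_suc \<kappa> i))) M (Q i)"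
      by (rule free_nonforking[OF Q(1)[OF le(1)] Qle[OF le(3,2)] Q(2)[OF le(2)] ai M fr])
    ultimately show ?thesis using ai by blast
  qed
  have "independent K \<kappa> \<alpha> a M (Q ?z) N'"
    unfolding independent_def
  proof (intro conjI ballI bexI[of _ N'] exI[of _ Q])
    show "a i \<in> universe N'" if "i \<in> below \<kappa> \<alpha>" for i using N(3)[OF that] N'(3) by blast
  qed (use \<alpha> M N' Q(1)[OF zle] MQ Q0N' chain QN' step le_refl[OF models_of_cardD(1)[OF N'(1)]]
      le_refl[OF models_of_cardD(1)[OF Q(1)[OF zle]]] in auto)
  moreover have "universe (Q ?z) = X ?z" using Q(3)[OF zle] by (simp add: Y_def)
  ultimately show ?thesis using that Q(1)[OF zle] N'(1) MQ Q0N' NN' by blast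
qed

end

theorem theorem5p33:
  fixes K :: "('a, 'f, 'r) class_data" and \<kappa> :: "'c rel"
    and M0 M2 N :: "('a, 'f, 'r) struct"
    and \<alpha>1 \<alpha>2 :: "'c set" and a1 a2 :: "'c set \<Rightarrow> 'a"
  assumes "Card_order \<kappa>"
    and "aec K"
    and "superstable K \<kappa>"
    and "has_symmetry K \<kappa>"
    and "categorical K \<kappa>"
    and "M0 \<in> models_of_card K \<kappa>" and "M2 \<in> models_of_card K \<kappa>" and "N \<in> models_of_card K \<kappa>"
    and "le K M0 M2" and "le K M2 N"
    and "\<alpha>1 \<in> ords \<kappa>" and "\<forall>i\<in>below \<kappa> \<alpha>1. a1 i \<in> universe N"
    and "independent K \<kappa> \<alpha>1 a1 M0 M2 N"
    and "\<alpha>2 \<in> ords \<kappa>" and "\<forall>i\<in>below \<kappa> \<alpha>2. a2 i \<in> universe M2"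
    and "independent K \<kappa> \<alpha>2 a2 M0 M0 N"
  shows "\<exists>M1\<in>models_of_card K \<kappa>. \<exists>N'\<in>models_of_card K \<kappa>.
           le K M0 M1 \<and> le K M1 N' \<and> le K N N' \<and>
           (\<forall>i\<in>below \<kappa> \<alpha>1. a1 i \<in> universe M1) \<and>
           independent K \<kappa> \<alpha>2 a2 M0 M1 N'"
proof -
  note ind1 = assms(13) and ind2 = assms(16)
  obtain Np Ps where Np: "Np \<in> models_of_card K \<kappa>" "le K N Np" and Ps: "cont_chain K \<kappa> \<alpha>1 Ps"
    "le K M2 (Ps (ord_zero \<kappa>))" "le K (Ps \<alpha>1) Np"
    and a1: "\<And>i. i \<in> below \<kappa> \<alpha>1 \<Longrightarrow> a1 i \<in> universe (Ps (ord_suc \<kappa> i)) \<and>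
      nonforking K \<kappa> (tp K (a1 i) (universe (Ps i)) (Ps (ord_suc \<kappa> i))) M0 (Ps i)"
    using ind1 unfolding independent_def by blast
  obtain Nq Qs where Nq: "Nq \<in> models_of_card K \<kappa>" "le K N Nq" and Qs: "cont_chain K \<kappa> \<alpha>2 Qs"
    "le K M0 (Qs (ord_zero \<kappa>))" "le K (Qs \<alpha>2) Nq"
    and a2: "\<And>i. i \<in> below \<kappa> \<alpha>2 \<Longrightarrow> a2 i \<in> universe (Qs (ord_suc \<kappa> i)) \<and>
      nonforking K \<kappa> (tp K (a2 i) (universe (Qs i)) (Qs (ord_suc \<kappa> i))) M0 (Qs i)"
    and a2_na: "\<And>i. i \<in> below \<kappa> \<alpha>2 \<Longrightarrow> nonalgebraic K (tp K (a2 i) (universe (Qs i)) (Qs (ord_suc \<kappa> i))) (Qs i)"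
    using ind2 unfolding independent_def by blast
  have M0N: "le K M0 N" using ind2 unfolding independent_def by blast
  show ?thesis
  proof (cases "below \<kappa> \<alpha>1 = {}")
    case True
    have "le K M0 M0" using ind2 unfolding independent_def by blast
    moreover have "\<forall>M\<in>models K. le K M M"
      using \<open>aec K\<close> unfolding aec_def abstract_class_def by blast
    then have "le K N N" using assms(8) unfolding models_of_card_def by blast
    ultimately show ?thesis using True ind2 M0N assms(6,8) by blast
  next
    case ne1: False
    \<comment> \<open>Nonforking includes that its base is a limit model, which supplies the limit
      model that the locale assumes.\<close>
    then have "limit_model K \<kappa> M0" using a1 unfolding nonforking_def by blast
    then interpret categorical_superstable K \<kappa>
      using assms(1-3,5) by unfold_locales auto
    \<comment> \<open>The homogeneous model is built above \<open>Np\<close>, so the chain of the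
      first sequence already lies in it.\<close>
    obtain C Cs where C: "C \<in> models K" "is_union (voc K) (Cs ` ords \<kappa>) C"
      and Cs: "\<And>i. i \<in> ords \<kappa> \<Longrightarrow> Cs i \<in> \<K> \<and> le K Np (Cs i) \<and> le K (Cs i) C"
      "\<And>i k. i \<in> ords \<kappa> \<Longrightarrow> k \<in> below \<kappa> i \<Longrightarrow> universal_over K \<kappa> (Cs i) (Cs k)"
      by (rule ex_universal_chain[OF Np(1)]) blast
    interpret symmetric_monster K \<kappa> C Cs
      by unfold_locales (use C Cs assms(4) in auto)
    have NpC: "le K Np C" using Cs(1)[OF ord_zero_ords] le_trans by blast
    have NC: "le K N C" by (rule le_trans[OF Np(2) NpC])
    have M2C: "le K M2 C" by (rule le_trans[OF assms(10) NC])
    have M0C: "le K M0 C" by (rule le_trans[OF assms(9) M2C])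
    show ?thesis
    proof (cases "below \<kappa> \<alpha>2 = {}")
      case True
      then have z: "\<alpha>2 = ord_zero \<kappa>" using zero_below assms(14) by blast
      have "cont_chain K \<kappa> \<alpha>2 (\<lambda>_. N)"
        unfolding cont_chain_def z using assms(8) le_refl models_of_cardD(1) ord_le_antisym ord_zero_le
          limit_ord_ords not_limit_zero by metis
      then have "independent K \<kappa> \<alpha>2 a2 M0 N N"
        unfolding independent_def using True assms(6,8,14) M0N le_refl[OF models_of_cardD(1)[OF assms(8)]] by blast
      then show ?thesis using assms(8,12) M0N le_refl[OF models_of_cardD(1)[OF assms(8)]] by blast
    next
      case ne2: False
      have "free_system \<alpha>1 (\<lambda>i. id ` universe (Ps i)) (\<lambda>i. id ` universe (Ps (ord_suc \<kappa> i)))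
          (\<lambda>i. id (a1 i)) (id ` universe M0)"
        by (rule chain_free_system[OF assms(11) Ps(1) K_embedding_id[OF le_trans[OF Ps(3) NpC]] a1])
      then have sys1: "free_system \<alpha>1 (\<lambda>i. universe (Ps i)) (\<lambda>i. universe (Ps (ord_suc \<kappa> i))) a1 (universe M0)"
        by simp
      \<comment> \<open>The second chain lives in a different extension of \<open>N\<close>; it is
        moved into \<open>C\<close> over \<open>N\<close>, which fixes \<open>a2\<close> and
        \<open>M0\<close>.\<close>
      obtain e where e: "K_embedding K e Nq C" "fixes_pointwise e (universe N)"
        by (rule embed_over[OF assms(8) NC Nq])
      have "free_system \<alpha>2 (\<lambda>i. e ` universe (Qs i)) (\<lambda>i. e ` universe (Qs (ord_suc \<kappa> i)))
          (\<lambda>i. e (a2 i)) (e ` universe M0)"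
        by (rule chain_free_system[OF assms(14) Qs(1) K_embedding_subset[OF Qs(3) e(1)] a2])
      moreover have "e (a2 i) = a2 i" if "i \<in> below \<kappa> \<alpha>2" for i
        using e(2) assms(15) leD(4)[OF assms(10)] that by (auto simp: fixes_pointwise_def)
      moreover have "e ` universe M0 = universe M0"
        using fixes_pointwise_image[OF fixes_pointwise_subset[OF e(2) leD(4)[OF M0N]]] .
      ultimately have sys2: "free_system \<alpha>2 (\<lambda>i. e ` universe (Qs i)) (\<lambda>i. e ` universe (Qs (ord_suc \<kappa> i))) a2 (universe M0)"
        unfolding free_system_def by simp
      have M2P: "universe M2 \<subseteq> universe (Ps i)" if "i \<in> below \<kappa> \<alpha>1" for i
      proof -
        have "le K (Ps (ord_zero \<kappa>)) (Ps i)"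
          using Ps(1) ord_zero_le[OF below_ords(1)[OF that]] that unfolding cont_chain_def below_iff by blast
        then show ?thesis using leD(4)[OF Ps(2)] leD(4) by blast
      qed
      \<comment> \<open>\<open>M2\<close> plays the role of \<open>L\<close>: it contains the second
        sequence and lies below every member of the first chain.\<close>
      obtain X X' where X: "free_system \<alpha>2 X X' a2 (universe M0)"
        and a1X: "\<And>i j. i \<in> below \<kappa> \<alpha>1 \<Longrightarrow> j \<in> below \<kappa> \<alpha>2 \<Longrightarrow> a1 i \<in> X j"
        by (rule free_systems_exchange[OF sys1 sys2 ne1 smallI[OF assms(7) M2C] leD(4)[OF assms(9)] M2P])
          (use assms(15) in blast)+
      have a2N: "a2 i \<in> universe N" if "i \<in> below \<kappa> \<alpha>2" for i
        using assms(15) leD(4)[OF assms(10)] that by blast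
      \<comment> \<open>\<open>M0\<close> lies below every \<open>Qs i\<close>, so an element of
        \<open>M0\<close> would have an algebraic type over \<open>Qs i\<close>.\<close>
      have a2M0: "a2 i \<notin> universe M0" if i: "i \<in> below \<kappa> \<alpha>2" for i
      proof
        assume "a2 i \<in> universe M0"
        moreover have le: "ord_le \<kappa> (ord_suc \<kappa> i) \<alpha>2" "ord_le \<kappa> i (ord_suc \<kappa> i)" "ord_le \<kappa> i \<alpha>2"
          using i ord_suc_least[OF below_ords(1)[OF i] i] below_ord_suc[OF below_ords(1)[OF i]] by (auto simp: below_iff)
        have "le K (Qs (ord_zero \<kappa>)) (Qs i)" and step: "le K (Qs i) (Qs (ord_suc \<kappa> i))"
          using Qs(1) ord_zero_le[OF below_ords(1)[OF i]] le unfolding cont_chain_def by blast+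
        ultimately have "a2 i \<in> universe (Qs i)" using leD(4)[OF Qs(2)] leD(4) by blast
        then show False using not_nonalgebraic[OF step] a2_na[OF i] by blast
      qed
      obtain M1 N' where M1: "M1 \<in> \<K>" "N' \<in> \<K>" "le K M0 M1" "le K M1 N'" "le K N N'"
        "universe M1 = X (ord_zero \<kappa>)" "independent K \<kappa> \<alpha>2 a2 M0 M1 N'"
        by (rule free_system_independent[OF X ne2 assms(6) M0C assms(8) NC a2N a2M0])
      have "ord_zero \<kappa> \<in> below \<kappa> \<alpha>2" using zero_below[OF assms(14)] ne2 below_zero by blast
      then have "\<forall>i\<in>below \<kappa> \<alpha>1. a1 i \<in> universe M1" using a1X M1(6) by blast
      then show ?thesis using M1 by blast
    qed
  qed
qed

end
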